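(* Let $H_0,H_1$ be complex Hilbert spaces, $G$ a densely defined closed operator from $H_0$ into $H_1$ and $D$ a densely defined closed operator from $H_1$ into $H_0$ with $-G^*\subset D$, and assume the inclusion $\mathrm{dom}(G)\subset H_0$ is compact. Let $H$ be a Hilbert space and $\kappa\in\mathcal{L}(\mathrm{BD}(G),H)$ injective with dense range. Let $a,a_1,a_2,\ldots\in\mathcal{L}(H_1)$, $m,m_1,m_2,\ldots\in\mathcal{L}(H_0)$ and $\mu>0$ with $\mathrm{Re}\,a_n\ge\mu I$ for all $n$, $\mathrm{Re}\,a\ge\mu I$ and $\sup_n\|a_n\|<\infty$. Suppose $(a_n)$ converges to $a$ independent of the boundary conditions and $m_n\to m$ in the weak operator topology on $\mathcal{L}(H_0)$. Assume $\ker(m_n-Da_n\mathring G)=\{0\}$ for all $n$ and $\ker(m-Da\mathring G)=\{0\}$. Let $\Lambda_H^{(n)}$ and $\Lambda_H$ be the Dirichlet-to-Neumann operators in $H$ associated with $-Da_nG+m_n$ and $-DaG+m$. Then: (a) the sequence $(\Lambda_H^{(n)})_{n}$ is uniformly sectorial; (b) there is $\lambda_0>0$ such that for all $\lambda>\lambda_0$, $(\lambda I+\Lambda_H^{(n)})^{-1}\to(\lambda I+\Lambda_H)^{-1}$ in the weak operator topology on $\mathcal{L}(H)$; (c) if $\kappa$ is compact, there is $\lambda_0>0$ such that for all $\lambda>\lambda_0$, $(\lambda I+\Lambda_H^{(n)})^{-1}\to(\lambda I+\Lambda_H)^{-1}$ in operator norm in $\mathcal{L}(H)$.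
   Context: Put $\mathring D=-G^*$, $\mathring G=-D^*$. Domains carry graph inner products. $\mathrm{BD}(G)$ (resp. $\mathrm{BD}(D)$) is the orthogonal complement of $\mathrm{dom}(\mathring G)$ in $\mathrm{dom}(G)$ (resp. of $\mathrm{dom}(\mathring D)$ in $\mathrm{dom}(D)$) with induced inner products, and $\pi_{\mathrm{BD}(G)},\pi_{\mathrm{BD}(D)}$ the orthogonal projections. $G$ maps $\mathrm{BD}(G)$ into $\mathrm{BD}(D)$. $\ker(m-Da\mathring G)=\{u\in\mathrm{dom}(\mathring G): a\mathring G u\in\mathrm{dom}(D),\ mu=Da\mathring Gu\}$. For $m\in\mathcal L(H_0)$ and $a\in\mathcal L(H_1)$ the Dirichlet-to-Neumann graph is $\Lambda=\{(\pi_{\mathrm{BD}(G)}u,\pi_{\mathrm{BD}(D)}aGu): u\in\mathrm{dom}(G),\ aGu\in\mathrm{dom}(D),\ mu-DaGu=0\}\subset\mathrm{BD}(G)\times\mathrm{BD}(D)$, and the Dirichlet-to-Neumann graph in $H$ is $\Lambda_H=\{(\varphi,\psi)\in H\times H:\exists u_0\in\mathrm{BD}(G),\ \kappa(u_0)=\varphi,\ (u_0,G\kappa^*\psi)\in\Lambda\}$, with $\kappa^*\colon H\to\mathrm{BD}(G)$ the adjoint; it is single-valued (an operator) when $\ker(m-Da\mathring G)=\{0\}$. The sequence $(a_n)$ of coercive operators converges to the coercive $a$ independent of the boundary conditions if for every strictly increasing $(n_k)$ in $\mathbb N$, all $f,f_k\in H_0$ and all $u,u_k\in\mathrm{dom}(G)$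 with $f_k\to f$ weakly in $H_0$, $u_k\to u$ weakly in $\mathrm{dom}(G)$, and $a_{n_k}Gu_k\in\mathrm{dom}(D)$, $-Da_{n_k}Gu_k=f_k$ for all $k$, it follows that $a_{n_k}Gu_k\to aGu$ weakly in $H_1$. A sequence of operators $A_n$ in $H$ is uniformly sectorial if there are $\omega\in\mathbb R$ and $c\ge0$ such that $|\mathrm{Im}((A_n+\omega)\varphi,\varphi)_H|\le c\,\mathrm{Re}((A_n+\omega)\varphi,\varphi)_H$ for all $n$ and $\varphi\in\mathrm{dom}(A_n)$. *)

theory Defs
  imports "HOL-Analysis.Analysis"
begin

text \<open>HOL-Analysis has only real inner product spaces. A complex Hilbert space is
represented (standard identification) as a real Hilbert space together with an
orthogonal complex structure ciu (multiplication by the imaginary unit).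
The complex inner product, linear in the first argument, is
  cinner x y = inner x y - i * inner (ciu x) y.\<close>

class chilbert = real_inner + complete_space +
  fixes ciu :: "'a \<Rightarrow> 'a"
  assumes ciu_add: "ciu (x + y) = ciu x + ciu y"
    and ciu_scaleR: "ciu (r *\<^sub>R x) = r *\<^sub>R ciu x"
    and ciu_ciu: "ciu (ciu x) = - x"
    and ciu_inner: "inner (ciu x) (ciu y) = inner x y"

definition cscale :: "complex \<Rightarrow> 'a::chilbert \<Rightarrow> 'a" where
  "cscale c x = Re c *\<^sub>R x + Im c *\<^sub>R ciu x"

definition cinner :: "'a::chilbert \<Rightarrow> 'a \<Rightarrow> complex" where
  "cinner x y = complex_of_real (inner x y) - \<i> * complex_of_real (inner (ciu x) y)"

definition csubspace :: "'a::chilbert set \<Rightarrow> bool" where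
  "csubspace S \<longleftrightarrow> 0 \<in> S \<and> (\<forall>x\<in>S. \<forall>y\<in>S. x + y \<in> S) \<and> (\<forall>c. \<forall>x\<in>S. cscale c x \<in> S)"

definition clinear_on :: "'a::chilbert set \<Rightarrow> ('a \<Rightarrow> 'b::chilbert) \<Rightarrow> bool" where
  "clinear_on S f \<longleftrightarrow> csubspace S \<and> (\<forall>x\<in>S. \<forall>y\<in>S. f (x + y) = f x + f y)
      \<and> (\<forall>c. \<forall>x\<in>S. f (cscale c x) = cscale c (f x))"

definition cbounded :: "('a::chilbert \<Rightarrow> 'b::chilbert) \<Rightarrow> bool" where
  "cbounded f \<longleftrightarrow> clinear_on UNIV f \<and> bounded_linear f"

definition graph_of :: "'a set \<Rightarrow> ('a \<Rightarrow> 'b) \<Rightarrow> ('a \<times> 'b) set" where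
  "graph_of S f = {(x, f x) | x. x \<in> S}"

definition dd_closed_op :: "'a::chilbert set \<Rightarrow> ('a \<Rightarrow> 'b::chilbert) \<Rightarrow> bool" where
  "dd_closed_op S f \<longleftrightarrow> clinear_on S f \<and> closure S = UNIV \<and> closed (graph_of S f)"

definition adj_dom :: "'a::chilbert set \<Rightarrow> ('a \<Rightarrow> 'b::chilbert) \<Rightarrow> 'b set" where
  "adj_dom S f = {y. \<exists>z. \<forall>x\<in>S. cinner (f x) y = cinner x z}"

definition adj :: "'a::chilbert set \<Rightarrow> ('a \<Rightarrow> 'b::chilbert) \<Rightarrow> 'b \<Rightarrow> 'a" where
  "adj S f y = (THE z. \<forall>x\<in>S. cinner (f x) y = cinner x z)"

definition ginner :: "('a::chilbert \<Rightarrow> 'b::chilbert) \<Rightarrow> 'a \<Rightarrow> 'a \<Rightarrow> complex" where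
  "ginner f x y = cinner x y + cinner (f x) (f y)"

definition gnorm :: "('a::chilbert \<Rightarrow> 'b::chilbert) \<Rightarrow> 'a \<Rightarrow> real" where
  "gnorm f x = sqrt ((norm x)\<^sup>2 + (norm (f x))\<^sup>2)"

definition compact_embedding :: "'a::chilbert set \<Rightarrow> ('a \<Rightarrow> 'b::chilbert) \<Rightarrow> bool" where
  "compact_embedding S f \<longleftrightarrow>
     (\<forall>B. B \<subseteq> S \<and> (\<exists>C. \<forall>x\<in>B. gnorm f x \<le> C) \<longrightarrow> compact (closure B))"

definition Gring_dom :: "'b::chilbert set \<Rightarrow> ('b \<Rightarrow> 'a::chilbert) \<Rightarrow> 'a set" where
  "Gring_dom domD D = adj_dom domD D"

definition Gring :: "'b::chilbert set \<Rightarrow> ('b \<Rightarrow> 'a::chilbert) \<Rightarrow> 'a \<Rightarrow> 'b" where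
  "Gring domD D x = - adj domD D x"

definition Dring_dom :: "'a::chilbert set \<Rightarrow> ('a \<Rightarrow> 'b::chilbert) \<Rightarrow> 'b set" where
  "Dring_dom domG G = adj_dom domG G"

definition Dring :: "'a::chilbert set \<Rightarrow> ('a \<Rightarrow> 'b::chilbert) \<Rightarrow> 'b \<Rightarrow> 'a" where
  "Dring domG G y = - adj domG G y"

definition BD_space :: "'a::chilbert set \<Rightarrow> ('a \<Rightarrow> 'b::chilbert) \<Rightarrow> 'a set \<Rightarrow> 'a set" where
  "BD_space S f S0 = {u \<in> S. \<forall>v\<in>S0. ginner f u v = 0}"

definition BD_G :: "'a::chilbert set \<Rightarrow> ('a \<Rightarrow> 'b::chilbert) \<Rightarrow> 'b set \<Rightarrow> ('b \<Rightarrow> 'a) \<Rightarrow> 'a set" where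
  "BD_G domG G domD D = BD_space domG G (Gring_dom domD D)"

definition BD_D :: "'a::chilbert set \<Rightarrow> ('a \<Rightarrow> 'b::chilbert) \<Rightarrow> 'b set \<Rightarrow> ('b \<Rightarrow> 'a) \<Rightarrow> 'b set" where
  "BD_D domG G domD D = BD_space domD D (Dring_dom domG G)"

text \<open>orthogonal projection of S onto BD = S0-perp (u = pi u + (u - pi u), u - pi u in S0)\<close>

definition BD_proj :: "'a::chilbert set \<Rightarrow> 'a set \<Rightarrow> 'a \<Rightarrow> 'a" where
  "BD_proj S0 B u = (THE w. w \<in> B \<and> u - w \<in> S0)"

definition pi_BDG :: "'a::chilbert set \<Rightarrow> ('a \<Rightarrow> 'b::chilbert) \<Rightarrow> 'b set \<Rightarrow> ('b \<Rightarrow> 'a) \<Rightarrow> 'a \<Rightarrow> 'a" where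
  "pi_BDG domG G domD D = BD_proj (Gring_dom domD D) (BD_G domG G domD D)"

definition pi_BDD :: "'a::chilbert set \<Rightarrow> ('a \<Rightarrow> 'b::chilbert) \<Rightarrow> 'b set \<Rightarrow> ('b \<Rightarrow> 'a) \<Rightarrow> 'b \<Rightarrow> 'b" where
  "pi_BDD domG G domD D = BD_proj (Dring_dom domG G) (BD_D domG G domD D)"

definition ker_trivial ::
  "'a::chilbert set \<Rightarrow> ('a \<Rightarrow> 'b::chilbert) \<Rightarrow> 'b set \<Rightarrow> ('b \<Rightarrow> 'a) \<Rightarrow> ('b \<Rightarrow> 'b) \<Rightarrow> ('a \<Rightarrow> 'a) \<Rightarrow> bool" where
  "ker_trivial domG G domD D a m \<longleftrightarrow>
     {u \<in> Gring_dom domD D. a (Gring domD D u) \<in> domD \<and> m u = D (a (Gring domD D u))} = {0}"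

definition DtN ::
  "'a::chilbert set \<Rightarrow> ('a \<Rightarrow> 'b::chilbert) \<Rightarrow> 'b set \<Rightarrow> ('b \<Rightarrow> 'a) \<Rightarrow> ('b \<Rightarrow> 'b) \<Rightarrow> ('a \<Rightarrow> 'a) \<Rightarrow> ('a \<times> 'b) set" where
  "DtN domG G domD D a m =
     {(pi_BDG domG G domD D u, pi_BDD domG G domD D (a (G u))) | u.
        u \<in> domG \<and> a (G u) \<in> domD \<and> m u - D (a (G u)) = 0}"

definition kappa_adj ::
  "'a::chilbert set \<Rightarrow> ('a \<Rightarrow> 'b::chilbert) \<Rightarrow> 'b set \<Rightarrow> ('b \<Rightarrow> 'a) \<Rightarrow> ('a \<Rightarrow> 'h::chilbert) \<Rightarrow> 'h \<Rightarrow> 'a" where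
  "kappa_adj domG G domD D \<kappa> \<phi> =
     (THE w. w \<in> BD_G domG G domD D \<and> (\<forall>u\<in>BD_G domG G domD D. cinner (\<kappa> u) \<phi> = ginner G u w))"

definition DtN_H ::
  "'a::chilbert set \<Rightarrow> ('a \<Rightarrow> 'b::chilbert) \<Rightarrow> 'b set \<Rightarrow> ('b \<Rightarrow> 'a) \<Rightarrow> ('a \<Rightarrow> 'h::chilbert)
     \<Rightarrow> ('b \<Rightarrow> 'b) \<Rightarrow> ('a \<Rightarrow> 'a) \<Rightarrow> ('h \<times> 'h) set" where
  "DtN_H domG G domD D \<kappa> a m =
     {(\<phi>, \<psi>). \<exists>u0\<in>BD_G domG G domD D. \<kappa> u0 = \<phi> \<and>
        (u0, G (kappa_adj domG G domD D \<kappa> \<psi>)) \<in> DtN domG G domD D a m}"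

definition op_dom :: "('h \<times> 'h) set \<Rightarrow> 'h set" where
  "op_dom L = Domain L"

definition op_fun :: "('h \<times> 'h) set \<Rightarrow> 'h \<Rightarrow> 'h" where
  "op_fun L \<phi> = (THE \<psi>. (\<phi>, \<psi>) \<in> L)"

definition weak_conv :: "(nat \<Rightarrow> 'a::chilbert) \<Rightarrow> 'a \<Rightarrow> bool" where
  "weak_conv x l \<longleftrightarrow> (\<forall>y. (\<lambda>k. cinner (x k) y) \<longlonglongrightarrow> cinner l y)"

definition weak_conv_graph :: "'a::chilbert set \<Rightarrow> ('a \<Rightarrow> 'b::chilbert) \<Rightarrow> (nat \<Rightarrow> 'a) \<Rightarrow> 'a \<Rightarrow> bool" where
  "weak_conv_graph S f x l \<longleftrightarrow> (\<forall>k. x k \<in> S) \<and> l \<in> S \<and>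
     (\<forall>v\<in>S. (\<lambda>k. ginner f (x k) v) \<longlonglongrightarrow> ginner f l v)"

definition wot_conv :: "(nat \<Rightarrow> 'a::chilbert \<Rightarrow> 'b::chilbert) \<Rightarrow> ('a \<Rightarrow> 'b) \<Rightarrow> bool" where
  "wot_conv T L \<longleftrightarrow> (\<forall>x. weak_conv (\<lambda>n. T n x) (L x))"

definition coercive :: "('b::chilbert \<Rightarrow> 'b) \<Rightarrow> real \<Rightarrow> bool" where
  "coercive a \<mu> \<longleftrightarrow> (\<forall>x. Re (cinner (a x) x) \<ge> \<mu> * (norm x)\<^sup>2)"

definition conv_indep_bc ::
  "'a::chilbert set \<Rightarrow> ('a \<Rightarrow> 'b::chilbert) \<Rightarrow> 'b set \<Rightarrow> ('b \<Rightarrow> 'a)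
     \<Rightarrow> (nat \<Rightarrow> 'b \<Rightarrow> 'b) \<Rightarrow> ('b \<Rightarrow> 'b) \<Rightarrow> bool" where
  "conv_indep_bc domG G domD D an a \<longleftrightarrow>
     (\<forall>r f fk u uk. strict_mono r \<and> weak_conv fk f \<and> weak_conv_graph domG G uk u \<and>
        (\<forall>k. an (r k) (G (uk k)) \<in> domD \<and> - D (an (r k) (G (uk k))) = fk k)
        \<longrightarrow> weak_conv (\<lambda>k. an (r k) (G (uk k))) (a (G u)))"

definition uniformly_sectorial :: "(nat \<Rightarrow> 'h set) \<Rightarrow> (nat \<Rightarrow> 'h \<Rightarrow> 'h::chilbert) \<Rightarrow> bool" where
  "uniformly_sectorial S A \<longleftrightarrow> (\<exists>\<omega>::real. \<exists>c::real. c \<ge> 0 \<and>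
     (\<forall>n. \<forall>\<phi>\<in>S n. \<bar>Im (cinner (A n \<phi> + \<omega> *\<^sub>R \<phi>) \<phi>)\<bar> \<le> c * Re (cinner (A n \<phi> + \<omega> *\<^sub>R \<phi>) \<phi>)))"

definition resolvent :: "'h set \<Rightarrow> ('h \<Rightarrow> 'h::chilbert) \<Rightarrow> real \<Rightarrow> 'h \<Rightarrow> 'h" where
  "resolvent S A lam f = (THE \<phi>. \<phi> \<in> S \<and> lam *\<^sub>R \<phi> + A \<phi> = f)"

definition resolvent_in_L :: "'h set \<Rightarrow> ('h \<Rightarrow> 'h::chilbert) \<Rightarrow> real \<Rightarrow> bool" where
  "resolvent_in_L S A lam \<longleftrightarrow> bij_betw (\<lambda>\<phi>. lam *\<^sub>R \<phi> + A \<phi>) S UNIV \<and> cbounded (resolvent S A lam)"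

definition bounded_on_graph :: "'a::chilbert set \<Rightarrow> ('a \<Rightarrow> 'b::chilbert) \<Rightarrow> ('a \<Rightarrow> 'h::chilbert) \<Rightarrow> bool" where
  "bounded_on_graph B G \<kappa> \<longleftrightarrow> clinear_on B \<kappa> \<and> (\<exists>C. \<forall>u\<in>B. norm (\<kappa> u) \<le> C * gnorm G u)"

definition compact_on_graph :: "'a::chilbert set \<Rightarrow> ('a \<Rightarrow> 'b::chilbert) \<Rightarrow> ('a \<Rightarrow> 'h::chilbert) \<Rightarrow> bool" where
  "compact_on_graph B G \<kappa> \<longleftrightarrow>
     (\<forall>X. X \<subseteq> B \<and> (\<exists>C. \<forall>u\<in>X. gnorm G u \<le> C) \<longrightarrow> compact (closure (\<kappa> ` X)))"

end

theory Submission
  imports Defs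
begin

text \<open>All operators are encoded by their graphs. In the product of the two spaces put
  \<open>\<Gamma>\<close> for the graph of \<open>G\<close>, \<open>\<Gamma>0\<close> for the graph of its restriction \<open>- D\<^sup>*\<close> and \<open>\<Gamma>1\<close> for the
  orthogonal complement of \<open>\<Gamma>0\<close> in \<open>\<Gamma>\<close>; up to swapping the factors, the graph of \<open>D\<close> is the
  orthogonal complement of \<open>\<Gamma>0\<close>. With \<open>J\<close> the map \<open>\<kappa>\<close> after the projection onto \<open>\<Gamma>1\<close> and
  \<open>B (x, y) = (m x, a y)\<close>, the Dirichlet-to-Neumann operator in \<open>H\<close> is the operator associated
  with the form \<open>(p, q) \<mapsto> (B p, q)\<close> on \<open>\<Gamma>\<close> and the non-injective map \<open>J\<close>.

  The form satisfies a Garding inequality, and triviality of the kernels together with the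
  compact embedding upgrades it, by contradiction and uniformly along the sequence, to coercivity
  modulo \<open>(norm (J p))\<^sup>2\<close> on the solutions of the interior equation. This gives sectoriality.
  Solvability of the resolvent equation follows from uniqueness by the Fredholm alternative.
  Bounded sequences of solutions have weak limit points, which solve the limit equation because of
  the convergence independent of the boundary conditions; uniqueness identifies them.
  If \<open>\<kappa>\<close> is compact, the same argument with weakly convergent right-hand sides yields convergence
  in norm.\<close>

section \<open>Closed subspaces of Hilbert spaces\<close>

text \<open>Only real inner products enter the functional analysis: on sets invariant under
  multiplication by the imaginary unit, testing with a vector and with its multiple by that unit
  recovers the complex identities. The interior equation \<open>D (a (G u)) = m u\<close> becomes
  orthogonality of \<open>B p\<close> to \<open>\<Gamma>0\<close>, and a single projection onto
  \<open>\<Gamma>1\<close> encodes both boundary projections. The obstacle is that the form need not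
  be coercive modulo \<open>J\<close> on all of \<open>\<Gamma>\<close>: \<open>J\<close> vanishes
  on \<open>\<Gamma>0\<close>, where a trivial kernel excludes null solutions but not negative
  values of the form. Coercivity can be expected on interior solutions only, and these are also the
  elements that the convergence hypothesis speaks of. This is why existence rests on a Fredholm
  argument instead of the Lax-Milgram lemma alone. Weakly convergent subsequences come from an
  injective compact map, the first projection on \<open>\<Gamma>\<close>: for a bounded sequence,
  convergence of the images already forces weak convergence. Strong convergence of the first
  components also lets \<open>mn n\<close> be applied to a varying argument although it converges
  only weakly.\<close>

lemma parallelogram:
  fixes x y :: "'x::real_inner"
  shows "(norm (x + y))\<^sup>2 + (norm (x - y))\<^sup>2 = 2 * (norm x)\<^sup>2 + 2 * (norm y)\<^sup>2"
  by (simp add: power2_norm_eq_inner inner_add_left inner_add_right inner_diff_left inner_diff_right)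

text \<open>Midpoints of a minimising sequence stay in \<open>S\<close>, so the parallelogram law
  makes the sequence Cauchy. Minimality along each line through the limit then gives
  orthogonality.\<close>

lemma closed_subspace_projection:
  fixes S :: "'x::{real_inner,complete_space} set"
  assumes "closed S" "subspace S"
  obtains p where "p \<in> S" "\<And>q. q \<in> S \<Longrightarrow> inner (x - p) q = 0"
proof -
  define d where "d = infdist x S"
  have ne: "S \<noteq> {}" using assms(2) subspace_0 by blast
  have d0: "d \<ge> 0" by (simp add: d_def infdist_nonneg)
  have low: "d \<le> norm (x - q)" if "q \<in> S" for q
    using infdist_le[OF that, of x] by (simp add: d_def dist_norm)
  have "\<exists>q\<in>S. norm (x - q) < d + 1 / real (Suc k)" for k
  proof -
    have "infdist x S < d + 1 / real (Suc k)" by (simp add: d_def)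
    then show ?thesis
      using ne cInf_lessD[of "dist x ` S"] unfolding infdist_notempty[OF ne] dist_norm[symmetric]
      by auto
  qed
  then obtain q where qS: "\<And>k. q k \<in> S" and q: "\<And>k. norm (x - q k) < d + 1 / real (Suc k)"
    by metis
  have key: "(dist (q i) (q j))\<^sup>2 \<le> 4 * (2 * d + 1) * (1 / real (Suc k))" if "k \<le> i" "k \<le> j" for i j k
  proof -
    let ?e = "1 / real (Suc k)"
    have e: "0 < ?e" "?e \<le> 1" by (auto simp: divide_le_eq)
    have le: "1 / real (Suc i) \<le> ?e" "1 / real (Suc j) \<le> ?e"
      using that by (simp_all add: frac_le)
    have ni: "(norm (x - q i))\<^sup>2 \<le> (d + ?e)\<^sup>2" "(norm (x - q j))\<^sup>2 \<le> (d + ?e)\<^sup>2"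
      using q[of i] q[of j] le by (auto intro!: power_mono)
    have mid: "(1/2) *\<^sub>R (q i + q j) \<in> S"
      using assms(2) qS by (simp add: subspace_add subspace_scale)
    have "d \<le> norm (x - (1/2) *\<^sub>R (q i + q j))" by (rule low[OF mid])
    also have "x - (1/2) *\<^sub>R (q i + q j) = (1/2) *\<^sub>R ((x - q i) + (x - q j))"
      by (simp add: scaleR_add_right scaleR_diff_right flip: scaleR_left_distrib)
    finally have "2 * d \<le> norm ((x - q i) + (x - q j))" by simp
    then have "(2 * d)\<^sup>2 \<le> (norm ((x - q i) + (x - q j)))\<^sup>2" using d0 by (intro power_mono) auto
    moreover have "(norm ((x - q i) - (x - q j)))\<^sup>2 = (dist (q i) (q j))\<^sup>2"
      by (simp add: dist_norm norm_minus_commute)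
    ultimately have "(dist (q i) (q j))\<^sup>2 \<le> 4 * (d + ?e)\<^sup>2 - 4 * d\<^sup>2"
      using parallelogram[of "x - q i" "x - q j"] ni by (simp add: power_mult_distrib)
    also have "\<dots> = 4 * (2 * d + ?e) * ?e" by (simp add: power2_eq_square algebra_simps)
    also have "\<dots> \<le> 4 * (2 * d + 1) * ?e" using e by (intro mult_right_mono mult_left_mono) auto
    finally show ?thesis .
  qed
  have "Cauchy q"
  proof (rule metric_CauchyI)
    fix \<epsilon> :: real assume \<epsilon>: "\<epsilon> > 0"
    obtain k where k: "4 * (2 * d + 1) / \<epsilon>\<^sup>2 < real (Suc k)"
      by (meson reals_Archimedean2 less_trans of_nat_less_iff lessI)
    show "\<exists>M. \<forall>m\<ge>M. \<forall>n\<ge>M. dist (q m) (q n) < \<epsilon>"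
    proof (intro exI allI impI)
      fix i j assume "k \<le> i" "k \<le> j"
      then have "(dist (q i) (q j))\<^sup>2 \<le> 4 * (2 * d + 1) * (1 / real (Suc k))" by (rule key)
      also have "\<dots> < \<epsilon>\<^sup>2" using k \<epsilon> by (simp add: field_simps)
      finally show "dist (q i) (q j) < \<epsilon>" using \<epsilon> by (simp add: power2_less_imp_less)
    qed
  qed
  then obtain p where p: "q \<longlonglongrightarrow> p" by (auto simp: Cauchy_convergent_iff convergent_def)
  have pS: "p \<in> S" using closed_sequentially[OF assms(1)] qS p by blast
  have "(\<lambda>k. norm (x - q k)) \<longlonglongrightarrow> norm (x - p)" by (intro tendsto_intros p)
  moreover have "(\<lambda>k. d + 1 / real (Suc k)) \<longlonglongrightarrow> d + 0"
    by (intro tendsto_intros LIMSEQ_Suc[OF lim_1_over_n])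
  ultimately have pd: "norm (x - p) \<le> d"
    using LIMSEQ_le[of "\<lambda>k. norm (x - q k)" "norm (x - p)" "\<lambda>k. d + 1 / real (Suc k)" "d + 0"] q
    by (auto intro: less_imp_le)
  have "inner (x - p) s = 0" if s: "s \<in> S" for s
  proof (cases "s = 0")
    case False
    \<comment> \<open>The value of \<open>t\<close> that minimises
      \<open>(norm (x - p - t *\<^sub>R s))\<^sup>2\<close>.\<close>
    define t where "t = inner (x - p) s / inner s s"
    have ss: "inner s s > 0" using False by simp
    have "p + t *\<^sub>R s \<in> S" using assms(2) pS s by (simp add: subspace_add subspace_scale)
    then have "norm (x - p) \<le> norm (x - (p + t *\<^sub>R s))" using low pd by fastforce
    then have "(norm (x - p))\<^sup>2 \<le> (norm (x - p - t *\<^sub>R s))\<^sup>2" by (intro power_mono) (auto simp: algebra_simps)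
    also have "\<dots> = (norm (x - p))\<^sup>2 - 2 * t * inner (x - p) s + t\<^sup>2 * inner s s"
      unfolding power2_norm_eq_inner by (simp add: inner_diff_left inner_diff_right inner_commute power2_eq_square algebra_simps)
    finally have "2 * t * inner (x - p) s \<le> t\<^sup>2 * inner s s" by simp
    then have "(inner (x - p) s)\<^sup>2 \<le> 0"
      using ss by (simp add: t_def power2_eq_square field_simps)
    then show ?thesis by simp
  qed simp
  with pS show ?thesis by (rule that)
qed

definition orth_proj :: "'x::{real_inner,complete_space} set \<Rightarrow> 'x \<Rightarrow> 'x" where
  "orth_proj S x = (SOME p. p \<in> S \<and> (\<forall>q\<in>S. inner (x - p) q = 0))"

context
  fixes S :: "'x::{real_inner,complete_space} set"
  assumes S: "closed S" "subspace S"
begin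

lemma orth_proj_in: "orth_proj S x \<in> S"
  and orth_proj_diff: "q \<in> S \<Longrightarrow> inner (x - orth_proj S x) q = 0"
proof -
  have "\<exists>p. p \<in> S \<and> (\<forall>q\<in>S. inner (x - p) q = 0)"
    using closed_subspace_projection[OF S, of x] by metis
  from someI_ex[OF this] show "orth_proj S x \<in> S" "q \<in> S \<Longrightarrow> inner (x - orth_proj S x) q = 0"
    by (auto simp: orth_proj_def)
qed

lemma orth_proj_inner: "q \<in> S \<Longrightarrow> inner (orth_proj S x) q = inner x q"
  using orth_proj_diff[of q x] by (simp add: inner_diff_left)

lemma orth_proj_eqI:
  assumes "p \<in> S" "\<And>q. q \<in> S \<Longrightarrow> inner p q = inner x q"
  shows "orth_proj S x = p"
proof -
  let ?d = "orth_proj S x - p"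
  have "?d \<in> S" using orth_proj_in assms(1) S(2) by (simp add: subspace_diff)
  then have "inner ?d ?d = 0" using assms(2) orth_proj_inner by (simp add: inner_diff_left)
  then show ?thesis by simp
qed

lemma orth_proj_id: "x \<in> S \<Longrightarrow> orth_proj S x = x"
  by (rule orth_proj_eqI) auto

lemma norm_orth_proj_le: "norm (orth_proj S x) \<le> norm x"
proof -
  have "inner (orth_proj S x) (orth_proj S x) = inner x (orth_proj S x)"
    by (rule orth_proj_inner[OF orth_proj_in])
  then have "norm (orth_proj S x) * norm (orth_proj S x) \<le> norm x * norm (orth_proj S x)"
    using norm_cauchy_schwarz[of x "orth_proj S x"] by (simp flip: power2_norm_eq_inner power2_eq_square)
  then show ?thesis by (cases "orth_proj S x = 0") auto
qed

lemma bounded_linear_orth_proj: "bounded_linear (orth_proj S)"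
proof (rule bounded_linear_intro[where K = 1])
  show "orth_proj S (x + y) = orth_proj S x + orth_proj S y" for x y
    by (rule orth_proj_eqI) (simp_all add: orth_proj_in S subspace_add inner_add_left orth_proj_inner)
  show "orth_proj S (r *\<^sub>R x) = r *\<^sub>R orth_proj S x" for r x
    by (rule orth_proj_eqI) (simp_all add: orth_proj_in S subspace_scale orth_proj_inner)
qed (simp add: norm_orth_proj_le)

text \<open>Testing with the residual \<open>x - orth_proj S x\<close> shows that \<open>S\<close>
  is its own double orthogonal complement. Membership expressed by such tests passes to weak
  limits.\<close>

lemma mem_closed_subspace_iff:
  "x \<in> S \<longleftrightarrow> (\<forall>y. (\<forall>q\<in>S. inner y q = 0) \<longrightarrow> inner x y = 0)"
proof (intro iffI allI impI)
  assume "\<forall>y. (\<forall>q\<in>S. inner y q = 0) \<longrightarrow> inner x y = 0"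
  then have "inner x (x - orth_proj S x) = 0" using orth_proj_diff by blast
  then have "inner (x - orth_proj S x) (x - orth_proj S x) = 0"
    using orth_proj_diff[OF orth_proj_in, of x x] by (simp add: inner_diff_right inner_commute)
  then show "x \<in> S" using orth_proj_in[of x] by simp
qed (metis inner_commute)

end

lemma subspace_closure_normed:
  fixes S :: "'x::real_normed_vector set"
  assumes "subspace S"
  shows "subspace (closure S)"
proof -
  have "x + y \<in> closure S" if xy: "x \<in> closure S" "y \<in> closure S" for x y
  proof -
    obtain f g where "\<And>n. f n \<in> S" "f \<longlonglongrightarrow> x" "\<And>n. g n \<in> S" "g \<longlonglongrightarrow> y"
      using xy unfolding closure_sequential by metis
    then have "\<And>n. f n + g n \<in> S" "(\<lambda>n. f n + g n) \<longlonglongrightarrow> x + y"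
      using assms by (auto intro: subspace_add tendsto_add)
    then show ?thesis unfolding closure_sequential by (intro exI[of _ "\<lambda>n. f n + g n"]) simp
  qed
  moreover have "c *\<^sub>R x \<in> closure S" if x: "x \<in> closure S" for c x
  proof -
    obtain f where "\<And>n. f n \<in> S" "f \<longlonglongrightarrow> x" using x unfolding closure_sequential by metis
    then have "\<And>n. c *\<^sub>R f n \<in> S" "(\<lambda>n. c *\<^sub>R f n) \<longlonglongrightarrow> c *\<^sub>R x"
      using assms by (auto intro: subspace_scale tendsto_intros)
    then show ?thesis unfolding closure_sequential by (intro exI[of _ "\<lambda>n. c *\<^sub>R f n"]) simp
  qed
  ultimately show ?thesis
    using subspace_0[OF assms] closure_subset[of S] by (auto simp: subspace_def)
qed

lemma dense_subspaceI:
  fixes S :: "'x::{real_inner,complete_space} set"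
  assumes "subspace S" "\<And>y. (\<And>s. s \<in> S \<Longrightarrow> inner s y = 0) \<Longrightarrow> y = 0"
  shows "closure S = UNIV"
proof -
  have "x \<in> closure S" for x
  proof -
    have cl: "closed (closure S)" "subspace (closure S)" using assms(1) by (auto intro: closed_closure subspace_closure_normed)
    have "x - orth_proj (closure S) x = 0"
    proof (rule assms(2))
      fix s assume "s \<in> S"
      then have "s \<in> closure S" using closure_subset by blast
      then show "inner s (x - orth_proj (closure S) x) = 0"
        using orth_proj_diff[OF cl] by (simp add: inner_commute)
    qed
    then show ?thesis using orth_proj_in[OF cl, of x] by simp
  qed
  then show ?thesis by blast
qed

lemma riesz_representation:
  fixes f :: "'x::{real_inner,complete_space} \<Rightarrow> real"
  assumes "bounded_linear f"
  obtains z where "\<And>x. f x = inner x z"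
proof (cases "\<forall>x. f x = 0")
  case True
  then show ?thesis using that[of 0] by simp
next
  case False
  then obtain x0 where x0: "f x0 \<noteq> 0" by blast
  interpret f: bounded_linear f by fact
  define N where "N = {x. f x = 0}"
  have N: "closed N" "subspace N"
    unfolding N_def
    by (intro closed_Collect_eq continuous_on_const linear_continuous_on assms)
       (auto simp: subspace_def f.add f.scaleR f.zero)
  define w where "w = x0 - orth_proj N x0"
  have fw: "f w = f x0" using orth_proj_in[OF N, of x0] by (simp add: w_def f.diff N_def)
  have ww: "inner w w \<noteq> 0" using fw x0 f.zero by auto
  have "f x = inner x ((f w / inner w w) *\<^sub>R w)" for x
  proof -
    \<comment> \<open>This combination lies in the kernel of \<open>f\<close>, to which
      \<open>w\<close> is orthogonal; solving for \<open>f x\<close> gives the representing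
      vector.\<close>
    have "f w *\<^sub>R x - f x *\<^sub>R w \<in> N" by (simp add: N_def f.diff f.scaleR)
    then have "inner w (f w *\<^sub>R x - f x *\<^sub>R w) = 0" unfolding w_def by (rule orth_proj_diff[OF N])
    then show ?thesis using ww by (simp add: inner_diff_right inner_commute field_simps)
  qed
  then show ?thesis by (rule that)
qed

lemma bounded_linear_adjoint:
  fixes T :: "'x::{real_inner,complete_space} \<Rightarrow> 'y::real_inner"
  assumes "bounded_linear T"
  obtains T' where "bounded_linear T'" "\<And>x y. inner (T x) y = inner x (T' y)"
proof -
  interpret T: bounded_linear T by fact
  have "\<exists>z. \<forall>x. inner (T x) y = inner x z" for y
    using riesz_representation[OF bounded_linear_compose[OF bounded_linear_inner_left assms], of y]
    by metis
  then obtain T' where T': "\<And>x y. inner (T x) y = inner x (T' y)" by metis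
  have eqI: "u = v" if "\<And>x. inner x u = inner x v" for u v :: 'x
    using that vector_eq_ldot by blast
  obtain C where C: "\<And>x. norm (T x) \<le> norm x * C" and C0: "0 \<le> C" using T.nonneg_bounded by blast
  have "bounded_linear T'"
  proof (rule bounded_linear_intro[where K = C])
    show "T' (x + y) = T' x + T' y" for x y
      by (rule eqI) (simp add: inner_add_right T'[symmetric])
    show "T' (r *\<^sub>R x) = r *\<^sub>R T' x" for r x
      by (rule eqI) (simp add: T'[symmetric])
    show "norm (T' y) \<le> norm y * C" for y
    proof -
      have "norm (T' y) * norm (T' y) = inner (T (T' y)) y" by (simp add: T' norm_eq_sqrt_inner)
      also have "\<dots> \<le> norm (T (T' y)) * norm y" by (rule norm_cauchy_schwarz)
      also have "\<dots> \<le> (norm (T' y) * C) * norm y" by (intro mult_right_mono C) simp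
      also have "\<dots> = norm (T' y) * (norm y * C)" by simp
      finally show ?thesis
        using C0 by (cases "T' y = 0") (auto simp: mult_le_cancel_left_pos)
    qed
  qed
  with T' show ?thesis using that by blast
qed

section \<open>Weak convergence and uniform boundedness\<close>

text \<open>Tests use the real inner product alone, so the notion applies to product spaces as well;
  \<open>weak_conv_iff_wconv\<close> identifies it with the complex notion.\<close>

definition wconv :: "(nat \<Rightarrow> 'x::real_inner) \<Rightarrow> 'x \<Rightarrow> bool" where
  "wconv x l \<longleftrightarrow> (\<forall>y. (\<lambda>k. inner (x k) y) \<longlonglongrightarrow> inner l y)"

lemma wconvD: "wconv x l \<Longrightarrow> (\<lambda>k. inner (x k) y) \<longlonglongrightarrow> inner l y"
  by (simp add: wconv_def)

lemma wconv_subseq: "wconv x l \<Longrightarrow> strict_mono r \<Longrightarrow> wconv (\<lambda>k. x (r k)) l"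
  unfolding wconv_def using LIMSEQ_subseq_LIMSEQ[unfolded comp_def] by blast

lemma wconv_unique:
  assumes "wconv x l" "wconv x l'"
  shows "l = l'"
  using assms LIMSEQ_unique unfolding wconv_def by (metis vector_eq_rdot)

lemma tendsto_imp_wconv: "x \<longlonglongrightarrow> l \<Longrightarrow> wconv x l"
  unfolding wconv_def by (auto intro: tendsto_intros)

lemma wconv_bounded_linear:
  fixes T :: "'x::{real_inner,complete_space} \<Rightarrow> 'y::real_inner"
  assumes "bounded_linear T" "wconv x l"
  shows "wconv (\<lambda>k. T (x k)) (T l)"
proof -
  obtain T' where "\<And>x y. inner (T x) y = inner x (T' y)" using bounded_linear_adjoint[OF assms(1)] by metis
  then show ?thesis using assms(2) by (simp add: wconv_def)
qed

lemma wconv_in_closed_subspace: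
  fixes S :: "'x::{real_inner,complete_space} set"
  assumes "closed S" "subspace S" "wconv x l" "\<And>k. x k \<in> S"
  shows "l \<in> S"
  unfolding mem_closed_subspace_iff[OF assms(1,2)]
proof (intro allI impI)
  fix y assume "\<forall>q\<in>S. inner y q = 0"
  then have "inner (x k) y = 0" for k using assms(4) by (metis inner_commute)
  then show "inner l y = 0" using wconvD[OF assms(3), of y] by (simp add: LIMSEQ_const_iff)
qed

text \<open>The weak limit is the Riesz representative of the pointwise limit functional.\<close>

lemma wconv_if_convergent_on_dense:
  fixes x :: "nat \<Rightarrow> 'x::{real_inner,complete_space}"
  assumes bdd: "\<And>k. norm (x k) \<le> C" and dense: "closure E = UNIV"
    and conv: "\<And>y. y \<in> E \<Longrightarrow> convergent (\<lambda>k. inner (x k) y)"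
  obtains l where "wconv x l"
proof -
  have C: "C \<ge> 0" using bdd[of 0] norm_ge_zero order_trans by blast
  have "convergent (\<lambda>k. inner (x k) y)" for y
  proof -
    have "Cauchy (\<lambda>k. inner (x k) y)"
    proof (rule metric_CauchyI)
      fix e :: real assume e: "e > 0"
      define d where "d = e / (3 * (C + 1))"
      have d: "d > 0" using e C by (simp add: d_def)
      obtain z where z: "z \<in> E" "dist z y < d"
        using dense d closure_approachable[of y E] by auto
      obtain M where M: "\<And>m n. m \<ge> M \<Longrightarrow> n \<ge> M \<Longrightarrow> dist (inner (x m) z) (inner (x n) z) < e / 3"
        using metric_CauchyD[OF convergent_Cauchy[OF conv[OF z(1)]], of "e / 3"] e by auto
      have small: "\<bar>inner (x k) (y - z)\<bar> < e / 3" for k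
      proof -
        have "\<bar>inner (x k) (y - z)\<bar> \<le> norm (x k) * norm (y - z)" by (rule Cauchy_Schwarz_ineq2)
        also have "\<dots> \<le> C * d"
          using z(2) bdd[of k] C by (intro mult_mono) (auto simp: dist_norm norm_minus_commute)
        also have "\<dots> < e / 3" using e C by (simp add: d_def field_simps)
        finally show ?thesis .
      qed
      have "dist (inner (x m) y) (inner (x n) y) < e" if "m \<ge> M" "n \<ge> M" for m n
        using M[OF that] small[of m] small[of n] unfolding dist_real_def inner_diff_right by linarith
      then show "\<exists>M. \<forall>m\<ge>M. \<forall>n\<ge>M. dist (inner (x m) y) (inner (x n) y) < e" by blast
    qed
    then show ?thesis by (simp add: Cauchy_convergent_iff)
  qed
  then obtain F where F: "\<And>y. (\<lambda>k. inner (x k) y) \<longlonglongrightarrow> F y"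
    unfolding convergent_def by metis
  have "bounded_linear F"
  proof (rule bounded_linear_intro[where K = C])
    show "F (y + z) = F y + F z" for y z
      using LIMSEQ_unique[OF F[of "y + z"]] tendsto_add[OF F[of y] F[of z]] by (simp add: inner_add_right)
    show "F (r *\<^sub>R y) = r *\<^sub>R F y" for r y
      using LIMSEQ_unique[OF F[of "r *\<^sub>R y"]] tendsto_mult_left[OF F[of y], of r] by simp
    show "norm (F y) \<le> norm y * C" for y
    proof (rule LIMSEQ_le_const2[OF tendsto_norm[OF F[of y]]])
      have "norm (inner (x n) y) \<le> norm y * C" for n
        using Cauchy_Schwarz_ineq2[of "x n" y] mult_right_mono[OF bdd[of n], of "norm y"]
        by (simp add: mult.commute)
      then show "\<exists>N. \<forall>n\<ge>N. norm (inner (x n) y) \<le> norm y * C" by blast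
    qed
  qed
  then obtain l where "\<And>y. F y = inner y l" using riesz_representation by metis
  then show ?thesis using F that[of l] by (simp add: wconv_def inner_commute)
qed

text \<open>Sokal's proof, which avoids the Baire category theorem: an operator of norm at least
  \<open>4 ^ n\<close> is large somewhere in any prescribed ball of radius \<open>(1/3) ^ n\<close>.\<close>

lemma uniform_boundedness:
  fixes T :: "nat \<Rightarrow> 'x::{real_normed_vector,complete_space} \<Rightarrow> 'y::real_normed_vector"
  assumes bl: "\<And>n. bounded_linear (T n)" and pt: "\<And>x. \<exists>C. \<forall>n. norm (T n x) \<le> C"
  obtains C where "\<And>n x. norm (T n x) \<le> C * norm x"
proof -
  have "\<exists>C. \<forall>n. onorm (T n) \<le> C"
  proof (rule ccontr)
    assume "\<not> ?thesis"
    then have "\<forall>k. \<exists>n. onorm (T n) > 4 ^ k" by (meson not_less)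
    then obtain \<nu> where \<nu>: "\<And>k. onorm (T (\<nu> k)) > 4 ^ k" by metis
    have step: "\<exists>y. norm (y - x) \<le> (1/3) ^ k \<and> norm (T (\<nu> k) y) \<ge> 2/3 * (1/3) ^ k * onorm (T (\<nu> k))" for x k
    proof (rule ccontr)
      interpret L: bounded_linear "T (\<nu> k)" by (rule bl)
      let ?r = "(1/3) ^ k :: real" and ?N = "onorm (T (\<nu> k))"
      assume "\<not> ?thesis"
      then have small: "norm (T (\<nu> k) y) < 2/3 * ?r * ?N" if "norm (y - x) \<le> ?r" for y
        using that by (meson not_less)
      \<comment> \<open>If the image of the whole ball were small, then so would be
        \<open>2 *\<^sub>R T (\<nu> k) u\<close>, a difference of the values at \<open>x + u\<close>
        and \<open>x - u\<close>. By scaling, the operator norm would be at most two thirds of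
        itself.\<close>
      have "norm (T (\<nu> k) v) \<le> (2/3 * ?N) * norm v" for v
      proof (cases "v = 0")
        case False
        define u where "u = (?r / norm v) *\<^sub>R v"
        have u: "norm u = ?r" using False by (simp add: u_def)
        have "T (\<nu> k) (x + u) - T (\<nu> k) (x - u) = 2 *\<^sub>R T (\<nu> k) u"
          by (simp add: L.add L.diff scaleR_2)
        then have "2 * norm (T (\<nu> k) u) \<le> norm (T (\<nu> k) (x + u)) + norm (T (\<nu> k) (x - u))"
          by (metis norm_scaleR norm_triangle_ineq4 abs_numeral)
        also have "\<dots> \<le> 2/3 * ?r * ?N + 2/3 * ?r * ?N"
          using small[of "x + u"] small[of "x - u"] u by (simp add: algebra_simps)
        finally have "norm (T (\<nu> k) u) \<le> 2/3 * ?r * ?N" by (simp add: algebra_simps)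
        moreover have "norm (T (\<nu> k) u) = ?r / norm v * norm (T (\<nu> k) v)"
          by (simp add: u_def L.scaleR)
        ultimately show ?thesis using False by (simp add: field_simps)
      qed (simp add: L.zero)
      then have "?N \<le> 2/3 * ?N" using onorm_pos_le[OF bl] by (intro onorm_bound) auto
      moreover have "?N > 0" using \<nu>[of k] by (meson less_trans zero_less_numeral zero_less_power)
      ultimately show False by simp
    qed
    define g where "g k x = (SOME y. norm (y - x) \<le> (1/3) ^ k \<and>
      norm (T (\<nu> k) y) \<ge> 2/3 * (1/3) ^ k * onorm (T (\<nu> k)))" for k x
    have g: "norm (g k x - x) \<le> (1/3) ^ k" "norm (T (\<nu> k) (g k x)) \<ge> 2/3 * (1/3) ^ k * onorm (T (\<nu> k))" for k x
      using someI_ex[OF step[of x k]] unfolding g_def by auto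
    define x where "x = rec_nat (g 0 0) (\<lambda>k z. g (Suc k) z)"
    have x_0: "x 0 = g 0 0" by (simp add: x_def)
    have x_Suc: "x (Suc k) = g (Suc k) (x k)" for k by (simp add: x_def)
    have big: "norm (T (\<nu> k) (x k)) \<ge> 2/3 * (1/3) ^ k * onorm (T (\<nu> k))" for k
      by (cases k) (simp_all only: x_0 x_Suc g(2))
    \<comment> \<open>The exact partial sum of the geometric series of step lengths; the plain bound
      by its limit would not survive the induction.\<close>
    have close: "norm (x (k + d) - x k) \<le> (1/2) * (1/3) ^ k * (1 - (1/3) ^ d)" for k d
    proof (induction d)
      case (Suc d)
      have "norm (x (k + Suc d) - x k) \<le> norm (x (Suc (k + d)) - x (k + d)) + norm (x (k + d) - x k)"
        using norm_triangle_ineq[of "x (Suc (k + d)) - x (k + d)" "x (k + d) - x k"] by simp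
      also have "\<dots> \<le> (1/3) ^ Suc (k + d) + (1/2) * (1/3) ^ k * (1 - (1/3) ^ d)"
        using g(1)[of "Suc (k + d)" "x (k + d)"] Suc.IH by (intro add_mono) (simp_all add: x_Suc)
      also have "\<dots> = (1/2) * (1/3) ^ k * (1 - (1/3) ^ Suc d)"
        by (simp add: power_add field_simps)
      finally show ?case .
    qed simp
    have close': "norm (x (k + d) - x k) \<le> (1/2) * (1/3) ^ k" for k d
    proof -
      have "(1/2) * (1/3) ^ k * (1 - (1/3) ^ d) \<le> (1/2) * (1/3) ^ k * (1::real)"
        by (intro mult_left_mono) auto
      then show ?thesis using close[of k d] by linarith
    qed
    have "Cauchy x"
    proof (rule metric_CauchyI)
      fix e :: real assume "e > 0"
      then obtain k where k: "(1/3) ^ k < e" using real_arch_pow_inv[of e "1/3"] by auto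
      have "dist (x m) (x n) < e" if "m \<ge> k" "n \<ge> k" for m n
      proof -
        have "norm (x m - x k) \<le> (1/2) * (1/3) ^ k" "norm (x n - x k) \<le> (1/2) * (1/3) ^ k"
          using close'[of k "m - k"] close'[of k "n - k"] that by auto
        then have "dist (x m) (x n) \<le> (1/3) ^ k"
          using dist_triangle2[of "x m" "x n" "x k"] by (simp add: dist_norm)
        then show ?thesis using k by simp
      qed
      then show "\<exists>M. \<forall>m\<ge>M. \<forall>n\<ge>M. dist (x m) (x n) < e" by blast
    qed
    then obtain l where l: "x \<longlonglongrightarrow> l" by (auto simp: Cauchy_convergent_iff convergent_def)
    have lk: "norm (l - x k) \<le> (1/2) * (1/3) ^ k" for k
    proof (rule LIMSEQ_le_const2)
      show "(\<lambda>d. norm (x (d + k) - x k)) \<longlonglongrightarrow> norm (l - x k)"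
        by (intro tendsto_intros LIMSEQ_ignore_initial_segment l)
      have "norm (x (n + k) - x k) \<le> (1/2) * (1/3) ^ k" for n
        using close'[of k n] by (simp add: add.commute)
      then show "\<exists>N. \<forall>n\<ge>N. norm (x (n + k) - x k) \<le> (1/2) * (1/3) ^ k" by blast
    qed
    obtain C where C: "\<And>n. norm (T n l) \<le> C" using pt by blast
    \<comment> \<open>Passing from \<open>x k\<close> to \<open>l\<close> costs at most 1/2 of the
      factor 2/3, which leaves 1/6; the growth \<open>4 ^ k\<close> outweighs the radius
      \<open>(1/3) ^ k\<close>.\<close>
    have lower: "C \<ge> 1/6 * (4/3) ^ k" for k
    proof -
      interpret L: bounded_linear "T (\<nu> k)" by (rule bl)
      let ?N = "onorm (T (\<nu> k))"
      have "norm (T (\<nu> k) (x k)) \<le> norm (T (\<nu> k) l) + norm (T (\<nu> k) (l - x k))"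
        using norm_triangle_ineq4[of "T (\<nu> k) l" "T (\<nu> k) (l - x k)"] by (simp add: L.diff)
      moreover have "norm (T (\<nu> k) (l - x k)) \<le> ?N * norm (l - x k)" by (rule onorm[OF bl])
      moreover have "?N * norm (l - x k) \<le> ?N * ((1/2) * (1/3) ^ k)"
        by (intro mult_left_mono lk onorm_pos_le[OF bl])
      ultimately have "C \<ge> 1/6 * (1/3) ^ k * ?N"
        using big[of k] C[of "\<nu> k"] by (simp add: algebra_simps)
      moreover have "1/6 * (1/3) ^ k * ?N \<ge> 1/6 * (1/3) ^ k * 4 ^ k"
        using \<nu>[of k] by (intro mult_left_mono) auto
      moreover have "1/6 * (1/3) ^ k * 4 ^ k = 1/6 * (4/3 :: real) ^ k"
        by (simp add: power_divide)
      ultimately show ?thesis by linarith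
    qed
    obtain k where "6 * C < (4/3) ^ k" using real_arch_pow[of "4/3" "6 * C"] by auto
    then show False using lower[of k] by simp
  qed
  then obtain C where "\<And>n. onorm (T n) \<le> C" by blast
  then have "norm (T n x) \<le> C * norm x" for n x
    using onorm[OF bl, of n x] mult_right_mono[of "onorm (T n)" C "norm x"] by (meson norm_ge_zero order_trans)
  then show ?thesis by (rule that)
qed

text \<open>Uniform boundedness is used twice: for fixed \<open>x\<close> on the functionals
  \<open>inner (T n x)\<close>, which bounds \<open>norm (T n x)\<close> after testing with
  \<open>T n x\<close> itself, and then on the operators \<open>T n\<close>.\<close>

lemma weakly_pointwise_bounded:
  fixes T :: "nat \<Rightarrow> 'x::{real_inner,complete_space} \<Rightarrow> 'y::{real_inner,complete_space}"
  assumes bl: "\<And>n. bounded_linear (T n)" and w: "\<And>x. wconv (\<lambda>n. T n x) (L x)"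
  obtains C where "\<And>n x. norm (T n x) \<le> C * norm x"
proof (rule uniform_boundedness[OF bl])
  fix x
  have "\<exists>C. \<forall>n. norm (inner (T n x) y) \<le> C" for y
    using convergent_imp_Bseq[OF convergentI[OF wconvD[OF w[of x], of y]]] by (auto simp: Bseq_def)
  then obtain C where C: "\<And>n y. norm (inner (T n x) y) \<le> C * norm y"
    using uniform_boundedness[of "\<lambda>n. inner (T n x)"] bounded_linear_inner_right by metis
  have "norm (T n x) \<le> C" if "T n x \<noteq> 0" for n
  proof -
    have "norm (T n x) * norm (T n x) \<le> C * norm (T n x)"
      using C[of n "T n x"] by (simp add: power2_norm_eq_inner[symmetric] power2_eq_square)
    then show ?thesis using that by simp
  qed
  moreover have "norm (T n x) \<le> max C 0" for n using calculation[of n] by (cases "T n x = 0") auto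
  ultimately show "\<exists>C. \<forall>n. norm (T n x) \<le> C" by blast
qed (use that in blast)

section \<open>Fredholm alternative for forms satisfying a Garding inequality\<close>

text \<open>Coercivity bounds \<open>T\<close> from below, so its range is closed; a vector
  \<open>y\<close> orthogonal to the range satisfies \<open>inner (T y) y = 0\<close> and therefore
  vanishes.\<close>

lemma lax_milgram:
  fixes T :: "'x::{real_inner,complete_space} \<Rightarrow> 'x"
  assumes bl: "bounded_linear T" and c: "c > 0" and coer: "\<And>x. inner (T x) x \<ge> c * (norm x)\<^sup>2"
  shows "c * norm x \<le> norm (T x)" and "surj T"
proof -
  interpret T: bounded_linear T by fact
  show below: "c * norm x \<le> norm (T x)" for x
  proof (cases "x = 0")
    case False
    have "norm x * (c * norm x) \<le> norm x * norm (T x)"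
      using coer[of x] norm_cauchy_schwarz[of "T x" x] by (simp add: power2_eq_square algebra_simps)
    then show ?thesis using False by simp
  qed (simp add: T.zero)
  have "complete (range T)"
    using complete_isometric_image[OF c subspace_UNIV bl _ complete_UNIV] below by blast
  then have "closed (range T)" by (rule complete_imp_closed)
  moreover have "closure (range T) = UNIV"
  proof (rule dense_subspaceI)
    show "subspace (range T)" by (intro linear_subspace_image subspace_UNIV T.linear_axioms)
    show "y = 0" if "\<And>s. s \<in> range T \<Longrightarrow> inner s y = 0" for y
      using that[of "T y"] coer[of y] c by (simp add: mult_le_0_iff)
  qed
  ultimately show "surj T" by simp
qed

text \<open>Compactness is tested on sequences in \<open>S\<close> only: the first projection is
  compact on the graph of \<open>G\<close>, but in general not on the whole product.\<close>

definition compact_map_on :: "'x::real_normed_vector set \<Rightarrow> ('x \<Rightarrow> 'c::real_normed_vector) \<Rightarrow> bool" where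
  "compact_map_on S K \<longleftrightarrow> (\<forall>x C. (\<forall>k. x k \<in> S \<and> norm (x k) \<le> C) \<longrightarrow>
     (\<exists>r::nat \<Rightarrow> nat. strict_mono r \<and> convergent (\<lambda>k. K (x (r k)))))"

lemma compact_map_onE:
  assumes "compact_map_on S K" "\<And>k. x k \<in> S" "\<And>k. norm (x k) \<le> C"
  obtains r where "strict_mono (r :: nat \<Rightarrow> nat)" "convergent (\<lambda>k. K (x (r k)))"
  using assms unfolding compact_map_on_def by metis

text \<open>The argument of Riesz and Schauder. The difference of \<open>L\<close> and the identity
  is dominated by the compact \<open>K\<close>, which is enough for it to be compact. If
  \<open>L\<close> were injective but not onto, the ranges of its powers would strictly decrease,
  and unit vectors orthogonal to the next range would have images under the difference that stay at
  distance at least 1.\<close>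

lemma compact_perturbation_inj_imp_surj:
  fixes L :: "'x::{real_inner,complete_space} \<Rightarrow> 'x" and K :: "'x \<Rightarrow> 'c::real_normed_vector"
  assumes L: "bounded_linear L" and K: "bounded_linear K" and cpt: "compact_map_on UNIV K"
    and dom: "\<And>x. norm (x - L x) \<le> b * norm (K x)" and inj: "inj L"
  shows "surj L"
proof -
  interpret L: bounded_linear L by fact
  interpret K: bounded_linear K by fact
  have conv: "convergent (\<lambda>k. x k - L (x k))" if Kx: "convergent (\<lambda>k. K (x k))" for x :: "nat \<Rightarrow> 'x"
  proof -
    have "Cauchy (\<lambda>k. x k - L (x k))"
    proof (rule metric_CauchyI)
      fix e :: real assume e: "e > 0"
      obtain M where M: "\<And>m n. m \<ge> M \<Longrightarrow> n \<ge> M \<Longrightarrow> dist (K (x m)) (K (x n)) < e / (\<bar>b\<bar> + 1)"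
        using metric_CauchyD[OF convergent_Cauchy[OF Kx], of "e / (\<bar>b\<bar> + 1)"] e by auto
      have "dist (x m - L (x m)) (x n - L (x n)) < e" if "m \<ge> M" "n \<ge> M" for m n
      proof -
        have "dist (x m - L (x m)) (x n - L (x n)) = norm ((x m - x n) - L (x m - x n))"
          by (simp add: dist_norm L.diff algebra_simps)
        also have "\<dots> \<le> b * norm (K (x m - x n))" by (rule dom)
        also have "\<dots> \<le> (\<bar>b\<bar> + 1) * dist (K (x m)) (K (x n))"
          by (simp add: K.diff dist_norm mult_right_mono)
        also have "\<dots> < e" using M[OF that] by (simp add: field_simps)
        finally show ?thesis .
      qed
      then show "\<exists>M. \<forall>m\<ge>M. \<forall>n\<ge>M. dist (x m - L (x m)) (x n - L (x n)) < e" by blast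
    qed
    then show ?thesis by (simp add: Cauchy_convergent_iff)
  qed
  \<comment> \<open>Normalised vectors violating every such bound would have a subsequence
    converging to a unit vector in the kernel. The bound is what makes the ranges of all powers
    closed, so that projections onto them exist.\<close>
  have "\<exists>\<delta>>0. \<forall>x. \<delta> * norm x \<le> norm (L x)"
  proof (rule ccontr)
    assume "\<not> ?thesis"
    then have "\<exists>x. norm (L x) < 1 / real (Suc k) * norm x" for k
      by (meson not_less of_nat_0_less_iff zero_less_Suc zero_less_divide_1_iff)
    then obtain v where v: "\<And>k. norm (L (v k)) < 1 / real (Suc k) * norm (v k)" by metis
    define u where "u k = (1 / norm (v k)) *\<^sub>R v k" for k
    have v0: "v k \<noteq> 0" for k using v[of k] L.zero by auto
    have u1: "norm (u k) = 1" for k using v0[of k] by (simp add: u_def)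
    have Lu: "norm (L (u k)) \<le> 1 / real (Suc k)" for k
      using v[of k] v0[of k] by (simp add: u_def L.scaleR field_simps)
    obtain r where r: "strict_mono r" "convergent (\<lambda>k. K (u (r k)))"
      by (rule compact_map_onE[OF cpt, of u 1]) (auto simp: u1)
    obtain w where w: "(\<lambda>k. u (r k) - L (u (r k))) \<longlonglongrightarrow> w" using conv[OF r(2)] convergent_def by blast
    have "(\<lambda>k. L (u k)) \<longlonglongrightarrow> 0"
      by (rule Lim_null_comparison[OF _ LIMSEQ_Suc[OF lim_1_over_n]]) (intro always_eventually allI Lu)
    from LIMSEQ_subseq_LIMSEQ[OF this r(1)] have L0: "(\<lambda>k. L (u (r k))) \<longlonglongrightarrow> 0" by (simp add: comp_def)
    have ur: "(\<lambda>k. u (r k)) \<longlonglongrightarrow> w" using tendsto_add[OF w L0] by simp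
    have "L w = 0" using LIMSEQ_unique[OF L.tendsto[OF ur] L0] .
    then have "w = 0" using injD[OF inj, of w 0] by (simp add: L.zero)
    moreover have "norm w = 1" using LIMSEQ_unique[OF tendsto_norm[OF ur]] by (simp add: u1)
    ultimately show False by simp
  qed
  then obtain \<delta> where \<delta>: "\<delta> > 0" "\<And>x. \<delta> * norm x \<le> norm (L x)" by blast
  have blp: "bounded_linear (L ^^ n)" for n
  proof (induction n)
    case 0
    show ?case using bounded_linear_ident by (simp add: id_def)
  next
    case (Suc n)
    have "L ^^ Suc n = (\<lambda>x. L ((L ^^ n) x))" by auto
    then show ?case using bounded_linear_compose[OF L Suc] by simp
  qed
  have below: "\<delta> ^ n * norm x \<le> norm ((L ^^ n) x)" for n x
  proof (induction n)
    case (Suc n)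
    have "\<delta> ^ Suc n * norm x \<le> \<delta> * norm ((L ^^ n) x)" using Suc \<delta>(1) by simp
    also have "\<dots> \<le> norm ((L ^^ Suc n) x)" using \<delta>(2) by simp
    finally show ?case .
  qed simp
  define R where "R n = range (L ^^ n)" for n
  have Rc: "closed (R n)" for n
  proof -
    have "\<delta> ^ n > 0" using \<delta>(1) by simp
    then have "complete (R n)" unfolding R_def
      using complete_isometric_image[OF _ subspace_UNIV blp _ complete_UNIV] below by blast
    then show ?thesis by (rule complete_imp_closed)
  qed
  have Rs: "subspace (R n)" for n
    unfolding R_def by (intro linear_subspace_image subspace_UNIV bounded_linear.linear blp)
  have R_Suc: "L x \<in> R (Suc n)" if xn: "x \<in> R n" for x n
  proof -
    obtain y where "x = (L ^^ n) y" using xn unfolding R_def by blast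
    then have "L x = (L ^^ Suc n) y" by simp
    then show ?thesis unfolding R_def by blast
  qed
  have R_dec: "R (Suc n) \<subseteq> R n" for n
    unfolding R_def funpow_Suc_right by (metis image_comp image_mono subset_UNIV)
  have R_mono: "R m \<subseteq> R n" if "n \<le> m" for m n
    using that R_dec by (rule lift_Suc_antimono_le[rotated])
  have inj_pow: "inj (L ^^ n)" for n by (rule inj_fn[OF inj])
  show "surj L"
  proof (rule ccontr)
    assume "\<not> surj L"
    then obtain y where y: "y \<notin> range L" by blast
    \<comment> \<open>Injectivity of \<open>L ^^ n\<close> carries the gap between the space and
      \<open>range L\<close> to a gap between \<open>R n\<close> and \<open>R (Suc n)\<close>; the
      normalised residual of a projection fills it.\<close>
    have "\<exists>v. v \<in> R n \<and> norm v = 1 \<and> (\<forall>w\<in>R (Suc n). inner v w = 0)" for n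
    proof -
      define z where "z = (L ^^ n) y"
      have "z \<notin> R (Suc n)"
      proof
        assume "z \<in> R (Suc n)"
        then obtain w where "(L ^^ n) y = (L ^^ n) (L w)"
          unfolding R_def z_def funpow_Suc_right by auto
        then show False using y injD[OF inj_pow[of n]] by blast
      qed
      define v where "v = z - orth_proj (R (Suc n)) z"
      have "v \<noteq> 0" using \<open>z \<notin> R (Suc n)\<close> orth_proj_in[OF Rc Rs, of "Suc n" z] by (metis v_def eq_iff_diff_eq_0)
      moreover have "v \<in> R n"
        unfolding v_def
      proof (rule subspace_diff[OF Rs])
        show "z \<in> R n" unfolding z_def R_def by blast
        show "orth_proj (R (Suc n)) z \<in> R n" using orth_proj_in[OF Rc Rs] R_dec by blast
      qed
      moreover have "inner v w = 0" if "w \<in> R (Suc n)" for w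
        unfolding v_def by (rule orth_proj_diff[OF Rc Rs that])
      ultimately show ?thesis
        by (intro exI[of _ "(1 / norm v) *\<^sub>R v"]) (simp add: subspace_scale[OF Rs])
    qed
    then obtain x where x: "\<And>n. x n \<in> R n" "\<And>n. norm (x n) = 1"
        "\<And>n w. w \<in> R (Suc n) \<Longrightarrow> inner (x n) w = 0" by metis
    obtain r where r: "strict_mono r" "convergent (\<lambda>k. K (x (r k)))"
      by (rule compact_map_onE[OF cpt, of x 1]) (auto simp: x)
    obtain N where N: "\<And>i j. i \<ge> N \<Longrightarrow> j \<ge> N \<Longrightarrow> dist (x (r i) - L (x (r i))) (x (r j) - L (x (r j))) < 1"
      using metric_CauchyD[OF convergent_Cauchy[OF conv[OF r(2)]], of 1] by auto
    \<comment> \<open>Everything in the difference of the two images except \<open>x (r N)\<close>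
      is collected in \<open>w\<close>. It lies in \<open>R (Suc (r N))\<close>, hence is orthogonal
      to the unit vector \<open>x (r N)\<close>.\<close>
    define w where "w = L (x (r N)) + (x (r (Suc N)) - L (x (r (Suc N))))"
    have rlt: "Suc (r N) \<le> r (Suc N)" using r(1) by (simp add: strict_mono_Suc_iff Suc_leI)
    have "x (r (Suc N)) \<in> R (Suc (r N))" using x(1) R_mono[OF rlt] by blast
    moreover from this have "L (x (r (Suc N))) \<in> R (Suc (r N))" using R_Suc R_dec by blast
    ultimately have "w \<in> R (Suc (r N))"
      unfolding w_def using R_Suc[OF x(1)] by (intro subspace_add[OF Rs] subspace_diff[OF Rs])
    then have "inner (x (r N)) w = 0" by (rule x(3))
    then have "(norm (x (r N) - w))\<^sup>2 = 1 + (norm w)\<^sup>2"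
      using x(2)[of "r N"] by (simp add: power2_norm_eq_inner inner_diff_left inner_diff_right inner_commute norm_eq_1)
    then have "1\<^sup>2 \<le> (norm (x (r N) - w))\<^sup>2" by simp
    then have "1 \<le> norm (x (r N) - w)" by (rule power2_le_imp_le) simp
    moreover have "dist (x (r N) - L (x (r N))) (x (r (Suc N)) - L (x (r (Suc N)))) = norm (x (r N) - w)"
      by (simp add: dist_norm w_def algebra_simps)
    ultimately show False using N[of N "Suc N"] by simp
  qed
qed

text \<open>Adding a multiple of \<open>K\<^sup>* K\<close> makes \<open>T\<close> coercive; hence \<open>T\<close> is a compact
  perturbation of an invertible operator.\<close>

lemma garding_inj_imp_surj:
  fixes T :: "'x::{real_inner,complete_space} \<Rightarrow> 'x" and K :: "'x \<Rightarrow> 'c::{real_inner,complete_space}"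
  assumes T: "bounded_linear T" and K: "bounded_linear K" and cpt: "compact_map_on UNIV K"
    and c: "c > 0" and garding: "\<And>x. inner (T x) x \<ge> c * (norm x)\<^sup>2 - M * (norm (K x))\<^sup>2"
    and inj: "inj T"
  shows "surj T"
proof -
  interpret T: bounded_linear T by fact
  obtain K' where K': "bounded_linear K'" "\<And>x y. inner (K x) y = inner x (K' y)"
    using bounded_linear_adjoint[OF K] by metis
  define A where "A x = T x + M *\<^sub>R K' (K x)" for x
  have A: "bounded_linear A"
    unfolding A_def by (intro bounded_linear_add T bounded_linear_scaleR_right[THEN bounded_linear_compose]
        bounded_linear_compose[OF K'(1) K])
  interpret A: bounded_linear A by fact
  have "inner (K' (K x)) x = (norm (K x))\<^sup>2" for x
    using K'(2)[of x "K x"] by (simp add: inner_commute power2_norm_eq_inner)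
  then have coer: "inner (A x) x \<ge> c * (norm x)\<^sup>2" for x
    using garding[of x] by (simp add: A_def inner_add_left)
  note below = lax_milgram(1)[OF A c coer] and surjA = lax_milgram(2)[OF A c coer]
  have "x = 0" if "A x = 0" for x using below[of x] c that by (simp add: mult_le_0_iff)
  then have "inj A" by (simp add: linear_injective_0[OF A.linear_axioms])
  define B where "B = inv A"
  have AB: "A (B y) = y" for y by (simp add: B_def surj_f_inv_f[OF surjA])
  have BA: "B (A x) = x" for x by (simp add: B_def inv_f_f[OF \<open>inj A\<close>])
  have B: "bounded_linear B"
  proof (rule bounded_linear_intro[where K = "1 / c"])
    show "B (x + y) = B x + B y" for x y using BA[of "B x + B y"] by (simp add: A.add AB)
    show "B (r *\<^sub>R x) = r *\<^sub>R B x" for r x using BA[of "r *\<^sub>R B x"] by (simp add: A.scaleR AB)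
    show "norm (B y) \<le> norm y * (1 / c)" for y using below[of "B y"] c by (simp add: AB field_simps)
  qed
  interpret B: bounded_linear B by fact
  have "bounded_linear (\<lambda>y. M *\<^sub>R B (K' y))"
    by (rule bounded_linear_compose[OF bounded_linear_scaleR_right bounded_linear_compose[OF B K'(1)]])
  then obtain b where b: "\<And>y. norm (M *\<^sub>R B (K' y)) \<le> norm y * b"
    using bounded_linear.bounded by blast
  have sBT: "surj (\<lambda>x. B (T x))"
  proof (rule compact_perturbation_inj_imp_surj[OF bounded_linear_compose[OF B T] K cpt])
    have "x - B (T x) = M *\<^sub>R B (K' (K x))" for x
    proof -
      have "x - B (T x) = B (A x - T x)" by (simp add: B.diff BA)
      then show ?thesis by (simp add: A_def B.scaleR)
    qed
    then show "norm (x - B (T x)) \<le> b * norm (K x)" for x using b by (simp add: mult.commute)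
    show "inj (\<lambda>x. B (T x))" using AB injD[OF inj] by (intro injI) metis
  qed
  have "\<exists>x. y = T x" for y
  proof -
    obtain x where "B y = B (T x)" using surjD[OF sBT] by blast
    then show ?thesis using AB by metis
  qed
  then show ?thesis by (simp add: surj_def)
qed

text \<open>Once the images under \<open>K\<close> converge, the inner products with all vectors in
  the range of the adjoint \<open>K'\<close> converge, and so do those with all vectors orthogonal
  to \<open>S\<close>. A vector \<open>z\<close> orthogonal to both kinds lies in \<open>S\<close>
  and satisfies \<open>K z = 0\<close>, so it is zero and the good test vectors are dense.\<close>

lemma compact_inj_imp_weak_subseq:
  fixes K :: "'x::{real_inner,complete_space} \<Rightarrow> 'c::{real_inner,complete_space}"
  assumes S: "closed S" "subspace S" and K: "bounded_linear K" and cpt: "compact_map_on S K"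
    and inj: "\<And>x. x \<in> S \<Longrightarrow> K x = 0 \<Longrightarrow> x = 0"
    and x: "\<And>k. x k \<in> S" "\<And>k. norm (x k) \<le> C"
  obtains r l where "strict_mono (r :: nat \<Rightarrow> nat)" "l \<in> S" "wconv (\<lambda>k. x (r k)) l"
    "(\<lambda>k. K (x (r k))) \<longlonglongrightarrow> K l"
proof -
  obtain K' where K': "\<And>x y. inner (K x) y = inner x (K' y)"
    using bounded_linear_adjoint[OF K] by metis
  obtain r where r: "strict_mono r" "convergent (\<lambda>k. K (x (r k)))"
    by (rule compact_map_onE[OF cpt x])
  obtain h where h: "(\<lambda>k. K (x (r k))) \<longlonglongrightarrow> h" using r(2) convergent_def by blast
  define E where "E = {y. convergent (\<lambda>k. inner (x (r k)) y)}"
  have "closure E = UNIV"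
  proof (rule dense_subspaceI)
    show "subspace E"
      unfolding subspace_def E_def
      by (simp add: inner_add_right convergent_add convergent_const convergent_mult)
    fix z assume z: "\<And>s. s \<in> E \<Longrightarrow> inner s z = 0"
    have "z \<in> S" unfolding mem_closed_subspace_iff[OF S]
    proof (intro allI impI)
      fix y assume "\<forall>q\<in>S. inner y q = 0"
      then have "inner (x (r k)) y = 0" for k using x(1) by (metis inner_commute)
      then have "y \<in> E" by (simp add: E_def convergent_const)
      then show "inner z y = 0" using z by (metis inner_commute)
    qed
    moreover have "K' (K z) \<in> E"
      using tendsto_inner[OF h tendsto_const, of "K z"] unfolding E_def convergent_def by (auto simp only: K'[symmetric] mem_Collect_eq)
    then have "K z = 0" using z[of "K' (K z)"] K'[of z "K z"] by (simp add: inner_commute)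
    ultimately show "z = 0" by (rule inj)
  qed
  then obtain l where l: "wconv (\<lambda>k. x (r k)) l"
  proof (rule wconv_if_convergent_on_dense[rotated])
    show "norm (x (r k)) \<le> C" for k by (rule x(2))
    show "convergent (\<lambda>k. inner (x (r k)) y)" if "y \<in> E" for y using that by (simp add: E_def)
  qed
  moreover have "K l = h" by (rule wconv_unique[OF wconv_bounded_linear[OF K l] tendsto_imp_wconv[OF h]])
  ultimately show ?thesis using h by (intro that[OF r(1) wconv_in_closed_subspace[OF S l x(1)] l]) simp
qed

section \<open>Forms with a non-injective trace map\<close>

lemma tendsto_if_subsubseq:
  fixes X :: "nat \<Rightarrow> 'm::metric_space"
  assumes sub: "\<And>r :: nat \<Rightarrow> nat. strict_mono r \<Longrightarrow> \<exists>s :: nat \<Rightarrow> nat. strict_mono s \<and> (\<lambda>k. X (r (s k))) \<longlonglongrightarrow> L"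
  shows "X \<longlonglongrightarrow> L"
proof (rule ccontr)
  assume "\<not> ?thesis"
  then obtain e where e: "e > 0" "\<not> (\<forall>\<^sub>F n in sequentially. dist (X n) L < e)"
    by (auto simp: tendsto_iff)
  define A where "A = {n. \<not> dist (X n) L < e}"
  have "infinite A"
    using e(2) by (auto simp: A_def eventually_cofinite simp flip: cofinite_eq_sequentially)
  then obtain r :: "nat \<Rightarrow> nat" where r: "strict_mono r" "\<And>k. r k \<in> A"
    using infinite_enumerate by blast
  obtain s :: "nat \<Rightarrow> nat" where "(\<lambda>k. X (r (s k))) \<longlonglongrightarrow> L" using sub[OF r(1)] by blast
  then have "\<forall>\<^sub>F k in sequentially. dist (X (r (s k))) L < e" using e(1) by (rule tendstoD)
  then obtain k where "dist (X (r (s k))) L < e" using eventually_happens by fastforce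
  then show False using r(2)[of "s k"] by (simp add: A_def)
qed

lemma norm_le_of_square_le_inner:
  fixes x :: "'x::real_normed_vector"
  assumes "c > 0" "c * (norm x)\<^sup>2 \<le> t * norm x" "t \<ge> 0"
  shows "norm x \<le> t / c"
proof (cases "x = 0")
  case False
  have "norm x * (c * norm x) \<le> norm x * t" using assms(2) by (simp add: power2_eq_square algebra_simps)
  then show ?thesis using False assms(1) by (simp add: field_simps)
qed (use assms in simp)

text \<open>The abstract setting, instantiated later with the two graphs, the first projection for
  \<open>K\<close> and the trace map for \<open>J\<close>. All maps live on the whole space, and
  only the properties that genuinely depend on the graph are restricted to \<open>S\<close>.\<close>

locale dtn_form =
  fixes S S0 :: "'x::{real_inner,complete_space} set"
    and K :: "'x \<Rightarrow> 'c::{real_inner,complete_space}"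
    and J :: "'x \<Rightarrow> 'h::chilbert"
    and \<mu> M :: real
  assumes S: "closed S" "subspace S" and S0: "closed S0" "subspace S0" "S0 \<subseteq> S"
    and K: "bounded_linear K" "compact_map_on S K" "\<And>x. x \<in> S \<Longrightarrow> K x = 0 \<Longrightarrow> x = 0"
    and J: "bounded_linear J" "\<And>x. x \<in> S \<Longrightarrow> J x = 0 \<longleftrightarrow> x \<in> S0" "closure (J ` S) = UNIV"
    and \<mu>: "\<mu> > 0"
begin

definition garding :: "('x \<Rightarrow> 'x) \<Rightarrow> bool" where
  "garding B \<longleftrightarrow> bounded_linear B \<and> (\<forall>x. inner (B x) x \<ge> \<mu> * (norm x)\<^sup>2 - M * (norm (K x))\<^sup>2)"

text \<open>For graphs this is the interior equation in weak form, see
  \<open>mem_orth_\<Gamma>0_iff\<close>: no condition on boundary values is imposed.\<close>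

definition inner_solution :: "('x \<Rightarrow> 'x) \<Rightarrow> 'x \<Rightarrow> bool" where
  "inner_solution B p \<longleftrightarrow> p \<in> S \<and> (\<forall>q\<in>S0. inner (B p) q = 0)"

definition dirichlet_unique :: "('x \<Rightarrow> 'x) \<Rightarrow> bool" where
  "dirichlet_unique B \<longleftrightarrow> (\<forall>p\<in>S0. inner_solution B p \<longrightarrow> p = 0)"

text \<open>Asking for the estimate on all of \<open>S\<close> would force the form to be positive
  on \<open>S0\<close>, where \<open>J\<close> vanishes. Half of the Garding constant \<mu> is given
  up to make room for a compactness argument.\<close>

definition elliptic :: "('x \<Rightarrow> 'x) \<Rightarrow> real \<Rightarrow> bool" where
  "elliptic B \<omega> \<longleftrightarrow> (\<forall>p. inner_solution B p \<longrightarrow> \<mu> / 2 * (norm p)\<^sup>2 \<le> inner (B p) p + \<omega> * (norm (J p))\<^sup>2)"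

text \<open>The premises are exactly what \<open>weak_subseq\<close> provides for bounded sequences
  of interior solutions; arbitrary index sequences \<open>r\<close> are allowed because limits are
  always taken along subsequences.\<close>

definition conv_to :: "(nat \<Rightarrow> 'x \<Rightarrow> 'x) \<Rightarrow> ('x \<Rightarrow> 'x) \<Rightarrow> bool" where
  "conv_to Bn B \<longleftrightarrow> (\<forall>r p l. strict_mono r \<and> (\<forall>k. inner_solution (Bn (r k)) (p k)) \<and> l \<in> S
      \<and> wconv p l \<and> (\<lambda>k. K (p k)) \<longlonglongrightarrow> K l \<longrightarrow> wconv (\<lambda>k. Bn (r k) (p k)) (B l))"

text \<open>The variational form of the resolvent equation for the boundary value
  \<open>J p\<close>, see \<open>dtn_rel_iff_solves\<close>.\<close>

definition solves :: "('x \<Rightarrow> 'x) \<Rightarrow> real \<Rightarrow> 'h \<Rightarrow> 'x \<Rightarrow> bool" where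
  "solves B lam f p \<longleftrightarrow> p \<in> S \<and> (\<forall>q\<in>S. inner (B p) q + lam * inner (J p) (J q) = inner f (J q))"

definition sol :: "('x \<Rightarrow> 'x) \<Rightarrow> real \<Rightarrow> 'h \<Rightarrow> 'x" where
  "sol B lam f = (THE p. solves B lam f p)"

lemma J_S0: "x \<in> S0 \<Longrightarrow> J x = 0"
  using J(2) S0(3) by blast

lemma solves_imp_inner_solution: "solves B lam f p \<Longrightarrow> inner_solution B p"
  unfolding solves_def inner_solution_def using J_S0 S0(3) by fastforce

lemma elliptic_mono: "elliptic B \<omega> \<Longrightarrow> \<omega> \<le> \<omega>' \<Longrightarrow> elliptic B \<omega>'"
  unfolding elliptic_def by (meson add_left_mono mult_right_mono order_trans zero_le_power2)

lemma weak_subseq: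
  assumes "\<And>k. x k \<in> S" "\<And>k. norm (x k) \<le> C"
  obtains r l where "strict_mono (r :: nat \<Rightarrow> nat)" "l \<in> S" "wconv (\<lambda>k. x (r k)) l"
    "(\<lambda>k. K (x (r k))) \<longlonglongrightarrow> K l"
  by (rule compact_inj_imp_weak_subseq[OF S K(1,2,3) assms])

lemma inner_solution_limit:
  assumes "conv_to Bn B" "strict_mono r" "\<And>k. inner_solution (Bn (r k)) (p k)" "l \<in> S"
    "wconv p l" "(\<lambda>k. K (p k)) \<longlonglongrightarrow> K l"
  shows "wconv (\<lambda>k. Bn (r k) (p k)) (B l)" "inner_solution B l"
proof -
  show w: "wconv (\<lambda>k. Bn (r k) (p k)) (B l)" using assms unfolding conv_to_def by blast
  have "inner (B l) q = 0" if q: "q \<in> S0" for q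
  proof -
    have "inner (Bn (r k) (p k)) q = 0" for k using assms(3)[of k] q by (simp add: inner_solution_def)
    then show ?thesis using wconvD[OF w, of q] by (simp add: LIMSEQ_const_iff)
  qed
  then show "inner_solution B l" using assms(4) by (simp add: inner_solution_def)
qed

lemma conv_to_const: "bounded_linear B \<Longrightarrow> conv_to (\<lambda>_. B) B"
  unfolding conv_to_def using wconv_bounded_linear by blast

text \<open>A sequence violating all the estimates would, after normalisation in the norm of \<open>K\<close>,
  converge to a nonzero solution of the homogeneous limit problem with vanishing boundary data.\<close>

lemma eventually_elliptic:
  assumes g: "\<And>n. garding (Bn n)" and conv: "conv_to Bn B" and uniq: "dirichlet_unique B"
  obtains n0 \<omega> where "\<And>n. n \<ge> n0 \<Longrightarrow> elliptic (Bn n) \<omega>"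
proof (rule ccontr)
  assume "\<not> thesis"
  then have "\<not> (\<forall>n\<ge>k. elliptic (Bn n) (real k))" for k using that by blast
  then have neg: "\<exists>n\<ge>k. \<exists>p. inner_solution (Bn n) p \<and>
      inner (Bn n p) p + real k * (norm (J p))\<^sup>2 < \<mu> / 2 * (norm p)\<^sup>2" for k
    unfolding elliptic_def by (meson not_less)
  interpret K: bounded_linear K by (rule K(1))
  interpret J: bounded_linear J by (rule J(1))
  have "\<exists>n u. n \<ge> k \<and> inner_solution (Bn n) u \<and> norm (K u) = 1 \<and>
      \<mu> / 2 * (norm u)\<^sup>2 + real k * (norm (J u))\<^sup>2 < M" for k
  proof -
    obtain n p where p: "n \<ge> k" "inner_solution (Bn n) p"
      "inner (Bn n p) p + real k * (norm (J p))\<^sup>2 < \<mu> / 2 * (norm p)\<^sup>2" using neg by blast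
    interpret B: bounded_linear "Bn n" using g by (simp add: garding_def)
    define h where "h = norm (K p)"
    have "inner (Bn n p) p \<ge> \<mu> * (norm p)\<^sup>2 - M * h\<^sup>2" using g by (simp add: garding_def h_def)
    \<comment> \<open>One half of the Garding term absorbs the right-hand side of the violated
      estimate; the other half keeps the normalised sequence bounded.\<close>
    then have lt: "\<mu> / 2 * (norm p)\<^sup>2 + real k * (norm (J p))\<^sup>2 < M * h\<^sup>2" using p(3) by simp
    moreover have "\<mu> / 2 * (norm p)\<^sup>2 + real k * (norm (J p))\<^sup>2 \<ge> 0" using \<mu> by simp
    ultimately have h: "h > 0" by (cases "h = 0") (auto simp: h_def)
    define u where "u = (1 / h) *\<^sub>R p"
    have "norm (K u) = 1" using h by (simp add: u_def K.scaleR h_def)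
    moreover have "inner_solution (Bn n) u"
      using p(2) by (simp add: inner_solution_def u_def B.scaleR subspace_scale[OF S(2)])
    moreover have "\<mu> / 2 * (norm u)\<^sup>2 + real k * (norm (J u))\<^sup>2 = (\<mu> / 2 * (norm p)\<^sup>2 + real k * (norm (J p))\<^sup>2) / h\<^sup>2"
      using h by (simp add: u_def J.scaleR power_mult_distrib power_divide add_divide_distrib)
    then have "\<mu> / 2 * (norm u)\<^sup>2 + real k * (norm (J u))\<^sup>2 < M"
      using lt h by (simp add: divide_less_eq)
    ultimately show ?thesis using p(1) by blast
  qed
  then obtain \<nu> u where \<nu>: "\<And>k. \<nu> k \<ge> k" and u: "\<And>k. inner_solution (Bn (\<nu> k)) (u k)"
      "\<And>k. norm (K (u k)) = 1" "\<And>k. \<mu> / 2 * (norm (u k))\<^sup>2 + real k * (norm (J (u k)))\<^sup>2 < M" by metis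
  \<comment> \<open>The indices \<open>\<nu> k\<close> need not increase. This recursion gives
    \<open>\<nu> (r k) < r (Suc k) \<le> \<nu> (r (Suc k))\<close>, so they increase strictly along
    \<open>r\<close>.\<close>
  define r where "r = rec_nat 0 (\<lambda>_ m. Suc (\<nu> m))"
  have r_Suc: "r (Suc k) = Suc (\<nu> (r k))" for k by (simp add: r_def)
  have r: "strict_mono r" unfolding strict_mono_Suc_iff r_Suc using \<nu> by (simp add: less_Suc_eq_le)
  have \<nu>r: "strict_mono (\<lambda>k. \<nu> (r k))"
    unfolding strict_mono_Suc_iff using \<nu> r_Suc by (metis Suc_le_lessD)
  have bdd: "norm (u k) \<le> sqrt (2 * M / \<mu>)" for k
  proof (rule real_le_rsqrt)
    have "\<mu> / 2 * (norm (u k))\<^sup>2 \<le> M" using u(3)[of k] mult_nonneg_nonneg[OF of_nat_0_le_iff[of k] zero_le_power2[of "norm (J (u k))"]] by linarith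
    then show "(norm (u k))\<^sup>2 \<le> 2 * M / \<mu>" using \<mu> by (simp add: field_simps)
  qed
  obtain s l where s: "strict_mono s" "l \<in> S" "wconv (\<lambda>k. u (r (s k))) l" "(\<lambda>k. K (u (r (s k)))) \<longlonglongrightarrow> K l"
  proof (rule weak_subseq[where x = "\<lambda>k. u (r k)"])
    show "u (r k) \<in> S" for k using u(1) by (simp add: inner_solution_def)
    show "norm (u (r k)) \<le> sqrt (2 * M / \<mu>)" for k by (rule bdd)
  qed
  have "norm (K l) = 1" using LIMSEQ_unique[OF tendsto_norm[OF s(4)]] by (simp add: u(2))
  have "strict_mono (\<lambda>k. \<nu> (r (s k)))" using \<nu>r s(1) by (simp add: strict_mono_def)
  then have l: "inner_solution B l" using inner_solution_limit(2)[OF conv _ _ s(2,3,4)] u(1) by blast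
  have "(\<lambda>k. J (u k)) \<longlonglongrightarrow> 0"
  proof (rule tendsto_norm_zero_cancel, rule Lim_null_comparison)
    show "\<forall>\<^sub>F k in sequentially. norm (norm (J (u k))) \<le> sqrt (M / real k)"
    proof (rule eventually_sequentiallyI)
      fix k :: nat assume k: "1 \<le> k"
      have "real k * (norm (J (u k)))\<^sup>2 \<le> M"
        using u(3)[of k] mult_nonneg_nonneg[OF less_imp_le[OF \<mu>] zero_le_power2[of "norm (u k)"]] by simp
      then show "norm (norm (J (u k))) \<le> sqrt (M / real k)"
        using k by (intro real_le_rsqrt) (simp add: field_simps)
    qed
    show "(\<lambda>k. sqrt (M / real k)) \<longlonglongrightarrow> 0"
      using tendsto_real_sqrt[OF tendsto_divide_0[OF tendsto_const[of M] filterlim_at_top_imp_at_infinity[OF filterlim_real_sequentially]]]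
      by simp
  qed
  then have "(\<lambda>k. J (u (r (s k)))) \<longlonglongrightarrow> 0"
    using LIMSEQ_subseq_LIMSEQ[OF LIMSEQ_subseq_LIMSEQ[OF _ r] s(1)] by (simp add: comp_def)
  then have "J l = 0" using wconv_unique[OF wconv_bounded_linear[OF J(1) s(3)] tendsto_imp_wconv] by blast
  then have "l = 0" using J(2)[OF s(2)] uniq l by (simp add: dirichlet_unique_def)
  then show False using \<open>norm (K l) = 1\<close> by (simp add: K.zero)
qed

text \<open>The limit problem controls all large indices. Each of the finitely many others, and the
  limit itself, is treated as a constant sequence; the maximum of the constants works for all, and
  the entry 1 makes it positive.\<close>

lemma uniformly_elliptic:
  assumes g: "\<And>n. garding (Bn n)" "garding B" and conv: "conv_to Bn B"
    and uniq: "\<And>n. dirichlet_unique (Bn n)" "dirichlet_unique B"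
  obtains \<omega> where "\<omega> > 0" "\<And>n. elliptic (Bn n) \<omega>" "elliptic B \<omega>"
proof -
  have single: "\<exists>\<omega>. elliptic A \<omega>" if "garding A" "dirichlet_unique A" for A
    using eventually_elliptic[of "\<lambda>_. A" A] that conv_to_const[of A] by (metis garding_def order_refl)
  obtain n0 \<omega>0 where \<omega>0: "\<And>n. n \<ge> n0 \<Longrightarrow> elliptic (Bn n) \<omega>0"
    using eventually_elliptic[OF g(1) conv uniq(2)] by blast
  have "\<forall>n. \<exists>w. elliptic (Bn n) w" using single g(1) uniq(1) by blast
  then obtain w where w: "\<And>n. elliptic (Bn n) (w n)" by metis
  obtain w' where w': "elliptic B w'" using single g(2) uniq(2) by blast
  define \<omega> where "\<omega> = max 1 (max \<omega>0 (max w' (Max (w ` {..n0}))))"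
  have "elliptic (Bn n) \<omega>" for n
  proof (cases "n \<ge> n0")
    case False
    then have "w n \<le> Max (w ` {..n0})" by (intro Max_ge) auto
    then show ?thesis using elliptic_mono[OF w] by (simp add: \<omega>_def)
  qed (use elliptic_mono[OF \<omega>0] in \<open>simp add: \<omega>_def\<close>)
  moreover have "elliptic B \<omega>" using elliptic_mono[OF w'] by (simp add: \<omega>_def)
  ultimately show ?thesis using that[of \<omega>] by (simp add: \<omega>_def)
qed

section \<open>Unique solvability of the resolvent equation for a fixed form\<close>

context
  fixes B :: "'x \<Rightarrow> 'x" and \<omega> lam :: real
  assumes B: "garding B" and ell: "elliptic B \<omega>" and lam: "\<omega> \<le> lam" and lam0: "0 \<le> lam"
begin

text \<open>The equation is tested with its own solution. Since \<open>J\<close> vanishes on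
  \<open>S0\<close>, this solution is an interior one and the ellipticity estimate applies.\<close>

lemma solves_lower_bound:
  assumes "solves B lam f p"
  shows "\<mu> / 2 * (norm p)\<^sup>2 \<le> inner f (J p)"
proof -
  have "\<mu> / 2 * (norm p)\<^sup>2 \<le> inner (B p) p + \<omega> * (norm (J p))\<^sup>2"
    using ell solves_imp_inner_solution[OF assms] by (simp add: elliptic_def)
  also have "\<dots> \<le> inner (B p) p + lam * inner (J p) (J p)"
    using lam by (simp add: power2_norm_eq_inner mult_right_mono)
  also have "\<dots> = inner f (J p)" using assms by (simp add: solves_def)
  finally show ?thesis .
qed

lemma solves_bound:
  assumes "solves B lam f p"
  shows "norm p \<le> 2 * onorm J / \<mu> * norm f"
proof -
  have "inner f (J p) \<le> norm f * norm (J p)" by (rule norm_cauchy_schwarz)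
  also have "\<dots> \<le> norm f * (onorm J * norm p)" by (intro mult_left_mono onorm J(1)) simp
  finally have "\<mu> / 2 * (norm p)\<^sup>2 \<le> (norm f * onorm J) * norm p"
    using solves_lower_bound[OF assms] by simp
  then have "norm p \<le> (norm f * onorm J) / (\<mu> / 2)"
    using \<mu> onorm_pos_le[OF J(1)] by (intro norm_le_of_square_le_inner) auto
  then show ?thesis by (simp add: algebra_simps)
qed

lemma solves_diff:
  assumes "solves B lam f p" "solves B lam g q"
  shows "solves B lam (f - g) (p - q)"
proof -
  interpret B: bounded_linear B using B by (simp add: garding_def)
  interpret J: bounded_linear J by (rule J(1))
  have "p - q \<in> S" using assms S(2) by (simp add: solves_def subspace_diff)
  moreover have "inner (B (p - q)) v + lam * inner (J (p - q)) (J v) = inner (f - g) (J v)" if "v \<in> S" for v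
  proof -
    have "inner (B p) v + lam * inner (J p) (J v) = inner f (J v)"
      "inner (B q) v + lam * inner (J q) (J v) = inner g (J v)"
      using assms that by (simp_all add: solves_def)
    then show ?thesis by (simp add: B.diff J.diff inner_diff_left right_diff_distrib)
  qed
  ultimately show ?thesis by (simp add: solves_def)
qed

lemma solves_unique:
  assumes "solves B lam f p" "solves B lam f q"
  shows "p = q"
  using solves_bound[OF solves_diff[OF assms]] by simp

text \<open>Ellipticity yields uniqueness through \<open>solves_bound\<close>, but no coercivity on
  all of \<open>S\<close>; existence therefore comes from
  \<open>garding_inj_imp_surj\<close>.\<close>

lemma solves_exists: "\<exists>p. solves B lam f p"
proof -
  interpret B: bounded_linear B using B by (simp add: garding_def)
  interpret J: bounded_linear J by (rule J(1))
  interpret K: bounded_linear K by (rule K(1))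
  let ?P = "orth_proj S"
  note P = bounded_linear_orth_proj[OF S]
  interpret P: bounded_linear ?P by (rule P)
  obtain J' where J': "bounded_linear J'" "\<And>x y. inner (J x) y = inner x (J' y)"
    using bounded_linear_adjoint[OF J(1)] by metis
  \<comment> \<open>The operator of the form on \<open>S\<close>, completed by the identity on the
    orthogonal complement: the Fredholm alternative is stated for a whole space.\<close>
  define T where "T x = ?P (B (?P x) + lam *\<^sub>R J' (J (?P x))) + (x - ?P x)" for x
  have T: "bounded_linear T"
    unfolding T_def
    by (intro bounded_linear_add bounded_linear_sub bounded_linear_ident P
        bounded_linear_compose[OF P] bounded_linear_compose[OF B.bounded_linear_axioms P]
        bounded_linear_compose[OF bounded_linear_scaleR_right]
        bounded_linear_compose[OF J'(1) bounded_linear_compose[OF J(1) P]])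
  have T_inner: "inner (T x) q = inner (B (?P x)) q + lam * inner (J (?P x)) (J q)" if "q \<in> S" for x q
  proof -
    have "inner (J' (J (?P x))) q = inner (J (?P x)) (J q)"
      using J'(2)[of q "J (?P x)"] by (simp only: inner_commute)
    then show ?thesis
      by (simp only: T_def inner_add_left inner_scaleR_left orth_proj_inner[OF S that] orth_proj_diff[OF S that])
  qed
  have T_perp: "inner (T x) (x - ?P x) = (norm (x - ?P x))\<^sup>2" for x
  proof -
    have "inner (?P y) (x - ?P x) = 0" for y
      using orth_proj_diff[OF S orth_proj_in[OF S], of x y] by (simp only: inner_commute)
    then show ?thesis by (simp only: T_def inner_add_left power2_norm_eq_inner)
  qed
  have nrm: "(norm x)\<^sup>2 = (norm (?P x))\<^sup>2 + (norm (x - ?P x))\<^sup>2" for x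
    using orth_proj_diff[OF S orth_proj_in[OF S], of x x]
    by (simp add: power2_norm_eq_inner inner_diff_left inner_diff_right inner_commute)
  have "surj T"
  proof (rule garding_inj_imp_surj[OF T bounded_linear_compose[OF K(1) P]])
    show "compact_map_on UNIV (\<lambda>x. K (?P x))"
      unfolding compact_map_on_def
    proof (intro allI impI)
      fix x :: "nat \<Rightarrow> 'x" and C
      assume "\<forall>k. x k \<in> UNIV \<and> norm (x k) \<le> C"
      then have "norm (?P (x k)) \<le> C" for k using norm_orth_proj_le[OF S, of "x k"] order_trans by blast
      then show "\<exists>r. strict_mono r \<and> convergent (\<lambda>k. K (?P (x (r k))))"
        using compact_map_onE[OF K(2), of "\<lambda>k. ?P (x k)" C] orth_proj_in[OF S] by metis
    qed
    \<comment> \<open>The coercivity constant is \<mu> on \<open>S\<close> and 1 on its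
      complement.\<close>
    show "min \<mu> 1 > 0" using \<mu> by simp
    show "min \<mu> 1 * (norm x)\<^sup>2 - M * (norm (K (?P x)))\<^sup>2 \<le> inner (T x) x" for x
    proof -
      have "inner (T x) x = inner (T x) (?P x) + inner (T x) (x - ?P x)" by (simp add: inner_diff_right)
      also have "\<dots> = inner (B (?P x)) (?P x) + lam * (norm (J (?P x)))\<^sup>2 + (norm (x - ?P x))\<^sup>2"
        by (simp add: T_inner[OF orth_proj_in[OF S]] T_perp power2_norm_eq_inner)
      also have "\<dots> \<ge> \<mu> * (norm (?P x))\<^sup>2 - M * (norm (K (?P x)))\<^sup>2 + (norm (x - ?P x))\<^sup>2"
        using B lam0 by (simp add: garding_def add_increasing2)
      finally have "\<mu> * (norm (?P x))\<^sup>2 + 1 * (norm (x - ?P x))\<^sup>2 - M * (norm (K (?P x)))\<^sup>2 \<le> inner (T x) x"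
        by simp
      moreover have "min \<mu> 1 * (norm (?P x))\<^sup>2 \<le> \<mu> * (norm (?P x))\<^sup>2"
        "min \<mu> 1 * (norm (x - ?P x))\<^sup>2 \<le> 1 * (norm (x - ?P x))\<^sup>2"
        by (rule mult_right_mono; simp)+
      ultimately show ?thesis unfolding nrm[of x] distrib_left by linarith
    qed
    have "x = 0" if Tx: "T x = 0" for x
    proof -
      have "x = ?P x" using T_perp[of x] Tx by simp
      moreover have "solves B lam 0 (?P x)"
        unfolding solves_def using T_inner[of _ x] Tx orth_proj_in[OF S] by simp
      then have "?P x = 0" using solves_bound[of 0] by simp
      ultimately show ?thesis by simp
    qed
    then show "inj T" using linear_injective_0[OF bounded_linear.linear[OF T]] by blast
  qed
  then obtain x where "J' f = T x" by (rule surjE)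
  then have "solves B lam f (?P x)"
    unfolding solves_def using T_inner[of _ x] orth_proj_in[OF S] J'(2) by (metis inner_commute)
  then show ?thesis by blast
qed

lemma solves_sol: "solves B lam f (sol B lam f)"
  unfolding sol_def using solves_exists solves_unique by (metis theI)

lemma sol_eqI: "solves B lam f p \<Longrightarrow> sol B lam f = p"
  using solves_sol solves_unique by blast

lemma bounded_linear_sol: "bounded_linear (sol B lam)"
proof -
  interpret B: bounded_linear B using B by (simp add: garding_def)
  interpret J: bounded_linear J by (rule J(1))
  have sol: "sol B lam f \<in> S"
    "q \<in> S \<Longrightarrow> inner (B (sol B lam f)) q + lam * inner (J (sol B lam f)) (J q) = inner f (J q)" for f q
    using solves_sol by (auto simp: solves_def)
  show ?thesis
  proof (rule bounded_linear_intro)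
    show "sol B lam (f + g) = sol B lam f + sol B lam g" for f g
    proof (rule sol_eqI)
      have "inner (B (sol B lam f + sol B lam g)) q + lam * inner (J (sol B lam f + sol B lam g)) (J q) = inner (f + g) (J q)"
        if "q \<in> S" for q
        using sol(2)[OF that, of f] sol(2)[OF that, of g] by (simp add: B.add J.add inner_add_left distrib_left)
      then show "solves B lam (f + g) (sol B lam f + sol B lam g)"
        using sol(1) S(2) by (simp add: solves_def subspace_add)
    qed
    show "sol B lam (r *\<^sub>R f) = r *\<^sub>R sol B lam f" for r f
    proof (rule sol_eqI)
      have "inner (B (r *\<^sub>R sol B lam f)) q + lam * inner (J (r *\<^sub>R sol B lam f)) (J q) = r * inner f (J q)"
        if "q \<in> S" for q
        using sol(2)[OF that, of f, symmetric] by (simp add: B.scaleR J.scaleR distrib_left)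
      then show "solves B lam (r *\<^sub>R f) (r *\<^sub>R sol B lam f)"
        using sol(1) S(2) by (simp add: solves_def subspace_scale)
    qed
    show "norm (sol B lam f) \<le> norm f * (2 * onorm J / \<mu>)" for f
      using solves_bound[OF solves_sol] by (simp add: mult.commute)
  qed
qed

end

end

section \<open>Convergence of solutions\<close>

context dtn_form begin

lemma data_weak_subseq:
  assumes f: "\<And>k. norm (f k) \<le> C"
  obtains r l where "strict_mono (r :: nat \<Rightarrow> nat)" "wconv (\<lambda>k. f (r k) :: 'h) l"
proof -
  obtain J' where J': "bounded_linear J'" "\<And>x y. inner (J x) y = inner x (J' y)"
    using bounded_linear_adjoint[OF J(1)] by metis
  interpret J': bounded_linear J' by fact
  define x where "x k = orth_proj S (J' (f k))" for k
  have x: "inner (f k) (J q) = inner (x k) q" if "q \<in> S" for k q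
    using orth_proj_inner[OF S that, of "J' (f k)"] J'(2)[of q "f k"]
    by (simp only: x_def inner_commute)
  obtain B where B: "B \<ge> 0" "\<And>y. norm (J' y) \<le> norm y * B" using J'.nonneg_bounded by blast
  have xb: "norm (x k) \<le> C * B" for k
  proof -
    have "norm (x k) \<le> norm (J' (f k))" unfolding x_def by (rule norm_orth_proj_le[OF S])
    also have "\<dots> \<le> norm (f k) * B" by (rule B(2))
    also have "\<dots> \<le> C * B" by (intro mult_right_mono f B(1))
    finally show ?thesis .
  qed
  have xS: "x k \<in> S" for k unfolding x_def by (rule orth_proj_in[OF S])
  obtain r l where r: "strict_mono (r :: nat \<Rightarrow> nat)" "wconv (\<lambda>k. x (r k)) l"
    by (rule weak_subseq[OF xS xb])
  have conv: "convergent (\<lambda>k. inner (f (r k)) y)" if y: "y \<in> J ` S" for y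
  proof -
    obtain q where "q \<in> S" "y = J q" using y by blast
    then show ?thesis using convergentI[OF wconvD[OF r(2), of q]] by (simp add: x)
  qed
  obtain l' where "wconv (\<lambda>k. f (r k)) l'"
    by (rule wconv_if_convergent_on_dense[OF f J(3) conv])
  then show ?thesis by (rule that[OF r(1)])
qed

context
  fixes Bn :: "nat \<Rightarrow> 'x \<Rightarrow> 'x" and B :: "'x \<Rightarrow> 'x" and \<omega> lam :: real
  assumes Bn: "\<And>n. garding (Bn n)" "\<And>n. elliptic (Bn n) \<omega>"
    and B: "garding B" "elliptic B \<omega>" and conv: "conv_to Bn B"
    and lam: "\<omega> \<le> lam" "0 \<le> lam"
begin

text \<open>Constant data serve convergence in the weak operator topology; the varying, weakly
  convergent data serve convergence in norm. The limit equation is obtained by fixing the test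
  element \<open>q\<close> and letting \<open>k\<close> tend to infinity.\<close>

lemma sol_weak_subseq:
  assumes r: "strict_mono r" and f: "wconv f f0" "\<And>k. norm (f k) \<le> C"
  obtains s where "strict_mono (s :: nat \<Rightarrow> nat)" "wconv (\<lambda>k. sol (Bn (r (s k))) lam (f (s k))) (sol B lam f0)"
proof -
  define p where "p k = sol (Bn (r k)) lam (f k)" for k
  have p: "solves (Bn (r k)) lam (f k) (p k)" for k
    unfolding p_def by (rule solves_sol[OF Bn lam])
  have bdd: "norm (p k) \<le> 2 * onorm J / \<mu> * C" for k
  proof -
    have "norm (p k) \<le> 2 * onorm J / \<mu> * norm (f k)" by (rule solves_bound[OF Bn lam p])
    also have "\<dots> \<le> 2 * onorm J / \<mu> * C"
      using onorm_pos_le[OF J(1)] \<mu> by (intro mult_left_mono f(2)) simp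
    finally show ?thesis .
  qed
  have pS: "p k \<in> S" for k using p by (simp add: solves_def)
  obtain s l where s: "strict_mono s" "l \<in> S" "wconv (\<lambda>k. p (s k)) l" "(\<lambda>k. K (p (s k))) \<longlonglongrightarrow> K l"
    by (rule weak_subseq[OF pS bdd])
  have w: "wconv (\<lambda>k. Bn (r (s k)) (p (s k))) (B l)"
  proof (rule inner_solution_limit(1)[OF conv _ _ s(2,3,4)])
    show "strict_mono (\<lambda>k. r (s k))" using r s(1) by (simp add: strict_mono_def)
    show "inner_solution (Bn (r (s k))) (p (s k))" for k by (rule solves_imp_inner_solution[OF p])
  qed
  have "inner (B l) q + lam * inner (J l) (J q) = inner f0 (J q)" if q: "q \<in> S" for q
  proof (rule LIMSEQ_unique)
    show "(\<lambda>k. inner (Bn (r (s k)) (p (s k))) q + lam * inner (J (p (s k))) (J q))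
        \<longlonglongrightarrow> inner (B l) q + lam * inner (J l) (J q)"
      by (intro tendsto_intros wconvD[OF w] wconvD[OF wconv_bounded_linear[OF J(1) s(3)]])
    have "inner (Bn (r (s k)) (p (s k))) q + lam * inner (J (p (s k))) (J q) = inner (f (s k)) (J q)" for k
      using p[of "s k"] q by (simp add: solves_def)
    then show "(\<lambda>k. inner (Bn (r (s k)) (p (s k))) q + lam * inner (J (p (s k))) (J q))
        \<longlonglongrightarrow> inner f0 (J q)"
      using wconvD[OF wconv_subseq[OF f(1) s(1)], of "J q"] by simp
  qed
  then have "sol B lam f0 = l" using s(2) by (intro sol_eqI[OF B lam]) (simp add: solves_def)
  then show ?thesis using that[OF s(1)] s(3) by (simp add: p_def)
qed

lemma sol_wconv: "wconv (\<lambda>n. J (sol (Bn n) lam f)) (J (sol B lam f))"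
  unfolding wconv_def
proof (intro allI tendsto_if_subsubseq)
  fix y and r :: "nat \<Rightarrow> nat" assume r: "strict_mono r"
  obtain s where s: "strict_mono (s :: nat \<Rightarrow> nat)" "wconv (\<lambda>k. sol (Bn (r (s k))) lam f) (sol B lam f)"
    by (rule sol_weak_subseq[OF r, of "\<lambda>_. f" f "norm f"]) (simp_all add: wconv_def)
  show "\<exists>s. strict_mono s \<and> (\<lambda>k. inner (J (sol (Bn (r (s k))) lam f)) y) \<longlonglongrightarrow> inner (J (sol B lam f)) y"
    by (intro exI[of _ s] conjI s(1) wconvD[OF wconv_bounded_linear[OF J(1) s(2)]])
qed

text \<open>Compactness of \<open>J\<close> gives strong convergence of a further subsequence, and
  weak convergence of the solutions identifies its limit.\<close>

lemma sol_strong_subseq: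
  assumes cpt: "compact_map_on S J"
    and r: "strict_mono r" and f: "wconv f f0" "\<And>k. norm (f k) \<le> C"
  obtains s where "strict_mono (s :: nat \<Rightarrow> nat)" "(\<lambda>k. J (sol (Bn (r (s k))) lam (f (s k)))) \<longlonglongrightarrow> J (sol B lam f0)"
proof -
  obtain s where s: "strict_mono (s :: nat \<Rightarrow> nat)" "wconv (\<lambda>k. sol (Bn (r (s k))) lam (f (s k))) (sol B lam f0)"
    by (rule sol_weak_subseq[OF r f])
  have bdd: "norm (sol (Bn (r (s k))) lam (f (s k))) \<le> 2 * onorm J / \<mu> * C" for k
  proof -
    have "norm (sol (Bn (r (s k))) lam (f (s k))) \<le> 2 * onorm J / \<mu> * norm (f (s k))"
      by (rule solves_bound[OF Bn lam solves_sol[OF Bn lam]])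
    also have "\<dots> \<le> 2 * onorm J / \<mu> * C"
      using onorm_pos_le[OF J(1)] \<mu> by (intro mult_left_mono f(2)) simp
    finally show ?thesis .
  qed
  have inS: "sol (Bn (r (s k))) lam (f (s k)) \<in> S" for k
    using solves_sol[OF Bn lam] by (simp add: solves_def)
  obtain t where t: "strict_mono t" "convergent (\<lambda>k. J (sol (Bn (r (s (t k)))) lam (f (s (t k)))))"
    by (rule compact_map_onE[OF cpt inS bdd])
  then obtain l where l: "(\<lambda>k. J (sol (Bn (r (s (t k)))) lam (f (s (t k))))) \<longlonglongrightarrow> l"
    by (auto simp: convergent_def)
  have "l = J (sol B lam f0)"
    by (rule wconv_unique[OF tendsto_imp_wconv[OF l] wconv_bounded_linear[OF J(1) wconv_subseq[OF s(2) t(1)]]])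
  moreover have "strict_mono (\<lambda>k. s (t k))" using s(1) t(1) by (simp add: strict_mono_def)
  ultimately show ?thesis using that[of "\<lambda>k. s (t k)"] l by simp
qed

end

text \<open>The operator norm is nearly attained at vectors \<open>f k\<close> of the unit ball,
  which converge weakly to some \<open>f0\<close> along a subsequence. Both resolvents applied to
  these vectors then converge strongly to the same limit, the trace of the solution of the limit
  problem with datum \<open>f0\<close>.\<close>

lemma sol_onorm_conv:
  assumes Bn: "\<And>n. garding (Bn n)" "\<And>n. elliptic (Bn n) \<omega>"
    and B: "garding B" "elliptic B \<omega>" and conv: "conv_to Bn B"
    and lam: "\<omega> \<le> lam" "0 \<le> lam" and cpt: "compact_map_on S J"
  shows "(\<lambda>n. onorm (\<lambda>f. J (sol (Bn n) lam f) - J (sol B lam f))) \<longlonglongrightarrow> 0"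
proof (rule tendsto_if_subsubseq)
  fix r :: "nat \<Rightarrow> nat" assume r: "strict_mono r"
  define R where "R k f = J (sol (Bn (r k)) lam f) - J (sol B lam f)" for k f
  have R: "bounded_linear (R k)" for k
    unfolding R_def
    by (intro bounded_linear_sub bounded_linear_compose[OF J(1)] bounded_linear_sol[OF Bn lam] bounded_linear_sol[OF B lam])
  have "\<exists>f. norm f \<le> 1 \<and> onorm (R k) \<le> norm (R k f) + 1 / real (Suc k)" for k
  proof (cases "onorm (R k) \<le> 1 / real (Suc k)")
    case True
    then show ?thesis by (intro exI[of _ 0]) (simp add: add_increasing)
  next
    case False
    interpret Rk: bounded_linear "R k" by (rule R)
    let ?b = "onorm (R k) - 1 / real (Suc k)"
    have "\<not> (\<forall>x. norm (R k x) \<le> ?b * norm x)"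
    proof
      assume "\<forall>x. norm (R k x) \<le> ?b * norm x"
      then have "onorm (R k) \<le> ?b" using False by (intro onorm_bound) auto
      then show False by (simp add: field_simps)
    qed
    then obtain x where x: "norm (R k x) > ?b * norm x" by (auto simp: not_le)
    then have x0: "x \<noteq> 0" by (auto simp: Rk.zero)
    have "norm (R k ((1 / norm x) *\<^sub>R x)) = norm (R k x) / norm x" by (simp add: Rk.scaleR)
    also have "\<dots> > onorm (R k) - 1 / real (Suc k)" using x x0 by (simp add: less_divide_eq)
    finally show ?thesis using x0 by (intro exI[of _ "(1 / norm x) *\<^sub>R x"]) simp
  qed
  then obtain f where f: "\<And>k. norm (f k) \<le> 1" "\<And>k. onorm (R k) \<le> norm (R k (f k)) + 1 / real (Suc k)"
    by metis
  obtain s f0 where s: "strict_mono (s :: nat \<Rightarrow> nat)" "wconv (\<lambda>k. f (s k)) f0"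
    by (rule data_weak_subseq[OF f(1)])
  have rs: "strict_mono (\<lambda>k. r (s k))" using r s(1) by (simp add: strict_mono_def)
  obtain t where t: "strict_mono (t :: nat \<Rightarrow> nat)"
      "(\<lambda>k. J (sol (Bn (r (s (t k)))) lam (f (s (t k))))) \<longlonglongrightarrow> J (sol B lam f0)"
    using sol_strong_subseq[where f = "\<lambda>k. f (s k)" and C = 1, OF Bn B conv lam cpt rs s(2)] f(1) by auto
  have bl: "bounded_linear B" using B(1) by (simp add: garding_def)
  \<comment> \<open>The limit resolvent is treated as a constant sequence of forms, which shows that
    it maps the weakly convergent data to a strongly convergent sequence.\<close>
  obtain v where v: "strict_mono (v :: nat \<Rightarrow> nat)"
      "(\<lambda>k. J (sol B lam (f (s (t (v k)))))) \<longlonglongrightarrow> J (sol B lam f0)"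
    using sol_strong_subseq[where Bn = "\<lambda>_. B" and f = "\<lambda>k. f (s (t k))" and C = 1,
        OF B B conv_to_const[OF bl] lam cpt strict_mono_id wconv_subseq[OF s(2) t(1)]] f(1) by auto
  define \<rho> where "\<rho> k = s (t (v k))" for k
  have \<rho>: "strict_mono \<rho>" using s(1) t(1) v(1) by (simp add: strict_mono_def \<rho>_def)
  have "(\<lambda>k. R (\<rho> k) (f (\<rho> k))) \<longlonglongrightarrow> J (sol B lam f0) - J (sol B lam f0)"
    unfolding R_def \<rho>_def
    by (rule tendsto_diff[OF LIMSEQ_subseq_LIMSEQ[OF t(2) v(1), unfolded comp_def] v(2)])
  then have "(\<lambda>k. norm (R (\<rho> k) (f (\<rho> k))) + 1 / real (Suc (\<rho> k))) \<longlonglongrightarrow> 0 + 0"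
    by (intro tendsto_add tendsto_norm_zero
        LIMSEQ_subseq_LIMSEQ[OF LIMSEQ_Suc[OF lim_1_over_n] \<rho>, unfolded comp_def]) simp
  then have lim: "(\<lambda>k. norm (R (\<rho> k) (f (\<rho> k))) + 1 / real (Suc (\<rho> k))) \<longlonglongrightarrow> 0" by simp
  have "(\<lambda>k. onorm (R (\<rho> k))) \<longlonglongrightarrow> 0"
  proof (rule Lim_null_comparison[OF _ lim], rule always_eventually, rule allI)
    show "norm (onorm (R (\<rho> k))) \<le> norm (R (\<rho> k) (f (\<rho> k))) + 1 / real (Suc (\<rho> k))" for k
      using onorm_pos_le[OF R, of "\<rho> k"] f(2)[of "\<rho> k"] by simp
  qed
  moreover have "R k = (\<lambda>f. J (sol (Bn (r k)) lam f) - J (sol B lam f))" for k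
    by (simp add: fun_eq_iff R_def)
  ultimately have "(\<lambda>k. onorm (\<lambda>f. J (sol (Bn (r (\<rho> k))) lam f) - J (sol B lam f))) \<longlonglongrightarrow> 0" by simp
  with \<rho> show "\<exists>s. strict_mono s \<and> (\<lambda>k. onorm (\<lambda>f. J (sol (Bn (r (s k))) lam f) - J (sol B lam f))) \<longlonglongrightarrow> 0"
    by blast
qed

end

section \<open>Graphs of boundary pairs\<close>

lemma Re_cinner: "Re (cinner x y) = inner x y"
  and Im_cinner: "Im (cinner x y) = - inner (ciu x) y"
  by (simp_all add: cinner_def)

lemma inner_ciu_right: "inner x (ciu y) = - inner (ciu x) (y :: 'a::chilbert)"
proof -
  have "inner (ciu x) (ciu (ciu y)) = inner x (ciu y)" by (rule ciu_inner)
  then show ?thesis by (simp add: ciu_ciu)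
qed

lemma inner_ciu_self: "inner (ciu x) (x :: 'a::chilbert) = 0"
  using inner_ciu_right[of x x] by (simp add: inner_commute)

lemma cscale_simps: "cscale (complex_of_real r) x = r *\<^sub>R x" "cscale \<i> x = ciu x"
  by (simp_all add: cscale_def)

lemma clinear_onD:
  assumes "clinear_on S f"
  shows "subspace S" "x \<in> S \<Longrightarrow> y \<in> S \<Longrightarrow> f (x + y) = f x + f y" "x \<in> S \<Longrightarrow> f (r *\<^sub>R x) = r *\<^sub>R f x"
    "x \<in> S \<Longrightarrow> ciu x \<in> S" "x \<in> S \<Longrightarrow> f (ciu x) = ciu (f x)" "f 0 = 0"
proof -
  have s: "0 \<in> S" "\<And>x y. x \<in> S \<Longrightarrow> y \<in> S \<Longrightarrow> x + y \<in> S" "\<And>c x. x \<in> S \<Longrightarrow> cscale c x \<in> S"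
    and f: "\<And>x y. x \<in> S \<Longrightarrow> y \<in> S \<Longrightarrow> f (x + y) = f x + f y" "\<And>c x. x \<in> S \<Longrightarrow> f (cscale c x) = cscale c (f x)"
    using assms by (auto simp: clinear_on_def csubspace_def)
  show "subspace S" using s(1,2) s(3)[of _ "complex_of_real _"] by (simp add: subspace_def cscale_simps)
  show "x \<in> S \<Longrightarrow> y \<in> S \<Longrightarrow> f (x + y) = f x + f y" by (rule f(1))
  show "x \<in> S \<Longrightarrow> f (r *\<^sub>R x) = r *\<^sub>R f x" using f(2)[of x "complex_of_real r"] by (simp add: cscale_simps)
  show "x \<in> S \<Longrightarrow> ciu x \<in> S" using s(3)[of x \<i>] by (simp add: cscale_simps)
  show "x \<in> S \<Longrightarrow> f (ciu x) = ciu (f x)" using f(2)[of x \<i>] by (simp add: cscale_simps)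
  show "f 0 = 0" using f(2)[OF s(1), of 0] by (simp add: cscale_def)
qed

lemma cboundedI:
  assumes "bounded_linear f" "\<And>x. f (ciu x) = ciu (f x)"
  shows "cbounded f"
proof -
  interpret bounded_linear f by fact
  show ?thesis
    using assms by (simp add: cbounded_def clinear_on_def csubspace_def cscale_def add scaleR)
qed

text \<open>The real identity at \<open>ciu x\<close> is the imaginary part of the complex identity
  at \<open>x\<close>.\<close>

lemma cinner_eq_iff_inner_eq:
  assumes f: "clinear_on S f" and g: "clinear_on S g"
  shows "(\<forall>x\<in>S. cinner (f x) y = cinner (g x) z) \<longleftrightarrow> (\<forall>x\<in>S. inner (f x) y = inner (g x) z)"
proof (intro iffI ballI)
  fix x assume "\<forall>x\<in>S. cinner (f x) y = cinner (g x) z" "x \<in> S"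
  then show "inner (f x) y = inner (g x) z" by (metis Re_cinner)
next
  fix x assume eq: "\<forall>x\<in>S. inner (f x) y = inner (g x) z" and x: "x \<in> S"
  have "inner (f (ciu x)) y = inner (g (ciu x)) z" using eq clinear_onD(4)[OF f x] by blast
  then show "cinner (f x) y = cinner (g x) z"
    using eq x clinear_onD(5)[OF f x] clinear_onD(5)[OF g x] by (simp add: cinner_def)
qed

lemma clinear_on_id: "clinear_on S f \<Longrightarrow> clinear_on S (\<lambda>x. x)"
  by (simp add: clinear_on_def)

definition orth :: "'x::real_inner set \<Rightarrow> 'x set" where
  "orth W = {x. \<forall>p\<in>W. inner x p = 0}"

lemma closed_orth: "closed (orth W)"
proof -
  have "orth W = (\<Inter>p\<in>W. {x. inner x p = 0})" by (auto simp: orth_def)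
  then show ?thesis by (auto intro!: closed_INT closed_Collect_eq continuous_intros)
qed

lemma subspace_orth: "subspace (orth W)"
  by (auto simp: subspace_def orth_def inner_add_left)

lemma orth_orth:
  assumes "closed (S :: 'x::{real_inner,complete_space} set)" "subspace S"
  shows "orth (orth S) = S"
proof (rule set_eqI)
  show "x \<in> orth (orth S) \<longleftrightarrow> x \<in> S" for x
    unfolding mem_closed_subspace_iff[OF assms, of x] by (simp add: orth_def)
qed

lemma inner_swap: "inner (prod.swap x) y = inner x (prod.swap y)"
  by (cases x; cases y) (simp add: inner_commute)

lemma mem_graph_of [simp]: "(x, y) \<in> graph_of S f \<longleftrightarrow> x \<in> S \<and> y = f x"
  by (auto simp: graph_of_def)

lemma subspace_graph_of:
  assumes "clinear_on S f"
  shows "subspace (graph_of S f)"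
proof -
  note s = clinear_onD[OF assms]
  show ?thesis
    unfolding subspace_def
  proof (intro conjI ballI allI)
    show "0 \<in> graph_of S f" using s(6) subspace_0[OF s(1)] by (simp add: zero_prod_def)
    show "x + y \<in> graph_of S f" if "x \<in> graph_of S f" "y \<in> graph_of S f" for x y
      using that s(2) subspace_add[OF s(1)] by (cases x; cases y) simp
    show "c *\<^sub>R x \<in> graph_of S f" if "x \<in> graph_of S f" for x c
      using that s(3) subspace_scale[OF s(1)] by (cases x) simp
  qed
qed

lemma orth_swap: "orth (prod.swap ` W) = prod.swap ` orth W"
proof (rule set_eqI)
  fix x
  have "x \<in> prod.swap ` orth W \<longleftrightarrow> prod.swap x \<in> orth W" by (force simp: image_iff)
  then show "x \<in> orth (prod.swap ` W) \<longleftrightarrow> x \<in> prod.swap ` orth W" by (simp add: orth_def inner_swap)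
qed

lemma bounded_linear_map_prod:
  assumes "bounded_linear m" "bounded_linear a"
  shows "bounded_linear (map_prod m a)"
proof -
  have "map_prod m a = (\<lambda>x. (m (fst x), a (snd x)))" by (auto simp: fun_eq_iff)
  then show ?thesis
    by (simp only:) (intro bounded_linear_Pair bounded_linear_compose[OF assms(1)]
        bounded_linear_compose[OF assms(2)] bounded_linear_fst bounded_linear_snd)
qed

definition ciu2 :: "'a::chilbert \<times> 'b::chilbert \<Rightarrow> 'a \<times> 'b" where
  "ciu2 = map_prod ciu ciu"

lemma ciu2_simps [simp]: "ciu2 (x, y) = (ciu x, ciu y)" "fst (ciu2 p) = ciu (fst p)" "snd (ciu2 p) = ciu (snd p)"
  by (simp_all add: ciu2_def)

lemma inner_ciu2: "inner (ciu2 p) (ciu2 q) = inner p q"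
  by (cases p; cases q) (simp add: ciu_inner)

lemma inner_ciu2_left: "inner (ciu2 p) q = - inner p (ciu2 q)"
  by (cases p; cases q) (simp add: inner_ciu_right)

lemma map_prod_ciu2:
  assumes "cbounded m" "cbounded a"
  shows "map_prod m a (ciu2 p) = ciu2 (map_prod m a p)"
  using clinear_onD(5)[of UNIV m "fst p"] clinear_onD(5)[of UNIV a "snd p"] assms
  by (cases p) (simp add: cbounded_def)

lemma norm_ciu2: "norm (ciu2 p) = norm p"
  by (simp add: norm_eq_sqrt_inner inner_ciu2)

text \<open>For real subspaces this amounts to being a complex subspace; it is the property that
  makes projections and solution operators commute with the imaginary unit.\<close>

definition ciu_invariant :: "('a::chilbert \<times> 'b::chilbert) set \<Rightarrow> bool" where
  "ciu_invariant W \<longleftrightarrow> (\<forall>p\<in>W. ciu2 p \<in> W)"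

lemma ciu_invariant_orth: "ciu_invariant W \<Longrightarrow> ciu_invariant (orth W)"
  by (auto simp: ciu_invariant_def orth_def inner_ciu2_left)

lemma ciu_invariant_graph_of: "clinear_on S f \<Longrightarrow> ciu_invariant (graph_of S f)"
  unfolding ciu_invariant_def by (auto simp: graph_of_def clinear_onD(4,5))

lemma ciu_invariant_swap: "ciu_invariant W \<Longrightarrow> ciu_invariant (prod.swap ` W)"
  unfolding ciu_invariant_def
proof
  fix p assume W: "\<forall>p\<in>W. ciu2 p \<in> W" and "p \<in> prod.swap ` W"
  then obtain q where q: "q \<in> W" "p = prod.swap q" by blast
  then have "ciu2 p = prod.swap (ciu2 q)" by (cases q) simp
  then show "ciu2 p \<in> prod.swap ` W" using W q(1) by blast
qed

lemma orth_proj_ciu2: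
  assumes W: "closed W" "subspace W" "ciu_invariant W"
  shows "orth_proj W (ciu2 p) = ciu2 (orth_proj W p)"
proof (rule orth_proj_eqI[OF W(1,2)])
  show "ciu2 (orth_proj W p) \<in> W" using W(3) orth_proj_in[OF W(1,2)] by (simp add: ciu_invariant_def)
  fix q assume "q \<in> W"
  then show "inner (ciu2 (orth_proj W p)) q = inner (ciu2 p) q"
    using W(3) orth_proj_inner[OF W(1,2), of "ciu2 q" p] by (simp add: ciu_invariant_def inner_ciu2_left)
qed

lemma ginner_eq_0_iff:
  assumes f: "clinear_on S f" and V: "\<And>v. v \<in> V \<Longrightarrow> v \<in> S \<and> ciu v \<in> V"
  shows "(\<forall>v\<in>V. ginner f u v = 0) \<longleftrightarrow> (\<forall>v\<in>V. inner (u, f u) (v, f v) = 0)"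
proof (intro iffI ballI)
  fix v assume "\<forall>v\<in>V. ginner f u v = 0" "v \<in> V"
  then have "Re (ginner f u v) = 0" by simp
  then show "inner (u, f u) (v, f v) = 0" by (simp add: ginner_def Re_cinner)
next
  fix v assume eq: "\<forall>v\<in>V. inner (u, f u) (v, f v) = 0" and v: "v \<in> V"
  have "inner (u, f u) (ciu v, f (ciu v)) = 0" using eq V[OF v] by blast
  then show "ginner f u v = 0"
    using eq v clinear_onD(5)[OF f, of v] V[OF v]
    by (intro complex_eqI) (simp_all add: ginner_def Re_cinner Im_cinner inner_ciu_right)
qed

text \<open>Orthogonality of \<open>(z, y)\<close> to \<open>(x, f x)\<close> reads
  \<open>inner (f x) y = inner x (- z)\<close>. Swapping the orthogonal complement of a graph thus
  yields the graph of the negative adjoint, with the sign that \<open>Gring\<close> and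
  \<open>Dring\<close> carry. Density makes the adjoint well defined.\<close>

lemma adj_characterization:
  assumes f: "clinear_on S f" and dense: "closure S = UNIV"
  shows "(y, z) \<in> prod.swap ` orth (graph_of S f) \<longleftrightarrow> y \<in> adj_dom S f \<and> z = - adj S f y"
proof -
  have iff: "(\<forall>x\<in>S. cinner (f x) y = cinner x z) \<longleftrightarrow> (\<forall>x\<in>S. inner (f x) y = inner x z)" for y z
    by (rule cinner_eq_iff_inner_eq[OF f clinear_on_id[OF f]])
  have uniq: "z = z'" if z: "\<forall>x\<in>S. inner x z = inner x z'" for z z'
  proof -
    have "closed {x. inner x z = inner x z'}" by (intro closed_Collect_eq continuous_intros)
    then have "closure S \<subseteq> {x. inner x z = inner x z'}" using z by (intro closure_minimal) auto
    then have "inner x z = inner x z'" for x using dense by auto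
    then show ?thesis using vector_eq_ldot by blast
  qed
  have adj: "adj S f y = z" if z: "\<forall>x\<in>S. inner (f x) y = inner x z" for z
    unfolding adj_def iff
  proof (rule the_equality)
    fix z' assume "\<forall>x\<in>S. inner (f x) y = inner x z'"
    then show "z' = z" using z by (intro uniq) simp
  qed (rule z)
  have "(y, z) \<in> prod.swap ` orth (graph_of S f) \<longleftrightarrow> (z, y) \<in> orth (graph_of S f)" by force
  also have "\<dots> \<longleftrightarrow> (\<forall>x\<in>S. inner (f x) y = inner x (- z))"
    proof -
    have "inner (z, y) (x, f x) = 0 \<longleftrightarrow> inner (f x) y = inner x (- z)" for x
      by (auto simp: inner_commute[of z] inner_commute[of y])
    then show ?thesis by (simp add: orth_def graph_of_def del: inner_Pair) blast
  qed
  also have "\<dots> \<longleftrightarrow> y \<in> adj_dom S f \<and> z = - adj S f y"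
  proof
    assume z: "\<forall>x\<in>S. inner (f x) y = inner x (- z)"
    then show "y \<in> adj_dom S f \<and> z = - adj S f y"
      unfolding adj_dom_def mem_Collect_eq iff adj[OF z] by (intro conjI exI[of _ "- z"] z) simp
  next
    assume y: "y \<in> adj_dom S f \<and> z = - adj S f y"
    then obtain z' where z': "\<forall>x\<in>S. inner (f x) y = inner x z'" unfolding adj_dom_def iff by blast
    then show "\<forall>x\<in>S. inner (f x) y = inner x (- z)" using adj[OF z'] y by simp
  qed
  finally show ?thesis .
qed

section \<open>Orthogonal decompositions of the two graphs\<close>

locale boundary_pair =
  fixes domG :: "'a::chilbert set" and G :: "'a \<Rightarrow> 'b::chilbert"
    and domD :: "'b set" and D :: "'b \<Rightarrow> 'a"
  assumes G_op: "dd_closed_op domG G" and D_op: "dd_closed_op domD D"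
    and G_adj_sub: "adj_dom domG G \<subseteq> domD \<and> (\<forall>y\<in>adj_dom domG G. D y = - adj domG G y)"
begin

abbreviation \<Gamma> where "\<Gamma> \<equiv> graph_of domG G"
abbreviation \<Delta> where "\<Delta> \<equiv> graph_of domD D"
definition \<Gamma>0 where "\<Gamma>0 = prod.swap ` orth \<Delta>"
definition \<Delta>0 where "\<Delta>0 = prod.swap ` orth \<Gamma>"
text \<open>A point of this set is a pair \<open>(u, G u)\<close> with \<open>D (G u) = u\<close>.
  Its first component ranges over BD(G) and its second over BD(D), see \<open>BD_G_iff\<close> and
  \<open>BD_D_iff\<close>; one set describes both boundary spaces.\<close>

definition \<Gamma>1 where "\<Gamma>1 = \<Gamma> \<inter> orth \<Gamma>0"

lemma G: "clinear_on domG G" "closure domG = UNIV" "closed \<Gamma>"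
  and D: "clinear_on domD D" "closure domD = UNIV" "closed \<Delta>"
  using G_op D_op by (auto simp: dd_closed_op_def)

lemma \<Gamma>: "closed \<Gamma>" "subspace \<Gamma>" and \<Delta>: "closed \<Delta>" "subspace \<Delta>"
  using G D subspace_graph_of by auto

lemma \<Gamma>0_iff: "(y, z) \<in> \<Gamma>0 \<longleftrightarrow> y \<in> Gring_dom domD D \<and> z = Gring domD D y"
  unfolding \<Gamma>0_def Gring_dom_def Gring_def by (rule adj_characterization[OF D(1,2)])

lemma \<Delta>0_iff: "(y, z) \<in> \<Delta>0 \<longleftrightarrow> y \<in> Dring_dom domG G \<and> z = Dring domG G y"
  unfolding \<Delta>0_def Dring_dom_def Dring_def by (rule adj_characterization[OF G(1,2)])

lemma \<Delta>0_subset: "\<Delta>0 \<subseteq> \<Delta>"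
proof
  fix p assume "p \<in> \<Delta>0"
  then show "p \<in> \<Delta>"
    using \<Delta>0_iff[of "fst p" "snd p"] G_adj_sub by (cases p) (auto simp: Dring_dom_def Dring_def)
qed

lemma \<Gamma>0_eq: "\<Gamma>0 = orth (prod.swap ` \<Delta>)"
  by (simp add: \<Gamma>0_def orth_swap)

lemma \<Gamma>0: "closed \<Gamma>0" "subspace \<Gamma>0"
  unfolding \<Gamma>0_eq by (rule closed_orth subspace_orth)+

lemma orth_\<Gamma>0: "orth \<Gamma>0 = prod.swap ` \<Delta>"
  unfolding \<Gamma>0_def orth_swap orth_orth[OF \<Delta>] ..

lemma orth_\<Delta>0: "orth \<Delta>0 = prod.swap ` \<Gamma>"
  unfolding \<Delta>0_def orth_swap orth_orth[OF \<Gamma>] ..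

text \<open>As the graph of \<open>D\<close> is closed, it is recovered from that of its adjoint.
  Applied to \<open>(m u, a (G u))\<close>, this turns the interior equation, domain condition
  included, into an orthogonality relation.\<close>

lemma mem_orth_\<Gamma>0_iff: "(z, q) \<in> orth \<Gamma>0 \<longleftrightarrow> q \<in> domD \<and> D q = z"
  unfolding orth_\<Gamma>0 by (auto simp: graph_of_def)

lemma mem_orth_\<Gamma>_iff: "(z, q) \<in> orth \<Gamma> \<longleftrightarrow> (q, z) \<in> \<Delta>0"
  unfolding \<Delta>0_def by force

text \<open>The inclusion \<open>\<Delta>0 \<subseteq> \<Delta>\<close> is reversed by taking
  orthogonal complements, and swapping the factors turns the result into this one.\<close>

lemma \<Gamma>0_subset: "\<Gamma>0 \<subseteq> \<Gamma>"
proof -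
  have "orth \<Delta> \<subseteq> orth \<Delta>0" using \<Delta>0_subset by (auto simp: orth_def)
  then have "\<Gamma>0 \<subseteq> prod.swap ` prod.swap ` \<Gamma>" unfolding \<Gamma>0_def orth_\<Delta>0 by (rule image_mono)
  then show ?thesis by (simp add: image_image)
qed

lemma \<Gamma>1: "closed \<Gamma>1" "subspace \<Gamma>1"
  unfolding \<Gamma>1_def by (auto intro!: closed_Int subspace_inter \<Gamma> closed_orth subspace_orth)

lemma invariant: "ciu_invariant \<Gamma>" "ciu_invariant \<Gamma>0" "ciu_invariant \<Delta>0" "ciu_invariant \<Gamma>1"
proof -
  show \<Gamma>i: "ciu_invariant \<Gamma>" by (rule ciu_invariant_graph_of[OF G(1)])
  show \<Gamma>0i: "ciu_invariant \<Gamma>0" unfolding \<Gamma>0_def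
    by (rule ciu_invariant_swap[OF ciu_invariant_orth[OF ciu_invariant_graph_of[OF D(1)]]])
  show "ciu_invariant \<Delta>0" unfolding \<Delta>0_def
    by (rule ciu_invariant_swap[OF ciu_invariant_orth[OF \<Gamma>i]])
  show "ciu_invariant \<Gamma>1"
    using \<Gamma>i ciu_invariant_orth[OF \<Gamma>0i] by (simp add: \<Gamma>1_def ciu_invariant_def)
qed

abbreviation P0 where "P0 \<equiv> orth_proj \<Gamma>0"
abbreviation P1 where "P1 \<equiv> orth_proj \<Gamma>1"

lemma P1_eq:
  assumes "x \<in> \<Gamma>"
  shows "P1 x = x - P0 x"
proof (rule orth_proj_eqI[OF \<Gamma>1])
  have "P0 x \<in> \<Gamma>0" by (rule orth_proj_in[OF \<Gamma>0])
  have "x - P0 x \<in> \<Gamma>"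
    using \<open>P0 x \<in> \<Gamma>0\<close> \<Gamma>0_subset by (intro subspace_diff[OF \<Gamma>(2)] assms) blast
  moreover have "x - P0 x \<in> orth \<Gamma>0"
    unfolding orth_def using orth_proj_diff[OF \<Gamma>0] by blast
  ultimately show "x - P0 x \<in> \<Gamma>1" by (simp add: \<Gamma>1_def)
  show "inner (x - P0 x) q = inner x q" if "q \<in> \<Gamma>1" for q
  proof -
    have "inner q (P0 x) = 0" using that \<open>P0 x \<in> \<Gamma>0\<close> by (simp add: \<Gamma>1_def orth_def)
    then show ?thesis by (simp add: inner_diff_left inner_commute[of "P0 x"])
  qed
qed

lemma P1_\<Gamma>0: "x \<in> \<Gamma>0 \<Longrightarrow> P1 x = 0"
  using P1_eq[of x] \<Gamma>0_subset orth_proj_id[OF \<Gamma>0] by auto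

text \<open>The complement of \<open>\<Gamma>0\<close> splits orthogonally into \<open>\<Gamma>1\<close> and the complement of \<open>\<Gamma>\<close>.\<close>

lemma inner_P1_orth_\<Gamma>0:
  assumes x: "x \<in> orth \<Gamma>0" and q: "q \<in> \<Gamma>"
  shows "inner (P1 x) q = inner x q"
proof -
  have q': "q = P0 q + P1 q" using P1_eq[OF q] by simp
  have P0q: "P0 q \<in> \<Gamma>0" and P1q: "P1 q \<in> \<Gamma>1" by (rule orth_proj_in[OF \<Gamma>0] orth_proj_in[OF \<Gamma>1])+
  have "inner (P1 x) (P0 q) = 0" "inner x (P0 q) = 0"
    using orth_proj_in[OF \<Gamma>1, of x] x P0q by (auto simp: \<Gamma>1_def orth_def)
  moreover have "inner (P1 x) (P1 q) = inner x (P1 q)" by (rule orth_proj_inner[OF \<Gamma>1 P1q])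
  ultimately show ?thesis by (subst (1 2) q') (simp only: inner_add_right)
qed

lemma Gring_domD: "v \<in> Gring_dom domD D \<Longrightarrow> v \<in> domG \<and> G v = Gring domD D v \<and> ciu v \<in> Gring_dom domD D"
proof -
  assume "v \<in> Gring_dom domD D"
  then have v: "(v, Gring domD D v) \<in> \<Gamma>0" by (simp add: \<Gamma>0_iff)
  then have "ciu2 (v, Gring domD D v) \<in> \<Gamma>0" using invariant(2) unfolding ciu_invariant_def by blast
  then show ?thesis using subsetD[OF \<Gamma>0_subset v] by (simp add: \<Gamma>0_iff)
qed

lemma Dring_domD: "v \<in> Dring_dom domG G \<Longrightarrow> v \<in> domD \<and> D v = Dring domG G v \<and> ciu v \<in> Dring_dom domG G"
proof -
  assume "v \<in> Dring_dom domG G"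
  then have v: "(v, Dring domG G v) \<in> \<Delta>0" by (simp add: \<Delta>0_iff)
  then have "ciu2 (v, Dring domG G v) \<in> \<Delta>0" using invariant(3) unfolding ciu_invariant_def by blast
  then show ?thesis using subsetD[OF \<Delta>0_subset v] by (simp add: \<Delta>0_iff)
qed

lemma BD_G_iff: "u \<in> BD_G domG G domD D \<longleftrightarrow> u \<in> domG \<and> (u, G u) \<in> \<Gamma>1"
proof -
  have "(\<forall>v\<in>Gring_dom domD D. inner (u, G u) (v, G v) = 0) \<longleftrightarrow> (u, G u) \<in> orth \<Gamma>0"
    using Gring_domD \<Gamma>0_iff by (auto simp: orth_def simp del: inner_Pair)
  then show ?thesis
    using ginner_eq_0_iff[OF G(1), of "Gring_dom domD D" u] Gring_domD
    by (simp add: BD_G_def BD_space_def \<Gamma>1_def)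
qed

lemma \<Gamma>1D: "p \<in> \<Gamma>1 \<Longrightarrow> fst p \<in> BD_G domG G domD D \<and> p = (fst p, G (fst p))"
  using BD_G_iff by (cases p) (auto simp: \<Gamma>1_def)

lemma BD_D_iff: "q \<in> BD_D domG G domD D \<longleftrightarrow> q \<in> domD \<and> (D q, q) \<in> \<Gamma>1"
proof -
  have "(\<forall>v\<in>Dring_dom domG G. inner (q, D q) (v, D v) = 0) \<longleftrightarrow> (q, D q) \<in> orth \<Delta>0"
    using Dring_domD \<Delta>0_iff by (auto simp: orth_def simp del: inner_Pair)
  also have "\<dots> \<longleftrightarrow> (D q, q) \<in> \<Gamma>" unfolding orth_\<Delta>0 by force
  finally show ?thesis
    using ginner_eq_0_iff[OF D(1), of "Dring_dom domG G" q] Dring_domD mem_orth_\<Gamma>0_iff[of "D q" q]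
    by (auto simp: BD_D_def BD_space_def \<Gamma>1_def)
qed

lemma pi_BDG_eq:
  assumes u: "u \<in> domG"
  shows "pi_BDG domG G domD D u = fst (P1 (u, G u))"
  unfolding pi_BDG_def BD_proj_def
proof (rule the_equality)
  have x: "(u, G u) \<in> \<Gamma>" using u by simp
  define w where "w = fst (P1 (u, G u))"
  have w: "w \<in> BD_G domG G domD D" "P1 (u, G u) = (w, G w)"
    using \<Gamma>1D[OF orth_proj_in[OF \<Gamma>1]] by (auto simp: w_def)
  have "(u, G u) - (w, G w) \<in> \<Gamma>0" using P1_eq[OF x] orth_proj_in[OF \<Gamma>0, of "(u, G u)"] w(2) by (metis diff_diff_eq2 add_diff_cancel_left')
  then show "fst (P1 (u, G u)) \<in> BD_G domG G domD D \<and> u - fst (P1 (u, G u)) \<in> Gring_dom domD D"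
    using w(1) by (simp add: w_def[symmetric] \<Gamma>0_iff)
next
  fix w assume w: "w \<in> BD_G domG G domD D \<and> u - w \<in> Gring_dom domD D"
  have "P1 (u, G u) = (w, G w)"
  proof (rule orth_proj_eqI[OF \<Gamma>1])
    show "(w, G w) \<in> \<Gamma>1" using w BD_G_iff by blast
    have "(u - w, G (u - w)) \<in> \<Gamma>0" using w Gring_domD \<Gamma>0_iff by metis
    moreover have "(u, G u) - (w, G w) \<in> \<Gamma>" using u w BD_G_iff by (intro subspace_diff[OF \<Gamma>(2)]) auto
    ultimately have d: "(u, G u) - (w, G w) \<in> \<Gamma>0" by simp
    show "inner (w, G w) q = inner (u, G u) q" if "q \<in> \<Gamma>1" for q
    proof -
      have "inner q ((u, G u) - (w, G w)) = 0" using that d by (simp add: \<Gamma>1_def orth_def del: inner_Pair diff_Pair)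
      then show ?thesis by (simp only: inner_diff_right inner_commute)
    qed
  qed
  then show "w = fst (P1 (u, G u))" by simp
qed

text \<open>The same projection \<open>P1\<close> yields the Neumann data. The remainder of
  \<open>(D q, q)\<close> is orthogonal to \<open>\<Gamma>\<close>, which after swapping means
  membership in \<open>\<Delta>0\<close>.\<close>

lemma pi_BDD_eq:
  assumes q: "q \<in> domD"
  shows "pi_BDD domG G domD D q = snd (P1 (D q, q))"
  unfolding pi_BDD_def BD_proj_def
proof (rule the_equality)
  have x: "(D q, q) \<in> orth \<Gamma>0" using q mem_orth_\<Gamma>0_iff by blast
  define z w where "z = fst (P1 (D q, q))" and "w = snd (P1 (D q, q))"
  have zw: "P1 (D q, q) = (z, w)" by (simp add: z_def w_def)
  have in1: "(z, w) \<in> \<Gamma>1" using orth_proj_in[OF \<Gamma>1, of "(D q, q)"] by (simp add: zw)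
  then have w: "w \<in> domD" "D w = z" using mem_orth_\<Gamma>0_iff[of z w] by (auto simp: \<Gamma>1_def)
  have "(D q, q) - (z, w) \<in> orth \<Gamma>"
    using inner_P1_orth_\<Gamma>0[OF x] by (simp add: zw orth_def inner_diff_left del: inner_Pair diff_Pair)
  then have "(q - w, D q - z) \<in> \<Delta>0" using mem_orth_\<Gamma>_iff by simp
  then show "snd (P1 (D q, q)) \<in> BD_D domG G domD D \<and> q - snd (P1 (D q, q)) \<in> Dring_dom domG G"
    using in1 w by (simp add: w_def[symmetric] BD_D_iff \<Delta>0_iff)
next
  fix w assume w: "w \<in> BD_D domG G domD D \<and> q - w \<in> Dring_dom domG G"
  have "P1 (D q, q) = (D w, w)"
  proof (rule orth_proj_eqI[OF \<Gamma>1])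
    show "(D w, w) \<in> \<Gamma>1" using w BD_D_iff by blast
    have "(q - w, D (q - w)) \<in> \<Delta>0" using w Dring_domD \<Delta>0_iff by metis
    moreover have "(q, D q) - (w, D w) \<in> \<Delta>" using q w BD_D_iff by (intro subspace_diff[OF \<Delta>(2)]) auto
    ultimately have d: "(D q, q) - (D w, w) \<in> orth \<Gamma>" using mem_orth_\<Gamma>_iff by simp
    show "inner (D w, w) p = inner (D q, q) p" if "p \<in> \<Gamma>1" for p
    proof -
      have "inner ((D q, q) - (D w, w)) p = 0" using that d by (simp add: \<Gamma>1_def orth_def del: inner_Pair diff_Pair)
      then show ?thesis by (simp only: inner_diff_left)
    qed
  qed
  then show "w = snd (P1 (D q, q))" by simp
qed

text \<open>The first component is \<open>D\<close> of the second. The Dirichlet-to-Neumann relation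
  prescribes second components only, so this is what recovers the full pair.\<close>

lemma \<Gamma>1_snd_inj:
  assumes "p \<in> \<Gamma>1" "q \<in> \<Gamma>1" "snd p = snd q"
  shows "p = q"
proof -
  have "fst p = D (snd p)" if "p \<in> \<Gamma>1" for p
    using that mem_orth_\<Gamma>0_iff[of "fst p" "snd p"] by (simp add: \<Gamma>1_def)
  then show ?thesis using assms by (simp add: prod_eq_iff)
qed

end

section \<open>The Dirichlet-to-Neumann relation\<close>

context dtn_form begin

text \<open>The operator associated with a form through \<open>J\<close>. Different \<open>p\<close>
  may have the same boundary value, so this is a relation until ellipticity is brought in.\<close>

definition dtn_rel :: "('x \<Rightarrow> 'x) \<Rightarrow> ('h \<times> 'h) set" where
  "dtn_rel B = {(J p, \<psi>) | p \<psi>. p \<in> S \<and> (\<forall>q\<in>S. inner (B p) q = inner \<psi> (J q))}"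

lemma dtn_rel_iff_solves:
  "(\<phi>, f - lam *\<^sub>R \<phi>) \<in> dtn_rel B \<longleftrightarrow> (\<exists>p. \<phi> = J p \<and> solves B lam f p)"
  by (auto simp: dtn_rel_def solves_def inner_diff_left eq_diff_eq)

context
  fixes B :: "'x \<Rightarrow> 'x" and \<omega> :: real
  assumes B: "garding B" and ell: "elliptic B \<omega>" and \<omega>: "0 \<le> \<omega>"
begin

lemma dtn_rel_single_valued:
  assumes "(\<phi>, \<psi>1) \<in> dtn_rel B" "(\<phi>, \<psi>2) \<in> dtn_rel B"
  shows "\<psi>1 = \<psi>2"
proof -
  interpret J: bounded_linear J by (rule J(1))
  have "\<exists>p. \<phi> = J p \<and> solves B \<omega> (\<psi>1 + \<omega> *\<^sub>R \<phi>) p"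
    using assms(1) dtn_rel_iff_solves[of \<phi> "\<psi>1 + \<omega> *\<^sub>R \<phi>" \<omega> B] by simp
  then obtain p where p: "\<phi> = J p" "solves B \<omega> (\<psi>1 + \<omega> *\<^sub>R \<phi>) p" by blast
  have "\<exists>p. \<phi> = J p \<and> solves B \<omega> (\<psi>2 + \<omega> *\<^sub>R \<phi>) p"
    using assms(2) dtn_rel_iff_solves[of \<phi> "\<psi>2 + \<omega> *\<^sub>R \<phi>" \<omega> B] by simp
  then obtain q where q: "\<phi> = J q" "solves B \<omega> (\<psi>2 + \<omega> *\<^sub>R \<phi>) q" by blast
  note d = solves_diff[OF B ell order_refl \<omega> p(2) q(2)]
  have "J (p - q) = 0" using p(1) q(1) by (simp add: J.diff)
  then have "\<mu> / 2 * (norm (p - q))\<^sup>2 \<le> 0" using solves_lower_bound[OF B ell order_refl \<omega> d] by simp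
  then have "p - q = 0" using \<mu> by (simp add: mult_le_0_iff)
  then have "inner (\<psi>1 - \<psi>2) (J v) = 0" if "v \<in> S" for v
    using d that B by (simp add: solves_def garding_def linear_simps(3) J.zero)
  then have "J ` S \<subseteq> {y. inner (\<psi>1 - \<psi>2) y = 0}" by blast
  moreover have "closed {y. inner (\<psi>1 - \<psi>2) y = 0}" by (intro closed_Collect_eq continuous_intros)
  ultimately have "closure (J ` S) \<subseteq> {y. inner (\<psi>1 - \<psi>2) y = 0}" by (rule closure_minimal)
  then have "inner (\<psi>1 - \<psi>2) (\<psi>1 - \<psi>2) = 0" using J(3) by blast
  then show ?thesis by simp
qed

lemma op_fun_dtn_rel: "(\<phi>, \<psi>) \<in> dtn_rel B \<Longrightarrow> op_fun (dtn_rel B) \<phi> = \<psi>"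
  unfolding op_fun_def using dtn_rel_single_valued by (intro the_equality) auto

lemma dtn_resolvent_equation:
  assumes lam: "\<omega> \<le> lam"
  shows "\<phi> \<in> op_dom (dtn_rel B) \<and> lam *\<^sub>R \<phi> + op_fun (dtn_rel B) \<phi> = f \<longleftrightarrow> \<phi> = J (sol B lam f)"
proof
  assume "\<phi> \<in> op_dom (dtn_rel B) \<and> lam *\<^sub>R \<phi> + op_fun (dtn_rel B) \<phi> = f"
  then obtain \<psi> where \<psi>: "(\<phi>, \<psi>) \<in> dtn_rel B" "lam *\<^sub>R \<phi> + \<psi> = f"
    using op_fun_dtn_rel by (auto simp: op_dom_def)
  then have "(\<phi>, f - lam *\<^sub>R \<phi>) \<in> dtn_rel B" by auto
  then obtain p where "\<phi> = J p" "solves B lam f p" using dtn_rel_iff_solves by blast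
  then show "\<phi> = J (sol B lam f)" using sol_eqI[OF B ell lam] \<omega> lam by simp
next
  assume \<phi>: "\<phi> = J (sol B lam f)"
  have "solves B lam f (sol B lam f)" using solves_sol[OF B ell lam] \<omega> lam by simp
  then have "(\<phi>, f - lam *\<^sub>R \<phi>) \<in> dtn_rel B" using \<phi> dtn_rel_iff_solves by blast
  then show "\<phi> \<in> op_dom (dtn_rel B) \<and> lam *\<^sub>R \<phi> + op_fun (dtn_rel B) \<phi> = f"
    using op_fun_dtn_rel by (auto simp: op_dom_def)
qed

lemma resolvent_dtn_rel:
  assumes lam: "\<omega> \<le> lam"
  shows "resolvent (op_dom (dtn_rel B)) (op_fun (dtn_rel B)) lam = (\<lambda>f. J (sol B lam f))"
  unfolding resolvent_def dtn_resolvent_equation[OF lam] by simp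

lemma bij_betw_dtn_rel:
  assumes lam: "\<omega> \<le> lam"
  shows "bij_betw (\<lambda>\<phi>. lam *\<^sub>R \<phi> + op_fun (dtn_rel B) \<phi>) (op_dom (dtn_rel B)) UNIV"
  unfolding bij_betw_def
proof
  show "inj_on (\<lambda>\<phi>. lam *\<^sub>R \<phi> + op_fun (dtn_rel B) \<phi>) (op_dom (dtn_rel B))"
  proof (rule inj_onI)
    fix \<phi> \<phi>' assume "\<phi> \<in> op_dom (dtn_rel B)" "\<phi>' \<in> op_dom (dtn_rel B)"
      "lam *\<^sub>R \<phi> + op_fun (dtn_rel B) \<phi> = lam *\<^sub>R \<phi>' + op_fun (dtn_rel B) \<phi>'"
    then show "\<phi> = \<phi>'"
      using dtn_resolvent_equation[OF lam, of \<phi> "lam *\<^sub>R \<phi>' + op_fun (dtn_rel B) \<phi>'"]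
        dtn_resolvent_equation[OF lam, of \<phi>' "lam *\<^sub>R \<phi>' + op_fun (dtn_rel B) \<phi>'"] by simp
  qed
  have "f \<in> (\<lambda>\<phi>. lam *\<^sub>R \<phi> + op_fun (dtn_rel B) \<phi>) ` op_dom (dtn_rel B)" for f
    using dtn_resolvent_equation[OF lam, of "J (sol B lam f)" f] by (auto intro: rev_image_eqI)
  then show "(\<lambda>\<phi>. lam *\<^sub>R \<phi> + op_fun (dtn_rel B) \<phi>) ` op_dom (dtn_rel B) = UNIV" by blast
qed

end
end

lemma weak_conv_iff_wconv: "weak_conv x l \<longleftrightarrow> wconv x l"
proof
  assume w: "weak_conv x l"
  show "wconv x l"
    unfolding wconv_def
  proof
    fix y
    have "(\<lambda>k. Re (cinner (x k) y)) \<longlonglongrightarrow> Re (cinner l y)"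
      using w by (intro tendsto_Re) (simp add: weak_conv_def)
    then show "(\<lambda>k. inner (x k) y) \<longlonglongrightarrow> inner l y" by (simp add: Re_cinner)
  qed
next
  assume w: "wconv x l"
  have c: "cinner z y = Complex (inner z y) (inner z (ciu y))" for z y :: 'a
    by (intro complex_eqI) (simp_all add: Re_cinner Im_cinner inner_ciu_right)
  show "weak_conv x l"
    unfolding weak_conv_def c by (intro allI tendsto_Complex wconvD[OF w])
qed

text \<open>Splitting \<open>T n (x n)\<close> at \<open>l\<close> separates a term that tends to
  zero in norm by uniform boundedness from one with fixed argument.\<close>

lemma wconv_apply_strong:
  assumes lin: "\<And>n. linear (T n)" and bdd: "\<And>n x. norm (T n x) \<le> C * norm x"
    and conv: "wconv (\<lambda>n. T n l) m" and x: "x \<longlonglongrightarrow> l"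
  shows "wconv (\<lambda>n. T n (x n)) m"
  unfolding wconv_def
proof
  fix y
  have "(\<lambda>n. C * norm (x n - l)) \<longlonglongrightarrow> C * norm (l - l)" by (intro tendsto_intros x)
  then have z: "(\<lambda>n. C * norm (x n - l)) \<longlonglongrightarrow> 0" by simp
  have "(\<lambda>n. T n (x n - l)) \<longlonglongrightarrow> 0"
    by (rule Lim_null_comparison[OF _ z]) (simp add: bdd)
  then have "(\<lambda>n. inner (T n (x n - l)) y + inner (T n l) y) \<longlonglongrightarrow> inner 0 y + inner m y"
    by (intro tendsto_add tendsto_inner tendsto_const wconvD[OF conv])
  then show "(\<lambda>n. inner (T n (x n)) y) \<longlonglongrightarrow> inner m y"
    by (simp add: linear_diff[OF lin] inner_diff_left)
qed

lemma compact_closure_range_subseq: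
  fixes y :: "nat \<Rightarrow> 'm::metric_space"
  assumes "compact (closure (range y))"
  shows "\<exists>r::nat \<Rightarrow> nat. strict_mono r \<and> convergent (\<lambda>k. y (r k))"
proof -
  have "seq_compact (closure (range y))" using assms by (simp add: compact_eq_seq_compact_metric)
  moreover have "\<forall>k. y k \<in> closure (range y)" by (intro allI subsetD[OF closure_subset] rangeI)
  ultimately have "\<exists>l\<in>closure (range y). \<exists>r::nat \<Rightarrow> nat. strict_mono r \<and> (y \<circ> r) \<longlonglongrightarrow> l"
    unfolding seq_compact_def by simp
  then show ?thesis unfolding comp_def convergent_def by blast
qed

lemma gnorm_eq: "gnorm f x = norm (x, f x)"
  by (simp add: gnorm_def norm_prod_def)

section \<open>The trace map on the graph and the variational form of the Dirichlet-to-Neumann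
  relation\<close>

locale boundary_trace = boundary_pair domG G domD D
  for domG :: "'a::chilbert set" and G :: "'a \<Rightarrow> 'b::chilbert"
    and domD :: "'b set" and D :: "'b \<Rightarrow> 'a" +
  fixes \<kappa> :: "'a \<Rightarrow> 'h::chilbert"
  assumes cpt_emb: "compact_embedding domG G"
    and kappa_L: "bounded_on_graph (BD_G domG G domD D) G \<kappa>"
    and kappa_inj: "inj_on \<kappa> (BD_G domG G domD D)"
    and kappa_dense: "closure (\<kappa> ` BD_G domG G domD D) = UNIV"
begin

text \<open>Control over \<kappa> is available on BD(G) only; precomposition with \<open>P1\<close>
  gives a bounded linear map on the entire product that agrees with \<kappa> on the graph over
  BD(G).\<close>

definition J :: "'a \<times> 'b \<Rightarrow> 'h" where "J x = \<kappa> (fst (P1 x))"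

lemma P1_in: "P1 x \<in> \<Gamma>1" "fst (P1 x) \<in> BD_G domG G domD D" "P1 x = (fst (P1 x), G (fst (P1 x)))"
  using orth_proj_in[OF \<Gamma>1, of x] \<Gamma>1D[of "P1 x"] by auto

lemma gnorm_P1: "gnorm G (fst (P1 x)) \<le> norm x"
  using norm_orth_proj_le[OF \<Gamma>1, of x] P1_in(3)[of x] by (simp add: gnorm_eq)

lemma clinear_\<kappa>: "clinear_on (BD_G domG G domD D) \<kappa>"
  using kappa_L by (simp add: bounded_on_graph_def)

lemma J_BD: "u \<in> BD_G domG G domD D \<Longrightarrow> J (u, G u) = \<kappa> u"
  using BD_G_iff orth_proj_id[OF \<Gamma>1] by (simp add: J_def)

lemma bounded_linear_J: "bounded_linear J"
proof -
  interpret P: bounded_linear P1 by (rule bounded_linear_orth_proj[OF \<Gamma>1])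
  obtain C where C: "\<And>u. u \<in> BD_G domG G domD D \<Longrightarrow> norm (\<kappa> u) \<le> C * gnorm G u"
    using kappa_L by (auto simp: bounded_on_graph_def)
  show ?thesis
  proof (rule bounded_linear_intro)
    show "J (x + y) = J x + J y" for x y
      by (simp add: J_def P.add clinear_onD(2)[OF clinear_\<kappa>] P1_in(2))
    show "J (r *\<^sub>R x) = r *\<^sub>R J x" for r x
      by (simp add: J_def P.scaleR clinear_onD(3)[OF clinear_\<kappa>] P1_in(2))
    show "norm (J x) \<le> norm x * \<bar>C\<bar>" for x
    proof -
      have "norm (J x) \<le> C * gnorm G (fst (P1 x))" unfolding J_def by (rule C[OF P1_in(2)])
      also have "\<dots> \<le> \<bar>C\<bar> * norm x" using gnorm_P1[of x] by (intro mult_mono) (auto simp: gnorm_eq)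
      finally show ?thesis by (simp add: mult.commute)
    qed
  qed
qed

lemma J_ciu2: "J (ciu2 x) = ciu (J x)"
  by (simp add: J_def orth_proj_ciu2[OF \<Gamma>1 invariant(4)] clinear_onD(5)[OF clinear_\<kappa>] P1_in(2))

text \<open>Injectivity of \<kappa> reduces the kernel of \<open>J\<close> to that of
  \<open>P1\<close>, which within \<open>\<Gamma>\<close> is \<open>\<Gamma>0\<close>.\<close>

lemma J_eq_0_iff:
  assumes "x \<in> \<Gamma>"
  shows "J x = 0 \<longleftrightarrow> x \<in> \<Gamma>0"
proof
  assume "J x = 0"
  then have "\<kappa> (fst (P1 x)) = \<kappa> 0" using clinear_onD(6)[OF clinear_\<kappa>] by (simp add: J_def)
  then have "fst (P1 x) = 0"
    using inj_onD[OF kappa_inj] P1_in(2) subspace_0[OF clinear_onD(1)[OF clinear_\<kappa>]] by blast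
  then have "P1 x = 0" using P1_in(3)[of x] clinear_onD(6)[OF G(1)] by (simp add: zero_prod_def)
  then show "x \<in> \<Gamma>0" using P1_eq[OF assms] orth_proj_in[OF \<Gamma>0, of x] by simp
next
  assume "x \<in> \<Gamma>0"
  then show "J x = 0" using P1_\<Gamma>0 clinear_onD(6)[OF clinear_\<kappa>] by (simp add: J_def)
qed

lemma compact_map_on_fst: "compact_map_on \<Gamma> fst"
  unfolding compact_map_on_def
proof (intro allI impI)
  fix x :: "nat \<Rightarrow> 'a \<times> 'b" and C assume x: "\<forall>k. x k \<in> \<Gamma> \<and> norm (x k) \<le> C"
  have "gnorm G (fst (x k)) \<le> C" "fst (x k) \<in> domG" for k
    using x[THEN spec, of k] by (auto simp: gnorm_eq graph_of_def)
  then have "range (\<lambda>k. fst (x k)) \<subseteq> domG" "\<exists>C. \<forall>u\<in>range (\<lambda>k. fst (x k)). gnorm G u \<le> C" by auto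
  then have "compact (closure (range (\<lambda>k. fst (x k))))" using cpt_emb unfolding compact_embedding_def by blast
  then show "\<exists>r. strict_mono r \<and> convergent (\<lambda>k. fst (x (r k)))" by (rule compact_closure_range_subseq)
qed

lemma compact_map_on_J:
  assumes "compact_on_graph (BD_G domG G domD D) G \<kappa>"
  shows "compact_map_on \<Gamma> J"
  unfolding compact_map_on_def
proof (intro allI impI)
  fix x :: "nat \<Rightarrow> 'a \<times> 'b" and C assume x: "\<forall>k. x k \<in> \<Gamma> \<and> norm (x k) \<le> C"
  define X where "X = range (\<lambda>k. fst (P1 (x k)))"
  have "gnorm G (fst (P1 (x k))) \<le> C" for k using gnorm_P1[of "x k"] x order_trans by blast
  moreover have "X \<subseteq> BD_G domG G domD D" unfolding X_def using P1_in(2) by blast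
  ultimately have "compact (closure (\<kappa> ` X))"
    using assms unfolding compact_on_graph_def X_def by blast
  moreover have "\<kappa> ` X = range (\<lambda>k. J (x k))" by (auto simp: X_def J_def)
  ultimately show "\<exists>r. strict_mono r \<and> convergent (\<lambda>k. J (x (r k)))"
    by (intro compact_closure_range_subseq) simp
qed

lemma dtn_form:
  assumes "\<mu> > 0"
  shows "dtn_form \<Gamma> \<Gamma>0 fst J \<mu>"
proof (rule dtn_form.intro)
  show "x = 0" if "x \<in> \<Gamma>" "fst x = 0" for x
    using that clinear_onD(6)[OF G(1)] by (cases x) (simp add: zero_prod_def)
  have "\<kappa> ` BD_G domG G domD D \<subseteq> J ` \<Gamma>"
  proof
    fix \<phi> assume "\<phi> \<in> \<kappa> ` BD_G domG G domD D"
    then obtain u where u: "u \<in> BD_G domG G domD D" "\<phi> = \<kappa> u" by blast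
    then show "\<phi> \<in> J ` \<Gamma>" using J_BD[OF u(1)] BD_G_iff[of u] by (intro image_eqI[of _ _ "(u, G u)"]) auto
  qed
  then show "closure (J ` \<Gamma>) = UNIV" using kappa_dense closure_mono by blast
qed (rule assms \<Gamma> \<Gamma>0 \<Gamma>0_subset compact_map_on_fst bounded_linear_J bounded_linear_fst | erule J_eq_0_iff)+

text \<open>Since \<open>J\<close> factors through \<open>P1\<close>, its adjoint takes values in
  \<open>\<Gamma>1\<close>, and the map from \<open>u\<close> to \<open>(u, G u)\<close> identifies
  BD(G) with \<open>\<Gamma>1\<close> isometrically. The first component of \<open>J' \<psi>\<close>
  is therefore the adjoint of \<kappa> at \<psi>.\<close>

lemma kappa_adj_eq:
  assumes J': "\<And>x y. inner (J x) y = inner x (J' y)"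
  shows "J' \<psi> \<in> \<Gamma>1" "kappa_adj domG G domD D \<kappa> \<psi> = fst (J' \<psi>)"
proof -
  have "P1 (J' \<psi>) = J' \<psi>"
  proof -
    have "inner x (P1 (J' \<psi>)) = inner x (J' \<psi>)" for x
    proof -
      have "inner x (P1 (J' \<psi>)) = inner (P1 x) (P1 (J' \<psi>))"
        using orth_proj_inner[OF \<Gamma>1 P1_in(1), of x "J' \<psi>"] by simp
      also have "\<dots> = inner (P1 x) (J' \<psi>)"
        using orth_proj_inner[OF \<Gamma>1 P1_in(1), of "J' \<psi>" x] by (simp only: inner_commute)
      also have "\<dots> = inner x (J' \<psi>)"
        by (simp add: J'[symmetric] J_def orth_proj_id[OF \<Gamma>1 P1_in(1)])
      finally show ?thesis .
    qed
    then show ?thesis using vector_eq_ldot by blast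
  qed
  then show J'1: "J' \<psi> \<in> \<Gamma>1" using P1_in(1) by metis
  let ?BD = "BD_G domG G domD D"
  have eqv: "(\<forall>u\<in>?BD. cinner (\<kappa> u) \<psi> = ginner G u w) \<longleftrightarrow> (\<forall>u\<in>?BD. inner (\<kappa> u) \<psi> = inner (u, G u) (w, G w))" for w
  proof (intro iffI ballI)
    fix u assume "\<forall>u\<in>?BD. cinner (\<kappa> u) \<psi> = ginner G u w" "u \<in> ?BD"
    then have "Re (cinner (\<kappa> u) \<psi>) = Re (ginner G u w)" by simp
    then show "inner (\<kappa> u) \<psi> = inner (u, G u) (w, G w)" by (simp add: ginner_def Re_cinner)
  next
    fix u assume eq: "\<forall>u\<in>?BD. inner (\<kappa> u) \<psi> = inner (u, G u) (w, G w)" and u: "u \<in> ?BD"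
    have "ciu u \<in> ?BD" by (rule clinear_onD(4)[OF clinear_\<kappa> u])
    then have "inner (\<kappa> (ciu u)) \<psi> = inner (ciu u, G (ciu u)) (w, G w)" using eq by blast
    then show "cinner (\<kappa> u) \<psi> = ginner G u w"
      using eq u clinear_onD(5)[OF clinear_\<kappa> u] clinear_onD(5)[OF G(1), of u] BD_G_iff[of u]
      by (intro complex_eqI) (simp_all add: ginner_def Re_cinner Im_cinner)
  qed
  define w where "w = fst (J' \<psi>)"
  have w: "w \<in> ?BD" "J' \<psi> = (w, G w)" using \<Gamma>1D[OF J'1] by (auto simp: w_def)
  have w_eq: "\<forall>u\<in>?BD. inner (\<kappa> u) \<psi> = inner (u, G u) (w, G w)"
    using J_BD J'[of _ \<psi>] w(2) by metis
  show "kappa_adj domG G domD D \<kappa> \<psi> = fst (J' \<psi>)"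
    unfolding kappa_adj_def eqv w_def[symmetric]
  proof (rule the_equality)
    fix v assume v: "v \<in> ?BD \<and> (\<forall>u\<in>?BD. inner (\<kappa> u) \<psi> = inner (u, G u) (v, G v))"
    have "(v, G v) - (w, G w) \<in> \<Gamma>1" using v w BD_G_iff by (intro subspace_diff[OF \<Gamma>1(2)]) auto
    then obtain z where z: "z \<in> ?BD" "(v, G v) - (w, G w) = (z, G z)" using \<Gamma>1D by metis
    have "inner (z, G z) (v, G v) = inner (z, G z) (w, G w)" using v w_eq z(1) by metis
    then have "inner (z, G z) ((v, G v) - (w, G w)) = 0" by (simp only: inner_diff_right diff_self)
    then have "(z, G z) = 0" unfolding z(2) by (simp only: inner_eq_zero_iff)
    then show "v = w" using z(2) by (simp add: zero_prod_def)
  qed (use w w_eq in blast)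
qed

text \<open>A form of Green's formula. The interior equation puts \<open>map_prod m a p\<close> into
  \<open>orth \<Gamma>0\<close>, where \<open>P1\<close> has the Neumann data as second component.
  Prescribing these data as \<open>G\<close> of the adjoint of \<kappa> at \<psi> amounts to
  \<open>P1 (map_prod m a p) = J' \<psi>\<close>, which is the variational identity.\<close>

lemma mem_DtN_H_iff:
  "(\<phi>, \<psi>) \<in> DtN_H domG G domD D \<kappa> a m \<longleftrightarrow>
    (\<exists>p\<in>\<Gamma>. \<phi> = J p \<and> (\<forall>q\<in>\<Gamma>. inner (map_prod m a p) q = inner \<psi> (J q)))"
proof -
  obtain J' where J': "\<And>x y. inner (J x) y = inner x (J' y)"
    using bounded_linear_adjoint[OF bounded_linear_J] by metis
  have J'_snd: "G (kappa_adj domG G domD D \<kappa> \<psi>) = snd (J' \<psi>)"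
    unfolding kappa_adj_eq(2)[OF J'] using \<Gamma>1D[OF kappa_adj_eq(1)[OF J', of \<psi>]] by (metis snd_conv)
  show ?thesis
  proof
    assume "(\<phi>, \<psi>) \<in> DtN_H domG G domD D \<kappa> a m"
    then obtain u where u: "u \<in> domG" "a (G u) \<in> domD" "m u - D (a (G u)) = 0"
      and \<phi>: "\<phi> = \<kappa> (pi_BDG domG G domD D u)"
      and \<psi>: "snd (J' \<psi>) = pi_BDD domG G domD D (a (G u))"
      unfolding DtN_H_def DtN_def by (auto simp: J'_snd)
    let ?p = "(u, G u)"
    have Bp: "map_prod m a ?p = (D (a (G u)), a (G u))" using u(3) by simp
    then have orth: "map_prod m a ?p \<in> orth \<Gamma>0" using u(2) mem_orth_\<Gamma>0_iff by simp
    have "snd (J' \<psi>) = snd (P1 (map_prod m a ?p))" using \<psi> pi_BDD_eq[OF u(2)] Bp by simp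
    then have eq: "J' \<psi> = P1 (map_prod m a ?p)"
      using \<Gamma>1_snd_inj[OF kappa_adj_eq(1)[OF J'] P1_in(1)] by blast
    have "inner (map_prod m a ?p) q = inner \<psi> (J q)" if "q \<in> \<Gamma>" for q
    proof -
      have "inner (map_prod m a ?p) q = inner (J' \<psi>) q" unfolding eq by (rule inner_P1_orth_\<Gamma>0[OF orth that, symmetric])
      then show ?thesis using J'[of q \<psi>] by (simp only: inner_commute)
    qed
    moreover have "\<phi> = J ?p" using \<phi> pi_BDG_eq[OF u(1)] by (simp add: J_def)
    ultimately show "\<exists>p\<in>\<Gamma>. \<phi> = J p \<and> (\<forall>q\<in>\<Gamma>. inner (map_prod m a p) q = inner \<psi> (J q))"
      using u(1) by (intro bexI[of _ ?p]) auto
  next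
    assume "\<exists>p\<in>\<Gamma>. \<phi> = J p \<and> (\<forall>q\<in>\<Gamma>. inner (map_prod m a p) q = inner \<psi> (J q))"
    then obtain p where p: "p \<in> \<Gamma>" "\<phi> = J p" "\<And>q. q \<in> \<Gamma> \<Longrightarrow> inner (map_prod m a p) q = inner \<psi> (J q)" by blast
    define u where "u = fst p"
    have u: "u \<in> domG" "p = (u, G u)" using p(1) by (auto simp: u_def graph_of_def)
    \<comment> \<open>Test elements with vanishing trace recover the interior equation; those in
      \<open>\<Gamma>1\<close> then give the Neumann data.\<close>
    have "inner (map_prod m a p) q = 0" if "q \<in> \<Gamma>0" for q
      using p(3)[of q] J_eq_0_iff[of q] that \<Gamma>0_subset by auto
    then have "map_prod m a p \<in> orth \<Gamma>0" by (simp add: orth_def)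
    then have aGu: "a (G u) \<in> domD" "D (a (G u)) = m u" using u(2) mem_orth_\<Gamma>0_iff by auto
    have "P1 (map_prod m a p) = J' \<psi>"
    proof (rule orth_proj_eqI[OF \<Gamma>1 kappa_adj_eq(1)[OF J']])
      fix q assume "q \<in> \<Gamma>1"
      then show "inner (J' \<psi>) q = inner (map_prod m a p) q"
        using p(3)[of q] J'[of q \<psi>] by (simp add: \<Gamma>1_def inner_commute)
    qed
    then have "pi_BDD domG G domD D (a (G u)) = snd (J' \<psi>)" using pi_BDD_eq[OF aGu(1)] aGu(2) u(2) by simp
    moreover have "pi_BDG domG G domD D u = fst (P1 p)" using pi_BDG_eq[OF u(1)] u(2) by simp
    ultimately have "(fst (P1 p), G (kappa_adj domG G domD D \<kappa> \<psi>)) \<in> DtN domG G domD D a m"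
      unfolding DtN_def J'_snd using u(1) aGu by (auto intro!: exI[of _ u])
    then show "(\<phi>, \<psi>) \<in> DtN_H domG G domD D \<kappa> a m"
      using P1_in(2)[of p] p(2) by (auto simp: DtN_H_def J_def)
  qed
qed

end

section \<open>Convergence of the Dirichlet-to-Neumann operators\<close>

context boundary_trace begin

lemma weak_conv_graph_iff:
  "weak_conv_graph domG G u l \<longleftrightarrow> (\<forall>k. u k \<in> domG) \<and> l \<in> domG \<and>
     (\<forall>q\<in>\<Gamma>. (\<lambda>k. inner (u k, G (u k)) q) \<longlonglongrightarrow> inner (l, G l) q)"
proof -
  have c: "ginner G z v = Complex (inner (z, G z) (v, G v)) (inner (z, G z) (ciu2 (v, G v)))" for z v
    by (intro complex_eqI) (simp_all add: ginner_def Re_cinner Im_cinner inner_ciu_right)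
  have "(\<forall>v\<in>domG. (\<lambda>k. ginner G (u k) v) \<longlonglongrightarrow> ginner G l v) \<longleftrightarrow>
      (\<forall>q\<in>\<Gamma>. (\<lambda>k. inner (u k, G (u k)) q) \<longlonglongrightarrow> inner (l, G l) q)"
  proof (intro iffI ballI)
    fix q assume w: "\<forall>v\<in>domG. (\<lambda>k. ginner G (u k) v) \<longlonglongrightarrow> ginner G l v" and "q \<in> \<Gamma>"
    then obtain v where v: "v \<in> domG" "q = (v, G v)" by (auto simp: graph_of_def)
    have "(\<lambda>k. Re (ginner G (u k) v)) \<longlonglongrightarrow> Re (ginner G l v)" using w v(1) by (intro tendsto_Re) blast
    then show "(\<lambda>k. inner (u k, G (u k)) q) \<longlonglongrightarrow> inner (l, G l) q" unfolding c v(2) by (simp del: inner_Pair)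
  next
    fix v assume w: "\<forall>q\<in>\<Gamma>. (\<lambda>k. inner (u k, G (u k)) q) \<longlonglongrightarrow> inner (l, G l) q" and v: "v \<in> domG"
    have "(v, G v) \<in> \<Gamma>" "ciu2 (v, G v) \<in> \<Gamma>"
      using v invariant(1) by (auto simp: ciu_invariant_def clinear_onD(4,5)[OF G(1)])
    then show "(\<lambda>k. ginner G (u k) v) \<longlonglongrightarrow> ginner G l v"
      unfolding c using w by (intro tendsto_Complex) blast+
  qed
  then show ?thesis by (simp add: weak_conv_graph_def)
qed

end

locale boundary_trace_form = boundary_trace domG G domD D \<kappa>
  for domG :: "'a::chilbert set" and G :: "'a \<Rightarrow> 'b::chilbert"
    and domD :: "'b set" and D :: "'b \<Rightarrow> 'a" and \<kappa> :: "'a \<Rightarrow> 'h::chilbert" +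
  fixes \<mu> C :: real
  assumes mu_pos: "\<mu> > 0"
begin

text \<open>With \<open>C\<close> bounding the norm of \<open>m\<close>, the first component
  contributes at least \<open>- C * (norm u)\<^sup>2\<close> to the form. Adding \<mu> to
  \<open>C\<close> pays for its share in \<open>\<mu> * (norm x)\<^sup>2\<close>, which involves the
  full graph norm.\<close>

sublocale form: dtn_form \<Gamma> \<Gamma>0 fst J \<mu> "C + \<mu>"
  by (rule dtn_form[OF mu_pos])

lemma DtN_H_eq: "DtN_H domG G domD D \<kappa> a m = form.dtn_rel (map_prod m a)"
  by (rule set_eqI) (auto simp: mem_DtN_H_iff form.dtn_rel_def split_paired_all simp del: mem_graph_of)

lemma dirichlet_unique_if_ker_trivial:
  assumes "ker_trivial domG G domD D a m"
  shows "form.dirichlet_unique (map_prod m a)"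
proof -
  show ?thesis
    unfolding form.dirichlet_unique_def form.inner_solution_def
  proof (intro ballI impI)
    fix p assume p: "p \<in> \<Gamma>0" and s: "p \<in> \<Gamma> \<and> (\<forall>q\<in>\<Gamma>0. inner (map_prod m a p) q = 0)"
    obtain v where v: "v \<in> Gring_dom domD D" "p = (v, Gring domD D v)" using p \<Gamma>0_iff by (cases p) auto
    have "map_prod m a p \<in> orth \<Gamma>0" using s by (simp add: orth_def)
    then have "a (Gring domD D v) \<in> domD" "m v = D (a (Gring domD D v))"
      using v(2) mem_orth_\<Gamma>0_iff[of "m v"] by auto
    then have "v = 0" using assms v(1) unfolding ker_trivial_def by blast
    moreover have "G v = Gring domD D v" using Gring_domD[OF v(1)] by simp
    ultimately show "p = 0" using v(2) clinear_onD(6)[OF G(1)] by (simp add: zero_prod_def)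
  qed
qed

text \<open>Interior solutions satisfy the equation in \<open>conv_indep_bc\<close> with right-hand
  sides \<open>- mn (r k) (u k)\<close>. These converge weakly because the \<open>u k\<close>
  converge strongly; the hypothesis on \<open>an\<close> then handles the second component.\<close>

lemma conv_to_if_conv_indep_bc:
  assumes mn: "\<And>n. linear (mn n)" "\<And>n x. norm (mn n x) \<le> c * norm x"
    and m_conv: "wot_conv mn m" and a_conv: "conv_indep_bc domG G domD D an a"
  shows "form.conv_to (\<lambda>n. map_prod (mn n) (an n)) (map_prod m a)"
proof -
  show ?thesis
    unfolding form.conv_to_def
  proof (intro allI impI, elim conjE)
    fix r :: "nat \<Rightarrow> nat" and p :: "nat \<Rightarrow> 'a \<times> 'b" and l
    assume r: "strict_mono r" and sol: "\<forall>k. form.inner_solution (map_prod (mn (r k)) (an (r k))) (p k)"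
      and l: "l \<in> \<Gamma>" and w: "wconv p l" and f: "(\<lambda>k. fst (p k)) \<longlonglongrightarrow> fst l"
    define u where "u = (\<lambda>k. fst (p k))"
    have p\<Gamma>: "p k \<in> \<Gamma>" for k using sol by (simp add: form.inner_solution_def)
    have u: "u k \<in> domG" "p k = (u k, G (u k))" for k using p\<Gamma>[of k] by (auto simp: u_def graph_of_def)
    have l': "fst l \<in> domG" "l = (fst l, G (fst l))" using l by (auto simp: graph_of_def)
    have aGu: "an (r k) (G (u k)) \<in> domD" "D (an (r k) (G (u k))) = mn (r k) (u k)" for k
    proof -
      have "map_prod (mn (r k)) (an (r k)) (p k) \<in> orth \<Gamma>0"
        using sol by (simp add: form.inner_solution_def orth_def)
      then show "an (r k) (G (u k)) \<in> domD" "D (an (r k) (G (u k))) = mn (r k) (u k)"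
        using u(2)[of k] mem_orth_\<Gamma>0_iff[of "mn (r k) (u k)"] by auto
    qed
    have mu: "wconv (\<lambda>k. mn (r k) (u k)) (m (fst l))"
    proof (rule wconv_apply_strong[OF mn(1) mn(2)])
      show "wconv (\<lambda>k. mn (r k) (fst l)) (m (fst l))"
        using m_conv wconv_subseq[OF _ r, of "\<lambda>n. mn n (fst l)"] by (simp add: wot_conv_def weak_conv_iff_wconv)
      show "u \<longlonglongrightarrow> fst l" using f by (simp add: u_def)
    qed
    then have "wconv (\<lambda>k. - mn (r k) (u k)) (- m (fst l))" by (auto simp: wconv_def intro: tendsto_minus)
    then have fk: "weak_conv (\<lambda>k. - mn (r k) (u k)) (- m (fst l))" by (simp add: weak_conv_iff_wconv)
    have wg: "weak_conv_graph domG G u (fst l)"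
      unfolding weak_conv_graph_iff using u l' wconvD[OF w] by (simp del: inner_Pair)
    have "weak_conv (\<lambda>k. an (r k) (G (u k))) (a (G (fst l)))"
      using a_conv[unfolded conv_indep_bc_def, rule_format,
          of r "\<lambda>k. - mn (r k) (u k)" "- m (fst l)" u "fst l"] r fk wg aGu by simp
    then have aw: "wconv (\<lambda>k. an (r k) (G (u k))) (a (G (fst l)))" by (simp add: weak_conv_iff_wconv)
    have "(\<lambda>k. inner (mn (r k) (u k)) (fst y) + inner (an (r k) (G (u k))) (snd y))
        \<longlonglongrightarrow> inner (m (fst l)) (fst y) + inner (a (G (fst l))) (snd y)" for y
      by (intro tendsto_add wconvD[OF mu] wconvD[OF aw])
    moreover have "map_prod (mn (r k)) (an (r k)) (p k) = (mn (r k) (u k), an (r k) (G (u k)))" for k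
      by (simp add: u(2))
    moreover have "map_prod m a l = (m (fst l), a (G (fst l)))" by (subst l'(2)) simp
    ultimately show "wconv (\<lambda>k. map_prod (mn (r k)) (an (r k)) (p k)) (map_prod m a l)"
      by (simp add: wconv_def inner_prod_def)
  qed
qed

lemma garding_map_prod:
  fixes m :: "'a \<Rightarrow> 'a" and a :: "'b \<Rightarrow> 'b"
  assumes m: "cbounded m" "\<And>x. norm (m x) \<le> C * norm x" and a: "cbounded a" "coercive a \<mu>"
  shows "form.garding (map_prod m a)"
proof -
  have low: "\<mu> * (norm x)\<^sup>2 - (C + \<mu>) * (norm (fst x))\<^sup>2 \<le> inner (map_prod m a x) x" for x :: "'a \<times> 'b"
  proof -
    obtain u q where x: "x = (u, q)" by (cases x)
    have "- (C * (norm u)\<^sup>2) \<le> inner (m u) u"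
    proof -
      have "\<bar>inner (m u) u\<bar> \<le> norm (m u) * norm u" by (rule Cauchy_Schwarz_ineq2)
      also have "\<dots> \<le> C * norm u * norm u" by (intro mult_right_mono m(2)) simp
      finally show ?thesis by (simp add: power2_eq_square mult.assoc)
    qed
    moreover have "\<mu> * (norm q)\<^sup>2 \<le> inner (a q) q" using a(2) by (simp add: coercive_def Re_cinner)
    moreover have "(norm x)\<^sup>2 = (norm u)\<^sup>2 + (norm q)\<^sup>2" by (simp add: x norm_prod_def)
    ultimately show ?thesis by (simp add: x algebra_simps)
  qed
  show ?thesis
    unfolding form.garding_def
    using low m(1) a(1) by (intro conjI allI bounded_linear_map_prod) (simp_all add: cbounded_def)
qed

text \<open>Complex linearity follows from uniqueness: multiplying a solution by the imaginary unit
  solves the problem with the multiplied datum.\<close>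

lemma cbounded_J_sol:
  assumes m: "cbounded m" and a: "cbounded a" and g: "form.garding (map_prod m a)"
    and ell: "form.elliptic (map_prod m a) \<omega>" and lam: "\<omega> \<le> lam" "0 \<le> lam"
  shows "cbounded (\<lambda>f. J (form.sol (map_prod m a) lam f))"
proof (rule cboundedI)
  let ?B = "map_prod m a"
  show "bounded_linear (\<lambda>f. J (form.sol ?B lam f))"
    by (rule bounded_linear_compose[OF bounded_linear_J form.bounded_linear_sol[OF g ell lam]])
  fix f
  define p where "p = form.sol ?B lam f"
  have p: "p \<in> \<Gamma>" "\<And>q. q \<in> \<Gamma> \<Longrightarrow> inner (?B p) q + lam * inner (J p) (J q) = inner f (J q)"
    using form.solves_sol[OF g ell lam, of f] by (simp_all add: p_def form.solves_def del: mem_graph_of)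
  have "form.sol ?B lam (ciu f) = ciu2 p"
  proof (rule form.sol_eqI[OF g ell lam])
    have "inner (?B (ciu2 p)) q + lam * inner (J (ciu2 p)) (J q) = inner (ciu f) (J q)" if "q \<in> \<Gamma>" for q
    proof -
      have "ciu2 q \<in> \<Gamma>" using that invariant(1) by (simp add: ciu_invariant_def)
      from p(2)[OF this] show ?thesis
        by (simp add: map_prod_ciu2[OF m a] J_ciu2 inner_ciu2_left inner_ciu_right)
    qed
    then show "form.solves ?B lam (ciu f) (ciu2 p)"
      using p(1) invariant(1) by (simp add: form.solves_def ciu_invariant_def del: mem_graph_of)
  qed
  then show "J (form.sol ?B lam (ciu f)) = ciu (J (form.sol ?B lam f))"
    by (simp add: J_ciu2 p_def)
qed

lemma DtN_H_resolvent:
  assumes m: "cbounded m" and a: "cbounded a" and g: "form.garding (map_prod m a)"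
    and ell: "form.elliptic (map_prod m a) \<omega>" and lam: "\<omega> \<le> lam" "0 \<le> \<omega>"
  defines "L \<equiv> DtN_H domG G domD D \<kappa> a m"
  shows "resolvent (op_dom L) (op_fun L) lam = (\<lambda>f. J (form.sol (map_prod m a) lam f))"
    and "resolvent_in_L (op_dom L) (op_fun L) lam"
proof -
  have lam0: "0 \<le> lam" using lam by simp
  show res: "resolvent (op_dom L) (op_fun L) lam = (\<lambda>f. J (form.sol (map_prod m a) lam f))"
    unfolding L_def DtN_H_eq by (rule form.resolvent_dtn_rel[OF g ell lam(2,1)])
  show "resolvent_in_L (op_dom L) (op_fun L) lam"
    unfolding resolvent_in_L_def res
    using form.bij_betw_dtn_rel[OF g ell lam(2,1)] cbounded_J_sol[OF m a g ell lam(1) lam0]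
    by (simp add: L_def DtN_H_eq)
qed

text \<open>The shifted real part is at least \<open>\<mu> / 2 * (norm p)\<^sup>2\<close> by
  ellipticity, while the imaginary part equals \<open>inner (map_prod m a p) (ciu2 p)\<close> and is
  at most \<open>N * (norm p)\<^sup>2\<close> in modulus. The real shift does not affect the
  imaginary part, and the quotient of the two constants is the slope.\<close>

lemma DtN_H_sector:
  assumes g: "form.garding (map_prod m a)" and ell: "form.elliptic (map_prod m a) \<omega>" and \<omega>: "0 \<le> \<omega>"
    and bdd: "\<And>x. norm (map_prod m a x) \<le> N * norm x" and N: "0 \<le> N"
  defines "L \<equiv> DtN_H domG G domD D \<kappa> a m"
  assumes \<phi>: "\<phi> \<in> op_dom L"
  shows "\<bar>Im (cinner (op_fun L \<phi> + \<omega> *\<^sub>R \<phi>) \<phi>)\<bar> \<le> 2 * N / \<mu> * Re (cinner (op_fun L \<phi> + \<omega> *\<^sub>R \<phi>) \<phi>)"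
proof -
  let ?B = "map_prod m a"
  have L: "L = form.dtn_rel ?B" by (simp add: L_def DtN_H_eq)
  obtain \<psi> where \<psi>: "(\<phi>, \<psi>) \<in> form.dtn_rel ?B" using \<phi> by (auto simp: L op_dom_def)
  then obtain p where p: "\<phi> = J p" "p \<in> \<Gamma>" "\<And>q. q \<in> \<Gamma> \<Longrightarrow> inner (?B p) q = inner \<psi> (J q)"
    unfolding form.dtn_rel_def by blast
  have fun_eq: "op_fun L \<phi> = \<psi>" unfolding L by (rule form.op_fun_dtn_rel[OF g ell \<omega> \<psi>])
  have "inner (?B p) q = 0" if "q \<in> \<Gamma>0" for q
    using p(3)[of q] that \<Gamma>0_subset form.J_S0[OF that] by auto
  then have "\<mu> / 2 * (norm p)\<^sup>2 \<le> inner (?B p) p + \<omega> * (norm (J p))\<^sup>2"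
    using ell p(2) unfolding form.elliptic_def form.inner_solution_def by blast
  also have "\<dots> = Re (cinner (op_fun L \<phi> + \<omega> *\<^sub>R \<phi>) \<phi>)"
    unfolding fun_eq using p(3)[OF p(2)] by (simp add: Re_cinner inner_add_left p(1) power2_norm_eq_inner)
  finally have re: "\<mu> / 2 * (norm p)\<^sup>2 \<le> Re (cinner (op_fun L \<phi> + \<omega> *\<^sub>R \<phi>) \<phi>)" .
  have ip: "ciu2 p \<in> \<Gamma>" using p(2) invariant(1) by (simp add: ciu_invariant_def)
  have "Im (cinner (op_fun L \<phi> + \<omega> *\<^sub>R \<phi>) \<phi>) = inner \<psi> (J (ciu2 p))"
    unfolding fun_eq by (simp add: Im_cinner ciu_add ciu_scaleR inner_add_left inner_ciu_self J_ciu2 inner_ciu_right p(1))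
  also have "\<dots> = inner (?B p) (ciu2 p)" using p(3)[OF ip] by simp
  finally have "\<bar>Im (cinner (op_fun L \<phi> + \<omega> *\<^sub>R \<phi>) \<phi>)\<bar> \<le> norm (?B p) * norm p"
    using Cauchy_Schwarz_ineq2[of "?B p" "ciu2 p"] by (simp add: norm_ciu2)
  also have "\<dots> \<le> N * norm p * norm p" by (intro mult_right_mono bdd) simp
  also have "\<dots> = 2 * N / \<mu> * (\<mu> / 2 * (norm p)\<^sup>2)" using mu_pos by (simp add: power2_eq_square)
  also have "\<dots> \<le> 2 * N / \<mu> * Re (cinner (op_fun L \<phi> + \<omega> *\<^sub>R \<phi>) \<phi>)"
    using N mu_pos by (intro mult_left_mono re) simp
  finally show ?thesis .
qed

end


theorem theorem6p4:
  fixes domG :: "'a::chilbert set" and G :: "'a \<Rightarrow> 'b::chilbert"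
    and domD :: "'b set" and D :: "'b \<Rightarrow> 'a"
    and \<kappa> :: "'a \<Rightarrow> 'h::chilbert"
    and a :: "'b \<Rightarrow> 'b" and an :: "nat \<Rightarrow> 'b \<Rightarrow> 'b"
    and m :: "'a \<Rightarrow> 'a" and mn :: "nat \<Rightarrow> 'a \<Rightarrow> 'a"
    and \<mu> :: real
  assumes G_op: "dd_closed_op domG G"
    and D_op: "dd_closed_op domD D"
    and G_adj_sub: "adj_dom domG G \<subseteq> domD \<and> (\<forall>y\<in>adj_dom domG G. D y = - adj domG G y)"
    and cpt_emb: "compact_embedding domG G"
    and kappa_L: "bounded_on_graph (BD_G domG G domD D) G \<kappa>"
    and kappa_inj: "inj_on \<kappa> (BD_G domG G domD D)"
    and kappa_dense: "closure (\<kappa> ` BD_G domG G domD D) = UNIV"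
    and a_L: "cbounded a" and an_L: "\<And>n. cbounded (an n)"
    and m_L: "cbounded m" and mn_L: "\<And>n. cbounded (mn n)"
    and mu_pos: "\<mu> > 0"
    and an_coer: "\<And>n. coercive (an n) \<mu>" and a_coer: "coercive a \<mu>"
    and an_bdd: "\<exists>C. \<forall>n. onorm (an n) \<le> C"
    and a_conv: "conv_indep_bc domG G domD D an a"
    and m_conv: "wot_conv mn m"
    and ker_n: "\<And>n. ker_trivial domG G domD D (an n) (mn n)"
    and ker: "ker_trivial domG G domD D a m"
  shows
    "uniformly_sectorial (\<lambda>n. op_dom (DtN_H domG G domD D \<kappa> (an n) (mn n)))
                         (\<lambda>n. op_fun (DtN_H domG G domD D \<kappa> (an n) (mn n)))
     \<and> (\<exists>lam0>(0::real). \<forall>lam>lam0.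
          (\<forall>n. resolvent_in_L (op_dom (DtN_H domG G domD D \<kappa> (an n) (mn n)))
                               (op_fun (DtN_H domG G domD D \<kappa> (an n) (mn n))) lam)
        \<and> resolvent_in_L (op_dom (DtN_H domG G domD D \<kappa> a m)) (op_fun (DtN_H domG G domD D \<kappa> a m)) lam
        \<and> wot_conv (\<lambda>n. resolvent (op_dom (DtN_H domG G domD D \<kappa> (an n) (mn n)))
                                    (op_fun (DtN_H domG G domD D \<kappa> (an n) (mn n))) lam)
                   (resolvent (op_dom (DtN_H domG G domD D \<kappa> a m)) (op_fun (DtN_H domG G domD D \<kappa> a m)) lam))
     \<and> (compact_on_graph (BD_G domG G domD D) G \<kappa> \<longrightarrow>
        (\<exists>lam0>(0::real). \<forall>lam>lam0.
          (\<lambda>n. onorm (\<lambda>f. resolvent (op_dom (DtN_H domG G domD D \<kappa> (an n) (mn n)))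
                                      (op_fun (DtN_H domG G domD D \<kappa> (an n) (mn n))) lam f
                        - resolvent (op_dom (DtN_H domG G domD D \<kappa> a m))
                                      (op_fun (DtN_H domG G domD D \<kappa> a m)) lam f))
          \<longlonglongrightarrow> 0))"
proof -
  interpret T: boundary_trace domG G domD D \<kappa>
    by unfold_locales (rule G_op D_op G_adj_sub cpt_emb kappa_L kappa_inj kappa_dense)+
  obtain Ca where Ca: "\<And>n. onorm (an n) \<le> Ca" using an_bdd by blast
  have an_norm: "norm (an n x) \<le> Ca * norm x" for n x
    using onorm[of "an n" x] an_L[of n] mult_right_mono[OF Ca norm_ge_zero, of n x]
    by (simp add: cbounded_def)
  \<comment> \<open>Convergence in the weak operator topology bounds the operators uniformly; one
    Garding inequality can then serve the whole sequence.\<close>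
  obtain Cn where Cn: "\<And>n x. norm (mn n x) \<le> Cn * norm x"
    using weakly_pointwise_bounded[of mn m] mn_L m_conv
    by (auto simp: cbounded_def wot_conv_def weak_conv_iff_wconv)
  obtain Cm where Cm: "\<And>x. norm (m x) \<le> norm x * Cm"
    using bounded_linear.bounded[of m] m_L by (auto simp: cbounded_def)
  define C where "C = max \<bar>Cn\<bar> \<bar>Cm\<bar>"
  have "Cn \<le> C" "Cm \<le> C" by (auto simp: C_def)
  have mn_norm: "norm (mn n x) \<le> C * norm x" for n x
    using Cn[of n x] mult_right_mono[OF \<open>Cn \<le> C\<close> norm_ge_zero, of x] by simp
  have m_norm: "norm (m x) \<le> C * norm x" for x
    using Cm[of x] mult_right_mono[OF \<open>Cm \<le> C\<close> norm_ge_zero, of x] by (simp add: mult.commute)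
  interpret T: boundary_trace_form domG G domD D \<kappa> \<mu> C
    by unfold_locales (rule mu_pos)
  let ?Bn = "\<lambda>n. map_prod (mn n) (an n)" and ?B = "map_prod m a"
  have gn: "T.form.garding (?Bn n)" for n
    by (rule T.garding_map_prod[OF mn_L mn_norm an_L an_coer])
  have g: "T.form.garding ?B"
    by (rule T.garding_map_prod[OF m_L m_norm a_L a_coer])
  have conv: "T.form.conv_to ?Bn ?B"
    using mn_L by (intro T.conv_to_if_conv_indep_bc[OF _ mn_norm m_conv a_conv])
      (simp add: cbounded_def bounded_linear.linear)
  \<comment> \<open>This single constant is the shift in the sectoriality estimate and the threshold
    \<open>lam0\<close> in both resolvent statements.\<close>
  obtain \<omega> where \<omega>: "\<omega> > 0" "\<And>n. T.form.elliptic (?Bn n) \<omega>" "T.form.elliptic ?B \<omega>"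
    by (rule T.form.uniformly_elliptic[OF gn g conv T.dirichlet_unique_if_ker_trivial[OF ker_n]
          T.dirichlet_unique_if_ker_trivial[OF ker]]) blast
  note resn = T.DtN_H_resolvent[OF mn_L an_L gn \<omega>(2) _ less_imp_le[OF \<omega>(1)]]
    and res = T.DtN_H_resolvent[OF m_L a_L g \<omega>(3) _ less_imp_le[OF \<omega>(1)]]
  have Bn_norm: "norm (?Bn n x) \<le> (C + \<bar>Ca\<bar>) * norm x" for n x
  proof -
    have "norm (?Bn n x) \<le> norm (mn n (fst x)) + norm (an n (snd x))"
      by (cases x) (simp add: norm_Pair_le)
    also have "\<dots> \<le> C * norm (fst x) + Ca * norm (snd x)" by (intro add_mono mn_norm an_norm)
    also have "\<dots> \<le> C * norm x + \<bar>Ca\<bar> * norm x"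
      using norm_fst_le[of "fst x" "snd x"] norm_snd_le[of "snd x" "fst x"]
      by (intro add_mono mult_mono) (simp_all add: C_def)
    finally show ?thesis by (simp add: distrib_right)
  qed
  have N: "0 \<le> C + \<bar>Ca\<bar>" by (simp add: C_def)
  show ?thesis
  proof (intro conjI impI exI[where x = \<omega>] allI \<omega>(1))
    show "uniformly_sectorial (\<lambda>n. op_dom (DtN_H domG G domD D \<kappa> (an n) (mn n)))
        (\<lambda>n. op_fun (DtN_H domG G domD D \<kappa> (an n) (mn n)))"
      unfolding uniformly_sectorial_def
    proof (rule exI[of _ \<omega>], rule exI[of _ "2 * (C + \<bar>Ca\<bar>) / \<mu>"], intro conjI allI ballI)
      show "0 \<le> 2 * (C + \<bar>Ca\<bar>) / \<mu>" using N mu_pos by simp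
    qed (rule T.DtN_H_sector[OF gn \<omega>(2) less_imp_le[OF \<omega>(1)] Bn_norm N])
    fix lam :: real assume lam: "\<omega> < lam"
    then have lam': "\<omega> \<le> lam" "0 \<le> lam" using \<omega>(1) by auto
    show "resolvent_in_L (op_dom (DtN_H domG G domD D \<kappa> (an n) (mn n)))
        (op_fun (DtN_H domG G domD D \<kappa> (an n) (mn n))) lam" for n
      by (rule resn(2)[OF lam'(1)])
    show "resolvent_in_L (op_dom (DtN_H domG G domD D \<kappa> a m)) (op_fun (DtN_H domG G domD D \<kappa> a m)) lam"
      by (rule res(2)[OF lam'(1)])
    show "wot_conv (\<lambda>n. resolvent (op_dom (DtN_H domG G domD D \<kappa> (an n) (mn n)))
          (op_fun (DtN_H domG G domD D \<kappa> (an n) (mn n))) lam)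
        (resolvent (op_dom (DtN_H domG G domD D \<kappa> a m)) (op_fun (DtN_H domG G domD D \<kappa> a m)) lam)"
      unfolding resn(1)[OF lam'(1)] res(1)[OF lam'(1)] wot_conv_def weak_conv_iff_wconv
      by (intro allI T.form.sol_wconv[OF gn \<omega>(2) g \<omega>(3) conv lam'])
    assume "compact_on_graph (BD_G domG G domD D) G \<kappa>"
    then have "compact_map_on T.\<Gamma> T.J" by (rule T.compact_map_on_J)
    then show "(\<lambda>n. onorm (\<lambda>f. resolvent (op_dom (DtN_H domG G domD D \<kappa> (an n) (mn n)))
          (op_fun (DtN_H domG G domD D \<kappa> (an n) (mn n))) lam f
        - resolvent (op_dom (DtN_H domG G domD D \<kappa> a m))
          (op_fun (DtN_H domG G domD D \<kappa> a m)) lam f)) \<longlonglongrightarrow> 0"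
      unfolding resn(1)[OF lam'(1)] res(1)[OF lam'(1)]
      by (rule T.form.sol_onorm_conv[OF gn \<omega>(2) g \<omega>(3) conv lam'])
  qed
qed

end
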